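(* Let $r\in\mathbb{N}$ and $1<p<+\infty$. There are constants $K_1,C_1>0$, independent of $f$ and $W$, such that for every $f\in\Lambda^p$ and every $W>0$ $$\|f-S_W(f)\|_p\le K_1\|\tilde f_{1/W,r}-f\|_{\ell_p(\Sigma_W)}+C_1\,\omega_r(f,1/W)_p.$$ In particular, $$\|f-S_W(f)\|_p\le\max\{K_1,C_1\}\,\tilde\Omega_{r,r}\left(f,\tfrac1W,\Sigma_W\right)_p.$$
   Context: $S_W$ denotes the Shannon sampling series $(S_Wf)(t)=\sum_{k=-\infty}^\infty f\big(\frac kW\big)\operatorname{sinc}(Wt-k)$, $t\in\mathbb{R}$, $W>0$, where $\operatorname{sinc}(x)=\frac{\sin(\pi x)}{\pi x}$ for $x\ne0$ and $\operatorname{sinc}(0)=1$. Conventions: $\mathbb{N}=\{1,2,\dots\}$; functions are defined pointwise (functions equal almost everywhere are not identified); $\|\cdot\|_p$ is the $L^p(\mathbb{R})$ norm. $M(\mathbb{R})$ is the set of bounded measurable functions on $\mathbb{R}$. A sequence $\Sigma=(x_j)_{j\in\mathbb{Z}}\subset\mathbb{R}$ is admissible if $0<\inf_j(x_j-x_{j-1})\le\sup_j(x_j-x_{j-1})<\infty$; put $\|f\|_{\ell_p(\Sigma)}=\big(\sum_{j\in\mathbb{Z}}|f(x_j)|^p(x_j-x_{j-1})\big)^{1/p}$. $\Lambda^p=\{f\in M(\mathbb{R}):\|f\|_{\ell_p(\Sigma)}<\infty\text{ for every admissible }\Sigma\}\subset L^p(\mathbb{R})$. $\Sigma_W=(j/W)_{j\in\mathbb{Z}}$,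 so $\|f\|_{\ell_p(\Sigma_W)}=\big(\frac1W\sum_{j\in\mathbb{Z}}|f(j/W)|^p\big)^{1/p}$. Modulus of smoothness: $\Delta_h^r f(x)=\sum_{k=0}^r\binom rk(-1)^{r-k}f(x+kh)$, $\omega_r(f,\delta)_p=\sup_{0<h\le\delta}\|\Delta_h^rf\|_p$. Steklov averages ($\delta>0$): $\tilde f_{\delta,r}(x)=(-\delta)^{-r}\int_0^\delta\cdots\int_0^\delta\sum_{m=1}^r(-1)^{r-m+1}\binom rm f\big(x+\frac mr(t_1+\dots+t_r)\big)\,dt_1\cdots dt_r$. Semi-discrete modulus: $\tilde\Omega_{r,r}(f,\frac1W,\Sigma_W)_p=\|\tilde f_{1/W,r}-f\|_{\ell_p(\Sigma_W)}+\omega_r(f,1/W)_p$. *)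

theory Defs
  imports "HOL-Analysis.Analysis"
begin

definition sinc_pi :: "real \<Rightarrow> real" where
  "sinc_pi x = (if x = 0 then 1 else sin (pi * x) / (pi * x))"

(* The unordered sum is 0 by convention if the series does not converge absolutely. For f in
   Lambda_space p with 1 < p < \<infinity> it always does, by Hoelder's inequality: the samples of f are
   in l^p and the sinc coefficients are in l^q for the conjugate exponent q > 1. *)
definition sampling_series :: "real \<Rightarrow> (real \<Rightarrow> complex) \<Rightarrow> real \<Rightarrow> complex" where
  "sampling_series W f t =
     (\<Sum>\<^sub>\<infinity>k::int. f (of_int k / W) * complex_of_real (sinc_pi (W * t - of_int k)))"

(* The power a^(1/p) on [0,\<infinity>], with \<infinity>^(1/p) = \<infinity>. *)
definition ennroot :: "real \<Rightarrow> ennreal \<Rightarrow> ennreal" where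
  "ennroot p a = (if a = \<infinity> then \<infinity> else ennreal (enn2real a powr (1 / p)))"

(* Norms and moduli take values in [0,\<infinity>], so that they are meaningful without any
   integrability or summability assumption. *)
definition Lp_norm :: "real \<Rightarrow> (real \<Rightarrow> complex) \<Rightarrow> ennreal" where
  "Lp_norm p f = ennroot p (\<integral>\<^sup>+ x. ennreal (norm (f x) powr p) \<partial>lebesgue)"

definition lp_norm :: "real \<Rightarrow> (int \<Rightarrow> real) \<Rightarrow> (real \<Rightarrow> complex) \<Rightarrow> ennreal" where
  "lp_norm p \<Sigma> f =
     ennroot p (\<Sum>\<^sub>\<infinity>j::int. ennreal (norm (f (\<Sigma> j)) powr p * (\<Sigma> j - \<Sigma> (j - 1))))"

(* The infimum and supremum are taken in the extended reals: on the type real they are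
   unspecified for unbounded families. *)
definition admissible :: "(int \<Rightarrow> real) \<Rightarrow> bool" where
  "admissible \<Sigma> \<longleftrightarrow>
     0 < (INF j. ereal (\<Sigma> j - \<Sigma> (j - 1))) \<and> (SUP j. ereal (\<Sigma> j - \<Sigma> (j - 1))) < \<infinity>"

definition uniform_grid :: "real \<Rightarrow> int \<Rightarrow> real" where
  "uniform_grid W j = of_int j / W"

definition bounded_measurable :: "(real \<Rightarrow> complex) set" where
  "bounded_measurable = {f \<in> borel_measurable lebesgue. bounded (range f)}"

definition Lambda_space :: "real \<Rightarrow> (real \<Rightarrow> complex) set" where
  "Lambda_space p = {f \<in> bounded_measurable. \<forall>\<Sigma>. admissible \<Sigma> \<longrightarrow> lp_norm p \<Sigma> f < \<infinity>}"

definition fwd_difference :: "nat \<Rightarrow> real \<Rightarrow> (real \<Rightarrow> complex) \<Rightarrow> real \<Rightarrow> complex" where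
  "fwd_difference r h f x =
     (\<Sum>k=0..r. of_nat (r choose k) * (-1) ^ (r - k) * f (x + real k * h))"

definition modulus_of_smoothness :: "nat \<Rightarrow> (real \<Rightarrow> complex) \<Rightarrow> real \<Rightarrow> real \<Rightarrow> ennreal" where
  "modulus_of_smoothness r f \<delta> p = (SUP h\<in>{0<..\<delta>}. Lp_norm p (fwd_difference r h f))"

(* The n-fold iterated integral of F over [0,\<delta>]^n, where F receives [t_1, ..., t_n].
   Iterated Lebesgue integrals are used because functions that are only Lebesgue measurable
   need not be measurable for the product sigma-algebra. *)
primrec iterated_integral ::
    "real \<Rightarrow> nat \<Rightarrow> (real list \<Rightarrow> complex) \<Rightarrow> complex" where
  "iterated_integral \<delta> 0 F = F []"
| "iterated_integral \<delta> (Suc n) F =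
     (LINT t:{0..\<delta>}|lebesgue. iterated_integral \<delta> n (\<lambda>ts. F (t # ts)))"

definition steklov :: "real \<Rightarrow> nat \<Rightarrow> (real \<Rightarrow> complex) \<Rightarrow> real \<Rightarrow> complex" where
  "steklov \<delta> r f x =
     complex_of_real ((- \<delta>) powi (- int r)) *
     iterated_integral \<delta> r (\<lambda>ts. \<Sum>m=1..r. (-1) ^ (r - m + 1) * of_nat (r choose m) *
        f (x + real m / real r * sum_list ts))"

(* The first summand of this modulus uses Steklov averages of order r and the second the
   classical modulus of the same order r. *)
definition semi_discrete_modulus ::
    "nat \<Rightarrow> (real \<Rightarrow> complex) \<Rightarrow> real \<Rightarrow> (int \<Rightarrow> real) \<Rightarrow> real \<Rightarrow> ennreal" where
  "semi_discrete_modulus r f \<delta> \<Sigma> p =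
     lp_norm p \<Sigma> (\<lambda>x. steklov \<delta> r f x - f x) + modulus_of_smoothness r f \<delta> p"

end

theory Submission
  imports Defs "HOL-Probability.Sinc_Integral" "HOL-Complex_Analysis.Complex_Analysis"
begin

text \<open>Rescaling by \<open>x \<mapsto> x / W\<close> turns the claim into the case \<open>W = 1\<close>, with constants that do not see
\<open>W\<close>. Write \<open>S d (x) = (\<Sum>k. d k * sinc (x - k))\<close> for a sequence \<open>d\<close>, write \<open>u|Z\<close> for the samples
of \<open>u\<close> at the integers, and let \<open>g\<close> be the Steklov average of \<open>f\<close>. The proof inserts a band-limited
function \<open>\<Phi> f\<close> which is close to \<open>f\<close> and which \<open>S\<close> reproduces, \<open>S (\<Phi> f|Z) = \<Phi> f\<close>, and reads off

\<open>f - S (f|Z) = (f - \<Phi> f) + S ((\<Phi> f - g)|Z) + S ((g - f)|Z)\<close>.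

The last term is the discrete part of the bound as soon as \<open>S\<close> maps \<open>lp\<close> boundedly into \<open>Lp\<close>
(\<open>sinc_series_bounded\<close>). This is where \<open>1 < p < \<infinity>\<close> is essential: it is M. Riesz's theorem on the
Hilbert transform in disguise. For \<open>p \<le> 2\<close> it follows from a trigonometric inequality of Pichorides
and from the vanishing of the integral of \<open>F\<^sup>p\<close> along a horizontal line, where \<open>F\<close> is holomorphic with
positive real part in the upper half-plane (\<open>riesz_line_bound\<close>); duality gives \<open>p \<ge> 2\<close>.

For the first term take \<open>\<Phi> = I - (I - P)\<^sup>r\<close>, where \<open>P\<close> is the convolution with a finite combination
\<open>theta\<close> of shifted sinc functions that decays fast and has integral one. Then \<open>(I - P)\<^sup>r f\<close> is an
average of mixed differences of \<open>f\<close> with arbitrary steps. An identity of Kemperman writes mixed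
differences as sums of pure \<open>r\<close>-th differences (\<open>mixed_diff_via_fwd_difference\<close>), and these are
controlled by the modulus of smoothness (\<open>Lp_pow_mixed_diff\<close>, \<open>Lp_pow_residual_pow\<close>). That \<open>S\<close>
reproduces \<open>\<Phi> f\<close> reduces to \<open>(\<Sum>k. sinc (k - y) * sinc (x - k)) = sinc (x - y)\<close>, which is the
partial fraction expansion of the cotangent (\<open>sinc_series_sinc_shift\<close>, \<open>sampling_theorem_conv\<close>).

For the middle term, the Steklov average is also a convolution, with kernel \<open>\<kappa>\<close>
(\<open>steklov_kernel\<close>), and convolutions commute. Hence \<open>g - \<Phi> f\<close> equals
\<open>\<kappa> * (f - \<Phi> f) - \<Phi> (f - \<kappa> * f)\<close>. Both inner differences are \<open>Lp\<close>-small, and the convolutions with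
\<open>\<kappa>\<close> and with \<open>theta\<close> map \<open>Lp\<close> boundedly into \<open>lp\<close> after sampling (\<open>Lp_pow_conv_integers\<close>).

Only the existence of constants matters. So all estimates are for \<open>p\<close>-th powers of norms with values
in \<open>[0, \<infinity>]\<close>, the triangle inequality costs a factor \<open>2\<^sup>p\<close>, and one crude form of Jensen's inequality
(\<open>weighted_power_mean\<close>) replaces the integral inequalities of Minkowski and Young.
Functions of the space \<open>\<Lambda>\<close> belong to \<open>Lp\<close> (\<open>Lambda_space_Lp\<close>), so the sinc series of the samples of a
convolution, like that of the samples of \<open>f\<close>, converges absolutely.\<close>

section \<open>Powers of extended nonnegative reals and the Schur test\<close>

definition ennpow :: "real \<Rightarrow> ennreal \<Rightarrow> ennreal" where "ennpow p = ennroot (1 / p)"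

lemma ennpow_ennreal: "0 \<le> a \<Longrightarrow> ennpow p (ennreal a) = ennreal (a powr p)"
  by (simp add: ennpow_def ennroot_def)

lemma ennpow_top [simp]: "ennpow p top = top"
  by (simp add: ennpow_def ennroot_def)

lemma ennpow_0 [simp]: "ennpow p 0 = 0"
  by (simp add: ennpow_def ennroot_def)

lemma ennpow_measurable [measurable]: "ennpow p \<in> borel_measurable borel"
  unfolding ennpow_def ennroot_def by measurable

lemma ennpow_mono:
  assumes "0 < p" "a \<le> b" shows "ennpow p a \<le> ennpow p b"
  using assms by (cases a; cases b) (auto simp: ennpow_ennreal top_unique intro!: ennreal_leI powr_mono2)

lemma ennpow_mult: "ennpow p (a * b) = ennpow p a * ennpow p b"
proof (cases a)
  case (real x)
  show ?thesis
  proof (cases b)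
    case (real y)
    with \<open>a = ennreal x\<close> \<open>0 \<le> x\<close> show ?thesis
      by (simp add: ennpow_ennreal powr_mult flip: ennreal_mult)
  next
    case top
    with real show ?thesis
      by (cases "x = 0") (auto simp: ennpow_ennreal ennreal_mult_top)
  qed
next
  case top
  show ?thesis
  proof (cases b)
    case (real y)
    with top show ?thesis
      by (cases "y = 0") (auto simp: ennpow_ennreal ennreal_top_mult)
  qed (use top in simp)
qed

lemma powr_add_le:
  fixes a b :: real
  assumes "0 \<le> a" "0 \<le> b" "0 < p"
  shows "(a + b) powr p \<le> 2 powr p * (a powr p + b powr p)"
proof -
  have "(a + b) powr p \<le> (2 * max a b) powr p"
    using assms by (intro powr_mono2) auto
  also have "\<dots> = 2 powr p * max a b powr p"
    using assms by (simp add: powr_mult)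
  also have "\<dots> \<le> 2 powr p * (a powr p + b powr p)"
    by (intro mult_left_mono) (auto simp: max_def)
  finally show ?thesis .
qed

lemma ennpow_add_le:
  assumes "0 < p"
  shows "ennpow p (a + b) \<le> ennreal (2 powr p) * (ennpow p a + ennpow p b)"
proof (cases "a = top \<or> b = top")
  case True
  then show ?thesis by (auto simp: ennreal_mult_top)
next
  case False
  then obtain x y where xy: "a = ennreal x" "b = ennreal y" "0 \<le> x" "0 \<le> y"
    by (metis ennreal_cases)
  have "ennpow p (a + b) = ennreal ((x + y) powr p)"
    using xy by (simp add: ennpow_ennreal flip: ennreal_plus)
  also have "\<dots> \<le> ennreal (2 powr p * (x powr p + y powr p))"
    using xy assms by (intro ennreal_leI powr_add_le) auto
  also have "\<dots> = ennreal (2 powr p) * (ennpow p a + ennpow p b)"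
    using xy by (simp add: ennpow_ennreal ennreal_mult ennreal_plus)
  finally show ?thesis .
qed

text \<open>If \<open>a > l\<close> then \<open>a = a\<^bsup>1 - p\<^esup> * a\<^bsup>p\<^esup>\<close>, and \<open>1 - p < 0\<close>. This trades \<open>a\<close> for its \<open>p\<close>-th power
at the price of a free parameter \<open>l\<close>, and plays the part of Hoelder's inequality below.\<close>

lemma le_add_ennpow:
  assumes "1 < p" "0 < l"
  shows "a \<le> ennreal l + ennreal (l powr (1 - p)) * ennpow p a"
proof (cases a)
  case (real x)
  show ?thesis
  proof (cases "x \<le> l")
    case True
    then show ?thesis using real by (intro order_trans[OF _ add_increasing2]) (auto intro: ennreal_leI)
  next
    case False
    then have x: "0 < x" "l < x" using assms by auto
    have "x = x powr (1 - p) * x powr p" using x by (simp flip: powr_add)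
    also have "\<dots> \<le> l powr (1 - p) * x powr p"
      using x assms by (intro mult_right_mono powr_mono2') auto
    finally have "a \<le> ennreal (l powr (1 - p) * x powr p)" using real by (auto intro: ennreal_leI)
    also have "\<dots> = ennreal (l powr (1 - p)) * ennpow p a" using real by (simp add: ennpow_ennreal ennreal_mult)
    finally show ?thesis by (rule add_increasing[rotated]) simp
  qed
next
  case top
  then show ?thesis using assms by (simp add: ennreal_mult_top)
qed

text \<open>Jensen's inequality for the measure with density \<open>k\<close> and mass at most \<open>A\<close>, up to the factor
\<open>2\<^sup>p\<close>. Integrating \<open>le_add_ennpow\<close> against \<open>k\<close> gives it once \<open>l\<close> is chosen to balance both terms.\<close>

lemma weighted_power_mean:
  assumes p: "1 < p" and A: "0 < A" and kA: "(\<integral>\<^sup>+x. k x \<partial>M) \<le> ennreal A"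
    and [measurable]: "k \<in> borel_measurable M" "a \<in> borel_measurable M"
  shows "ennpow p (\<integral>\<^sup>+x. k x * a x \<partial>M) \<le> ennreal (2 powr p * A powr (p - 1)) * (\<integral>\<^sup>+x. k x * ennpow p (a x) \<partial>M)"
    (is "ennpow p ?J \<le> _ * ?I")
proof -
  have J: "?J \<le> ennreal (l * A) + ennreal (l powr (1 - p)) * ?I" if l: "0 < l" for l
  proof -
    have "?J \<le> (\<integral>\<^sup>+x. ennreal l * k x + ennreal (l powr (1 - p)) * (k x * ennpow p (a x)) \<partial>M)"
    proof (rule nn_integral_mono)
      fix x
      have "k x * a x \<le> k x * (ennreal l + ennreal (l powr (1 - p)) * ennpow p (a x))"
        using le_add_ennpow[OF p l] by (rule mult_left_mono) simp
      then show "k x * a x \<le> ennreal l * k x + ennreal (l powr (1 - p)) * (k x * ennpow p (a x))"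
        by (simp add: algebra_simps)
    qed
    also have "\<dots> = ennreal l * (\<integral>\<^sup>+x. k x \<partial>M) + ennreal (l powr (1 - p)) * ?I"
      by (subst nn_integral_add) (auto simp: nn_integral_cmult)
    also have "\<dots> \<le> ennreal l * ennreal A + ennreal (l powr (1 - p)) * ?I"
      using kA by (intro add_mono mult_left_mono) auto
    also have "ennreal l * ennreal A = ennreal (l * A)"
      using l A by (intro ennreal_mult[symmetric]) auto
    finally show ?thesis .
  qed
  show ?thesis
  proof (cases ?I)
    case top
    then show ?thesis using A by (simp add: ennreal_mult_top)
  next
    case (real I)
    show ?thesis
    proof (cases "I = 0")
      case True
      have "?J \<le> ennreal e" if "0 < e" for e
        using J[of "e / A"] that A True real by auto
      then have "?J = 0"
        by (metis add_0 ennreal_le_epsilon le_zero_eq)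
      then show ?thesis by simp
    next
      case False
      then have I: "0 < I" using real by simp
      \<comment> \<open>For this \<open>l\<close> both terms of the bound equal \<open>l * A\<close>.\<close>
      define l where "l = (I / A) powr (1 / p)"
      have l: "0 < l" using I A by (simp add: l_def)
      have "l powr p = I / A" using I A p by (simp add: l_def powr_powr)
      then have Il: "I = A * l powr p" using A by (simp add: field_simps)
      have "l powr (1 - p) * l powr p = l" using l by (simp flip: powr_add)
      then have "l powr (1 - p) * I = l * A" by (simp add: Il)
      then have "?J \<le> ennreal (2 * l * A)"
        using J[OF l] real l A I by (simp add: mult_ac flip: ennreal_mult ennreal_plus)
      then have "ennpow p ?J \<le> ennreal ((2 * l * A) powr p)"
        using ennpow_mono[of p _ "ennreal (2 * l * A)"] p l A by (simp add: ennpow_ennreal)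
      also have "(2 * l * A) powr p = 2 powr p * A powr (p - 1) * I"
        using l A by (simp add: powr_mult Il powr_diff)
      finally show ?thesis using real by (simp add: ennreal_mult)
    qed
  qed
qed

text \<open>A kernel with uniformly bounded row and column integrals is bounded on \<open>Lp\<close>: apply Jensen's
inequality in \<open>y\<close> for each \<open>x\<close>, then interchange the integrals. Both measures are arbitrary, so that
the same lemma serves sequences and functions.\<close>

lemma schur_test:
  assumes p: "1 < p" and A: "0 < A"
    and "sigma_finite_measure M" "sigma_finite_measure N"
    and k [measurable]: "(\<lambda>(x, y). k x y) \<in> borel_measurable (M \<Otimes>\<^sub>M N)"
    and h [measurable]: "h \<in> borel_measurable N"
    and kx: "\<And>x. x \<in> space M \<Longrightarrow> (\<integral>\<^sup>+y. k x y \<partial>N) \<le> ennreal A"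
    and ky: "\<And>y. y \<in> space N \<Longrightarrow> (\<integral>\<^sup>+x. k x y \<partial>M) \<le> ennreal A"
  shows "(\<integral>\<^sup>+x. ennpow p (\<integral>\<^sup>+y. k x y * h y \<partial>N) \<partial>M)
     \<le> ennreal (2 powr p * A powr p) * (\<integral>\<^sup>+y. ennpow p (h y) \<partial>N)"
proof -
  interpret M: sigma_finite_measure M by fact
  interpret N: sigma_finite_measure N by fact
  interpret pair_sigma_finite M N ..
  have "(\<integral>\<^sup>+x. ennpow p (\<integral>\<^sup>+y. k x y * h y \<partial>N) \<partial>M)
     \<le> (\<integral>\<^sup>+x. ennreal (2 powr p * A powr (p - 1)) * (\<integral>\<^sup>+y. k x y * ennpow p (h y) \<partial>N) \<partial>M)"
    by (intro nn_integral_mono weighted_power_mean p A kx) auto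
  also have "\<dots> = ennreal (2 powr p * A powr (p - 1)) * (\<integral>\<^sup>+x. \<integral>\<^sup>+y. k x y * ennpow p (h y) \<partial>N \<partial>M)"
    by (intro nn_integral_cmult) measurable
  also have "(\<integral>\<^sup>+x. \<integral>\<^sup>+y. k x y * ennpow p (h y) \<partial>N \<partial>M) = (\<integral>\<^sup>+y. \<integral>\<^sup>+x. k x y * ennpow p (h y) \<partial>M \<partial>N)"
    by (rule Fubini'[symmetric]) measurable
  also have "\<dots> = (\<integral>\<^sup>+y. (\<integral>\<^sup>+x. k x y \<partial>M) * ennpow p (h y) \<partial>N)"
    by (intro nn_integral_cong nn_integral_multc) measurable
  also have "\<dots> \<le> (\<integral>\<^sup>+y. ennreal A * ennpow p (h y) \<partial>N)"
    by (intro nn_integral_mono mult_right_mono ky) auto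
  also have "\<dots> = ennreal A * (\<integral>\<^sup>+y. ennpow p (h y) \<partial>N)"
    by (intro nn_integral_cmult) measurable
  finally have "(\<integral>\<^sup>+x. ennpow p (\<integral>\<^sup>+y. k x y * h y \<partial>N) \<partial>M)
     \<le> ennreal (2 powr p * A powr (p - 1)) * (ennreal A * (\<integral>\<^sup>+y. ennpow p (h y) \<partial>N))"
    by (simp add: mult_left_mono)
  also have "\<dots> = ennreal (2 powr p * A powr (p - 1) * A) * (\<integral>\<^sup>+y. ennpow p (h y) \<partial>N)"
    using A by (simp add: ennreal_mult mult.assoc)
  also have "2 powr p * A powr (p - 1) * A = 2 powr p * A powr p"
    using A by (simp add: powr_diff)
  finally show ?thesis .
qed

section \<open>Sums over the integers and the Cauchy kernel\<close>

abbreviation Z :: "int measure" where "Z \<equiv> count_space UNIV"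

lemma infsum_eq_nn_integral_int:
  fixes g :: "int \<Rightarrow> ennreal"
  shows "infsum g UNIV = (\<integral>\<^sup>+k. g k \<partial>Z)"
proof (rule antisym)
  have "sum g F \<le> (\<integral>\<^sup>+k. g k \<partial>Z)" if "finite F" for F
  proof -
    have "sum g F = (\<integral>\<^sup>+k. g k * indicator F k \<partial>Z)"
      using that by (simp add: nn_integral_indicator_finite)
    also have "\<dots> \<le> (\<integral>\<^sup>+k. g k \<partial>Z)"
      by (intro nn_integral_mono) (auto simp: indicator_def)
    finally show ?thesis .
  qed
  then show "infsum g UNIV \<le> (\<integral>\<^sup>+k. g k \<partial>Z)"
    by (subst nonneg_infsum_complete) (auto intro!: SUP_least)
next
  have "(\<integral>\<^sup>+k. g k \<partial>Z) = (\<integral>\<^sup>+k. (SUP n. g k * indicator {- int n..int n} k) \<partial>Z)"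
  proof (intro nn_integral_cong antisym SUP_least)
    fix k :: int
    have "g k = g k * indicator {- int (nat \<bar>k\<bar>)..int (nat \<bar>k\<bar>)} k"
      by (auto simp: indicator_def)
    also have "\<dots> \<le> (SUP n. g k * indicator {- int n..int n} k)"
      by (rule SUP_upper) simp
    finally show "g k \<le> (SUP n. g k * indicator {- int n..int n} k)" .
  qed (auto simp: indicator_def)
  also have "\<dots> = (SUP n. \<integral>\<^sup>+k. g k * indicator {- int n..int n} k \<partial>Z)"
    by (intro nn_integral_monotone_convergence_SUP) (auto simp: incseq_def le_fun_def indicator_def)
  also have "\<dots> = (SUP n. sum g {- int n..int n})"
    by (simp add: nn_integral_indicator_finite)
  also have "\<dots> \<le> infsum g UNIV"
    by (subst nonneg_infsum_complete) (auto intro!: SUP_least SUP_upper)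
  finally show "(\<integral>\<^sup>+k. g k \<partial>Z) \<le> infsum g UNIV" .
qed

lemma sigma_finite_Z: "sigma_finite_measure Z"
  by (rule sigma_finite_measure_count_space)

text \<open>Cutting the line into unit cells is the bridge between \<open>lp\<close> over the integers and \<open>Lp\<close> over the
line.\<close>

lemma nn_integral_unit_cells:
  fixes F :: "real \<Rightarrow> ennreal"
  assumes [measurable]: "F \<in> borel_measurable borel"
  shows "(\<integral>\<^sup>+x. F x \<partial>lborel) = (\<integral>\<^sup>+k. (\<integral>\<^sup>+x. F x * indicator {real_of_int k..<real_of_int k + 1} x \<partial>lborel) \<partial>Z)"
proof -
  interpret Z: sigma_finite_measure Z by (rule sigma_finite_Z)
  interpret pair_sigma_finite lborel Z ..
  have "(\<integral>\<^sup>+x. F x \<partial>lborel) = (\<integral>\<^sup>+x. (\<integral>\<^sup>+k. F x * indicator {real_of_int k..<real_of_int k + 1} x \<partial>Z) \<partial>lborel)"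
  proof (rule nn_integral_cong)
    fix x :: real
    have "F x * indicator {real_of_int k..<real_of_int k + 1} x = F x * indicator {\<lfloor>x\<rfloor>} k" for k :: int
      by (auto simp: indicator_def floor_eq_iff intro: floor_unique[symmetric])
    then show "F x = (\<integral>\<^sup>+k. F x * indicator {real_of_int k..<real_of_int k + 1} x \<partial>Z)"
      by simp
  qed
  also have "\<dots> = (\<integral>\<^sup>+k. (\<integral>\<^sup>+x. F x * indicator {real_of_int k..<real_of_int k + 1} x \<partial>lborel) \<partial>Z)"
  proof (rule Fubini'[symmetric])
    show "(\<lambda>(x, k). F x * indicator {real_of_int k..<real_of_int k + 1} x) \<in> borel_measurable (lborel \<Otimes>\<^sub>M Z)"
      unfolding indicator_def by measurable
  qed
  finally show ?thesis .
qed

lemma nn_integral_floor: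
  fixes h :: "int \<Rightarrow> ennreal"
  shows "(\<integral>\<^sup>+x. h \<lfloor>x::real\<rfloor> \<partial>lborel) = (\<integral>\<^sup>+k. h k \<partial>Z)"
proof -
  have "(\<integral>\<^sup>+x. h \<lfloor>x::real\<rfloor> \<partial>lborel) = (\<integral>\<^sup>+k. (\<integral>\<^sup>+x. h k * indicator {real_of_int k..<real_of_int k + 1} x \<partial>lborel) \<partial>Z)"
    by (subst nn_integral_unit_cells[where F = "\<lambda>x. h \<lfloor>x\<rfloor>"])
      (auto intro!: nn_integral_cong arg_cong[where f = h] floor_unique simp: indicator_def)
  then show ?thesis by (simp add: nn_integral_cmult)
qed

lemma nn_integral_lborel_shift:
  fixes F :: "real \<Rightarrow> ennreal"
  assumes [measurable]: "F \<in> borel_measurable borel"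
  shows "(\<integral>\<^sup>+x. F (x + a) \<partial>lborel) = (\<integral>\<^sup>+x. F x \<partial>lborel)"
  by (subst (2) nn_integral_real_affine[where c = 1 and t = a]) (auto simp: add.commute)

lemma nn_integral_lborel_reflect:
  fixes F :: "real \<Rightarrow> ennreal"
  assumes [measurable]: "F \<in> borel_measurable borel"
  shows "(\<integral>\<^sup>+x. F (a - x) \<partial>lborel) = (\<integral>\<^sup>+x. F x \<partial>lborel)"
  by (subst (2) nn_integral_real_affine[where c = "-1" and t = a]) auto

text \<open>The Poisson kernel at height one, without its factor \<open>1 / \<pi>\<close>. It dominates every error kernel
of the proof.\<close>

definition cauchy_kernel :: "real \<Rightarrow> real" where "cauchy_kernel x = 1 / (1 + x\<^sup>2)"

lemma cauchy_kernel_pos: "0 < cauchy_kernel x"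
  by (simp add: cauchy_kernel_def add_pos_nonneg)

lemma cauchy_kernel_nonneg [simp]: "0 \<le> cauchy_kernel x"
  using cauchy_kernel_pos[of x] by simp

lemma cauchy_kernel_minus [simp]: "cauchy_kernel (- x) = cauchy_kernel x"
  by (simp add: cauchy_kernel_def)

lemma cauchy_kernel_commute: "cauchy_kernel (x - y) = cauchy_kernel (y - x)"
  by (simp add: cauchy_kernel_def power2_commute)

lemma cauchy_kernel_measurable [measurable]: "cauchy_kernel \<in> borel_measurable borel"
  unfolding cauchy_kernel_def by measurable

text \<open>Moving the argument within a unit cell changes the kernel only by a constant factor, so sums of
the kernel over the integers compare with its integral.\<close>

lemma cauchy_kernel_shift:
  assumes "\<bar>x - y\<bar> \<le> 1"
  shows "cauchy_kernel x \<le> 3 * cauchy_kernel y"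
proof -
  have "y\<^sup>2 \<le> 2 * x\<^sup>2 + 2"
  proof -
    have "\<bar>y - x\<bar>\<^sup>2 \<le> 1\<^sup>2" using assms by (intro power_mono) auto
    then have "(y - x)\<^sup>2 \<le> 1" by simp
    moreover have "y\<^sup>2 \<le> 2 * x\<^sup>2 + 2 * (y - x)\<^sup>2"
      using zero_le_power2[of "y - 2 * x"] by (simp add: power2_eq_square algebra_simps)
    ultimately show ?thesis by simp
  qed
  then have "y\<^sup>2 \<le> 2 + 3 * x\<^sup>2" using zero_le_power2[of x] by linarith
  then show ?thesis
    unfolding cauchy_kernel_def by (simp add: divide_simps add_pos_nonneg)
qed

lemma nn_integral_cauchy_kernel: "(\<integral>\<^sup>+x. ennreal (cauchy_kernel x) \<partial>lborel) \<le> ennreal pi"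
proof -
  have half: "(\<integral>\<^sup>+x. ennreal (cauchy_kernel x) * indicator {0..} x \<partial>lborel) = ennreal (pi / 2)"
    by (subst nn_integral_FTC_atLeast[where F = arctan and T = "pi / 2"])
      (auto intro!: derivative_eq_intros tendsto_arctan_at_top simp: cauchy_kernel_def inverse_eq_divide)
  have "(\<integral>\<^sup>+x. ennreal (cauchy_kernel x) \<partial>lborel)
    \<le> (\<integral>\<^sup>+x. ennreal (cauchy_kernel x) * indicator {0..} x + ennreal (cauchy_kernel (0 - x)) * indicator {0..} (0 - x) \<partial>lborel)"
    by (intro nn_integral_mono) (auto simp: indicator_def)
  also have "\<dots> = ennreal (pi / 2) + ennreal (pi / 2)"
    by (subst nn_integral_add, (auto)[2])
      (subst nn_integral_lborel_reflect[where F = "\<lambda>x. ennreal (cauchy_kernel x) * indicator {0..} x"], auto simp: half)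
  also have "\<dots> = ennreal pi" by (simp flip: ennreal_plus)
  finally show ?thesis .
qed

lemma nn_integral_cauchy_kernel_shift:
  "(\<integral>\<^sup>+x. ennreal (cauchy_kernel (x - y)) \<partial>lborel) \<le> ennreal (3 * pi)"
  "(\<integral>\<^sup>+x. ennreal (cauchy_kernel (y - x)) \<partial>lborel) \<le> ennreal (3 * pi)"
proof -
  have *: "ennreal pi \<le> ennreal (3 * pi)" by (intro ennreal_leI) simp
  show "(\<integral>\<^sup>+x. ennreal (cauchy_kernel (x - y)) \<partial>lborel) \<le> ennreal (3 * pi)"
    using nn_integral_lborel_shift[of "\<lambda>x. ennreal (cauchy_kernel x)" "- y"] order_trans[OF nn_integral_cauchy_kernel *]
    by simp
  then show "(\<integral>\<^sup>+x. ennreal (cauchy_kernel (y - x)) \<partial>lborel) \<le> ennreal (3 * pi)"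
    by (subst cauchy_kernel_commute)
qed

lemma sum_cauchy_kernel_shift:
  "(\<integral>\<^sup>+k. ennreal (cauchy_kernel (of_int k - y)) \<partial>Z) \<le> ennreal (3 * pi)"
  "(\<integral>\<^sup>+k. ennreal (cauchy_kernel (y - of_int k)) \<partial>Z) \<le> ennreal (3 * pi)"
proof -
  have "(\<integral>\<^sup>+k. ennreal (cauchy_kernel (of_int k - y)) \<partial>Z)
      = (\<integral>\<^sup>+x. ennreal (cauchy_kernel (of_int \<lfloor>x::real\<rfloor> - y)) \<partial>lborel)"
    by (rule nn_integral_floor[symmetric])
  also have "\<dots> \<le> (\<integral>\<^sup>+x. 3 * ennreal (cauchy_kernel (x - y)) \<partial>lborel)"
  proof (rule nn_integral_mono)
    fix x :: real
    have "\<bar>(of_int \<lfloor>x\<rfloor> - y) - (x - y)\<bar> \<le> 1"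
      using floor_correct[of x] by linarith
    then show "ennreal (cauchy_kernel (of_int \<lfloor>x\<rfloor> - y)) \<le> 3 * ennreal (cauchy_kernel (x - y))"
      by (subst ennreal_numeral[symmetric], subst ennreal_mult'[symmetric])
        (auto intro!: ennreal_leI cauchy_kernel_shift)
  qed
  also have "\<dots> = 3 * (\<integral>\<^sup>+x. ennreal (cauchy_kernel (x + - y)) \<partial>lborel)"
    by (simp add: nn_integral_cmult)
  also have "(\<integral>\<^sup>+x. ennreal (cauchy_kernel (x + - y)) \<partial>lborel) \<le> ennreal pi"
    by (subst nn_integral_lborel_shift[where F = "\<lambda>x. ennreal (cauchy_kernel x)"]) (auto simp: nn_integral_cauchy_kernel)
  also have "3 * ennreal pi = ennreal (3 * pi)" by (simp add: ennreal_mult)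
  finally show "(\<integral>\<^sup>+k. ennreal (cauchy_kernel (of_int k - y)) \<partial>Z) \<le> ennreal (3 * pi)"
    by (simp add: mult_left_mono)
  then show "(\<integral>\<^sup>+k. ennreal (cauchy_kernel (y - of_int k)) \<partial>Z) \<le> ennreal (3 * pi)"
    by (subst cauchy_kernel_commute)
qed

lemma cauchy_schur_RZ:
  assumes "1 < p"
  shows "(\<integral>\<^sup>+x. ennpow p (\<integral>\<^sup>+j. ennreal (cauchy_kernel (x - of_int j)) * h j \<partial>Z) \<partial>lborel)
    \<le> ennreal (2 powr p * (3 * pi) powr p) * (\<integral>\<^sup>+j. ennpow p (h j) \<partial>Z)"
  by (rule schur_test[OF assms]) (auto intro: sigma_finite_Z sigma_finite_lborel
    nn_integral_cauchy_kernel_shift sum_cauchy_kernel_shift)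

lemma cauchy_schur_ZZ:
  assumes "1 < p"
  shows "(\<integral>\<^sup>+k. ennpow p (\<integral>\<^sup>+j. ennreal (cauchy_kernel (of_int k - of_int j)) * h j \<partial>Z) \<partial>Z)
    \<le> ennreal (2 powr p * (3 * pi) powr p) * (\<integral>\<^sup>+j. ennpow p (h j) \<partial>Z)"
  by (rule schur_test[OF assms]) (auto intro: sigma_finite_Z sigma_finite_lborel
    nn_integral_cauchy_kernel_shift sum_cauchy_kernel_shift)

lemma cauchy_schur_ZR:
  assumes "1 < p" and [measurable]: "h \<in> borel_measurable borel"
  shows "(\<integral>\<^sup>+k. ennpow p (\<integral>\<^sup>+y. ennreal (cauchy_kernel (of_int k - y)) * h y \<partial>lborel) \<partial>Z)
    \<le> ennreal (2 powr p * (3 * pi) powr p) * (\<integral>\<^sup>+y. ennpow p (h y) \<partial>lborel)"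
  by (rule schur_test[OF assms(1)]) (auto intro: sigma_finite_Z sigma_finite_lborel
    nn_integral_cauchy_kernel_shift sum_cauchy_kernel_shift)

section \<open>The p-th power of an Lp norm\<close>

definition Lp_pow :: "real \<Rightarrow> 'a measure \<Rightarrow> ('a \<Rightarrow> complex) \<Rightarrow> ennreal" where
  "Lp_pow p M v = (\<integral>\<^sup>+x. ennreal (norm (v x) powr p) \<partial>M)"

lemma Lp_pow_add:
  assumes "0 < p" and [measurable]: "a \<in> borel_measurable M" "b \<in> borel_measurable M"
  shows "Lp_pow p M (\<lambda>x. a x + b x) \<le> ennreal (2 powr p) * (Lp_pow p M a + Lp_pow p M b)"
proof -
  have "Lp_pow p M (\<lambda>x. a x + b x)
      \<le> (\<integral>\<^sup>+x. ennreal (2 powr p) * (ennreal (norm (a x) powr p) + ennreal (norm (b x) powr p)) \<partial>M)"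
    unfolding Lp_pow_def
  proof (rule nn_integral_mono)
    fix x
    have "norm (a x + b x) powr p \<le> (norm (a x) + norm (b x)) powr p"
      using assms(1) by (intro powr_mono2 norm_triangle_ineq) auto
    also have "\<dots> \<le> 2 powr p * (norm (a x) powr p + norm (b x) powr p)"
      using assms(1) by (intro powr_add_le) auto
    finally have "ennreal (norm (a x + b x) powr p) \<le> ennreal (2 powr p * (norm (a x) powr p + norm (b x) powr p))"
      by (rule ennreal_leI)
    also have "\<dots> = ennreal (2 powr p) * (ennreal (norm (a x) powr p) + ennreal (norm (b x) powr p))"
      by (subst ennreal_mult) auto
    finally show "ennreal (norm (a x + b x) powr p)
      \<le> ennreal (2 powr p) * (ennreal (norm (a x) powr p) + ennreal (norm (b x) powr p))" .
  qed
  also have "\<dots> = ennreal (2 powr p) * (Lp_pow p M a + Lp_pow p M b)"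
    by (simp add: nn_integral_cmult nn_integral_add Lp_pow_def)
  finally show ?thesis .
qed

lemma Lp_pow_mono:
  assumes "0 < p" "\<And>x. x \<in> space M \<Longrightarrow> norm (a x) \<le> norm (b x)"
  shows "Lp_pow p M a \<le> Lp_pow p M b"
  unfolding Lp_pow_def using assms by (intro nn_integral_mono ennreal_leI powr_mono2) auto

lemma Lp_pow_cmult:
  assumes [measurable]: "a \<in> borel_measurable M"
  shows "Lp_pow p M (\<lambda>x. c * a x) = ennreal (norm c powr p) * Lp_pow p M a"
  unfolding Lp_pow_def by (simp add: norm_mult powr_mult ennreal_mult nn_integral_cmult)

lemma Lp_pow_uminus [simp]: "Lp_pow p M (\<lambda>x. - a x) = Lp_pow p M a"
  by (simp add: Lp_pow_def)

lemma Lp_pow_diff: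
  assumes "0 < p" and "a \<in> borel_measurable M" "b \<in> borel_measurable M"
  shows "Lp_pow p M (\<lambda>x. a x - b x) \<le> ennreal (2 powr p) * (Lp_pow p M a + Lp_pow p M b)"
  using Lp_pow_add[OF assms(1,2), of "\<lambda>x. - b x"] assms(3) by simp

lemma Lp_pow_cong_AE:
  assumes "AE x in M. a x = b x" shows "Lp_pow p M a = Lp_pow p M b"
  unfolding Lp_pow_def using assms by (intro nn_integral_cong_AE) auto

text \<open>A sum over the integers in \<open>[0, \<infinity>]\<close> is the supremum of its finite partial sums.\<close>

lemma Lp_pow_Z_leI:
  assumes "\<And>K. finite K \<Longrightarrow> (\<Sum>k\<in>K. norm (y k) powr p) \<le> B"
  shows "Lp_pow p Z y \<le> ennreal B"
  unfolding Lp_pow_def infsum_eq_nn_integral_int[symmetric]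
  using assms by (subst nonneg_infsum_complete) (auto intro!: SUP_least ennreal_leI simp: sum_ennreal)

lemma sum_le_Lp_pow_Z:
  assumes "finite K"
  shows "ennreal (\<Sum>k\<in>K. norm (y k) powr p) \<le> Lp_pow p Z y"
proof -
  have "ennreal (\<Sum>k\<in>K. norm (y k) powr p) = (\<integral>\<^sup>+k. ennreal (norm (y k) powr p) * indicator K k \<partial>Z)"
    using assms by (simp add: nn_integral_indicator_finite sum_ennreal)
  also have "\<dots> \<le> Lp_pow p Z y"
    unfolding Lp_pow_def by (intro nn_integral_mono) (auto simp: indicator_def)
  finally show ?thesis .
qed

section \<open>M. Riesz's inequality on a horizontal line\<close>

text \<open>For \<open>t\<close> near \<open>\<plusminus>\<pi>/2\<close> the term \<open>- cos (p * t)\<close> is bounded below by a positive constant, because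
\<open>\<pi>/2 < p * \<pi>/2 \<le> \<pi>\<close>; away from \<open>\<plusminus>\<pi>/2\<close> the term \<open>cos t\<close> is. Suitable multiples therefore add up to
at least one.\<close>

lemma pichorides_inequality:
  fixes p :: real
  assumes p: "1 < p" "p \<le> 2"
  obtains A B where "0 < A" "0 < B"
    "\<And>t. \<bar>t\<bar> < pi / 2 \<Longrightarrow> 1 \<le> A * cos t powr p - B * cos (p * t)"
proof -
  \<comment> \<open>Any point strictly between \<open>\<pi> / (2 * p)\<close> and \<open>\<pi> / 2\<close> would do.\<close>
  define t0 where "t0 = (pi / 2 + pi / (2 * p)) / 2"
  have pt0: "p * t0 = pi * (p + 1) / 4" using p by (simp add: t0_def field_simps)
  have t0: "0 < t0" "t0 < pi / 2"
  proof -
    show "0 < t0" using p by (simp add: t0_def add_pos_pos)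
    have "pi / (2 * p) < pi / 2" using p by (intro divide_strict_left_mono) auto
    then show "t0 < pi / 2" by (simp add: t0_def)
  qed
  have pt0': "pi / 2 < p * t0" "p * t0 \<le> pi" unfolding pt0 using p by auto
  have c0: "cos (p * t0) < 0" using cos_lt_zero_pi[of "p * t0"] pt0' by (cases "p * t0 = pi") auto
  have ct0: "0 < cos t0" using t0 by (intro cos_gt_zero) auto
  define B where "B = 1 / (- cos (p * t0))"
  define A where "A = (1 + B) / cos t0 powr p"
  have B: "0 < B" using c0 by (simp add: B_def divide_neg_neg)
  have A: "0 < A" using B ct0 by (simp add: A_def)
  show ?thesis
  proof (rule that[OF A B])
    fix t :: real assume t: "\<bar>t\<bar> < pi / 2"
    have abs: "cos t = cos \<bar>t\<bar>" "cos (p * t) = cos (p * \<bar>t\<bar>)"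
      using p by (auto simp: abs_if)
    show "1 \<le> A * cos t powr p - B * cos (p * t)"
    proof (cases "t0 \<le> \<bar>t\<bar>")
      case True
      have "p * \<bar>t\<bar> \<le> 2 * (pi / 2)" using p t by (intro mult_mono) auto
      then have "cos (p * \<bar>t\<bar>) \<le> cos (p * t0)"
        using True p t0 by (intro cos_monotone_0_pi_le mult_left_mono) auto
      then have "B * (- cos (p * t0)) \<le> B * (- cos (p * t))"
        using B abs by (intro mult_left_mono) auto
      moreover have "B * (- cos (p * t0)) = 1" using c0 by (simp add: B_def)
      moreover have "0 \<le> A * cos t powr p" using A by simp
      ultimately show ?thesis by simp
    next
      case False
      have "cos t0 \<le> cos t" unfolding abs using False t0 by (intro cos_monotone_0_pi_le) auto
      then have "A * cos t0 powr p \<le> A * cos t powr p"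
        using A ct0 p by (intro mult_left_mono powr_mono2) auto
      moreover have "A * cos t0 powr p = 1 + B" using ct0 by (simp add: A_def)
      moreover have "B * cos (p * t) \<le> B * 1" using B by (intro mult_left_mono) auto
      ultimately show ?thesis by simp
    qed
  qed
qed

text \<open>The trigonometric inequality with \<open>t\<close> the argument of \<open>z\<close>, multiplied by \<open>norm z\<^sup>p\<close>.\<close>

lemma powr_right_half_plane:
  fixes p :: real and z :: complex
  assumes AB: "\<And>t. \<bar>t\<bar> < pi / 2 \<Longrightarrow> 1 \<le> A * cos t powr p - B * cos (p * t)" and z: "0 < Re z"
  shows "norm z powr p \<le> A * Re z powr p - B * Re (z powr of_real p)"
proof -
  have nz: "z \<noteq> 0" using z by auto
  have t: "\<bar>Im (Ln z)\<bar> < pi / 2" using z nz Re_Ln_pos_lt by blast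
  have rez: "Re z = norm z * cos (Im (Ln z))"
  proof -
    have "z = exp (Ln z)" using nz by simp
    then have "Re z = exp (Re (Ln z)) * cos (Im (Ln z))" by (metis Re_exp)
    then show ?thesis using nz by simp
  qed
  have c: "0 < cos (Im (Ln z))" using t by (intro cos_gt_zero_pi) auto
  have 1: "Re z powr p = norm z powr p * cos (Im (Ln z)) powr p"
    unfolding rez using c by (simp add: powr_mult)
  have 2: "Re (z powr of_real p) = norm z powr p * cos (p * Im (Ln z))"
    using nz by (simp add: powr_def Re_exp)
  have "norm z powr p * 1 \<le> norm z powr p * (A * cos (Im (Ln z)) powr p - B * cos (p * Im (Ln z)))"
    using AB[OF t] by (intro mult_left_mono) auto
  then show ?thesis unfolding 1 2 by (simp add: algebra_simps)
qed

text \<open>The kernel \<open>1 / (t + \<i>)\<close> is a Cauchy transform taken one unit above the real axis. Up to the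
factor \<open>\<i>\<close>, its real and imaginary parts are the Poisson kernel and the conjugate Poisson kernel at
height one. Unlike the singular kernel \<open>1 / t\<close> it is defined at every integer.\<close>

definition hilbert_kernel :: "real \<Rightarrow> complex" where "hilbert_kernel t = 1 / (of_real t + \<i>)"

definition hilbert_sum :: "int set \<Rightarrow> (int \<Rightarrow> complex) \<Rightarrow> real \<Rightarrow> complex" where
  "hilbert_sum J d x = (\<Sum>j\<in>J. d j * hilbert_kernel (x - of_int j))"

lemma real_plus_i_neq_0 [simp]: "complex_of_real t + \<i> \<noteq> 0"
  by (auto simp: complex_eq_iff)

lemma norm_real_plus_i: "norm (complex_of_real t + \<i>) = sqrt (1 + t\<^sup>2)"
  by (simp add: cmod_def add.commute)

lemma norm_hilbert_kernel: "norm (hilbert_kernel t) = sqrt (cauchy_kernel t)"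
  by (simp add: hilbert_kernel_def norm_divide norm_real_plus_i cauchy_kernel_def real_sqrt_divide)

lemma hilbert_kernel_minus: "hilbert_kernel (- t) = - cnj (hilbert_kernel t)"
  by (simp add: hilbert_kernel_def complex_eq_iff Re_divide Im_divide)

lemma continuous_on_hilbert_kernel [continuous_intros]:
  "continuous_on S f \<Longrightarrow> continuous_on S (\<lambda>x. hilbert_kernel (f x))"
  unfolding hilbert_kernel_def by (intro continuous_intros) auto

lemma hilbert_kernel_measurable [measurable]: "hilbert_kernel \<in> borel_measurable borel"
  by (intro borel_measurable_continuous_onI continuous_intros)

lemma hilbert_sum_measurable [measurable]: "hilbert_sum J d \<in> borel_measurable borel"
  unfolding hilbert_sum_def by measurable

lemma hilbert_kernel_diff_le:
  assumes "\<bar>t - s\<bar> \<le> 1"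
  shows "norm (hilbert_kernel t - hilbert_kernel s) \<le> 3 * cauchy_kernel s"
proof -
  have "hilbert_kernel t - hilbert_kernel s = of_real (s - t) * (hilbert_kernel t * hilbert_kernel s)"
    by (simp add: hilbert_kernel_def diff_frac_eq)
  then have "norm (hilbert_kernel t - hilbert_kernel s) = \<bar>s - t\<bar> * sqrt (cauchy_kernel t * cauchy_kernel s)"
    by (simp add: norm_mult norm_hilbert_kernel real_sqrt_mult del: of_real_diff)
  also have "\<dots> \<le> 1 * sqrt ((3 * cauchy_kernel s) * (3 * cauchy_kernel s))"
    using assms cauchy_kernel_shift[OF assms]
    by (intro mult_mono real_sqrt_le_mono mult_mono) (auto intro: order_trans[of _ "1 * _"])
  also have "\<dots> = 3 * cauchy_kernel s"
    by (simp only: real_sqrt_abs2 mult_1) simp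
  finally show ?thesis .
qed

text \<open>Since \<open>Re F > 0\<close> in the upper half-plane, \<open>F\<^sup>p\<close> is holomorphic there. At distance \<open>R\<close> from the
origin it is of order \<open>R\<^bsup>- p\<^esup>\<close> with \<open>p > 1\<close>, so the three other sides of a rectangle of size \<open>R\<close>
contribute \<open>R * R\<^bsup>- p\<^esup>\<close>, which tends to zero, to the integral around the rectangle.\<close>

lemma hilbert_sum_line_integral_powr_tendsto_0:
  fixes d :: "int \<Rightarrow> real"
  assumes p: "1 < p" and J: "finite J" and d: "\<And>j. j \<in> J \<Longrightarrow> 0 \<le> d j" and pos: "\<exists>j\<in>J. 0 < d j"
  defines "F \<equiv> \<lambda>z. \<Sum>j\<in>J. of_real (d j) * (\<i> / (z - of_int j))"
  obtains I where "\<And>R. 0 \<le> R \<Longrightarrow> ((\<lambda>x. F (of_real x + \<i>) powr of_real p) has_integral I R) {- R..R}"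
    "(I \<longlongrightarrow> 0) at_top" "\<And>z. 0 < Im z \<Longrightarrow> 0 < Re (F z)" "F holomorphic_on {z. 0 < Im z}"
proof -
  define H where "H = {z. 0 < Im z}"
  have nz: "z - of_int j \<noteq> 0" if "z \<in> H" for z j
    using that by (auto simp: H_def)
  have Fpos: "0 < Re (F z)" if "0 < Im z" for z
  proof -
    have re: "Re (\<i> / (z - of_int j)) = Im z / norm (z - of_int j) ^ 2" for j :: int
      by (simp add: Re_divide cmod_power2)
    have "z - of_int j \<noteq> 0" for j :: int using that by auto
    then have rp: "0 < Re (\<i> / (z - of_int j))" for j :: int unfolding re using that by auto
    have "Re (F z) = (\<Sum>j\<in>J. d j * Re (\<i> / (z - of_int j)))"
      unfolding F_def Re_sum
      by (intro sum.cong refl) (simp only: times_complex.sel Re_complex_of_real Im_complex_of_real mult_zero_left diff_0_right)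
    also have "\<dots> > 0"
    proof -
      obtain j where "j \<in> J" "0 < d j" using pos by blast
      then show ?thesis
        using d rp J by (intro sum_pos2[of J j] mult_pos_pos mult_nonneg_nonneg less_imp_le[OF rp]) auto
    qed
    finally show ?thesis .
  qed
  have Fhol: "F holomorphic_on H"
    unfolding F_def using nz by (intro holomorphic_intros) auto
  have ghol: "(\<lambda>z. F z powr of_real p) holomorphic_on H"
  proof (intro holomorphic_intros Fhol)
    fix z assume "z \<in> H"
    then show "F z \<notin> \<real>\<^sub>\<le>\<^sub>0" using Fpos[of z] by (auto simp: H_def complex_nonpos_Reals_iff)
  qed
  have "convex H" "open H" unfolding H_def by (auto simp: convex_halfspace_Im_gt open_halfspace_Im_gt)
  then obtain G where G: "\<And>z. z \<in> H \<Longrightarrow> (G has_field_derivative F z powr of_real p) (at z)"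
    using holomorphic_convex_primitive'[OF _ _ ghol] by (metis at_within_open)
  define I where "I R = G (of_real R + \<i>) - G (of_real (- R) + \<i>)" for R
  have hasI: "((\<lambda>x. F (of_real x + \<i>) powr of_real p) has_integral I R) {- R..R}" if "0 \<le> R" for R
    unfolding I_def
  proof (rule fundamental_theorem_of_calculus)
    fix x assume "x \<in> {- R..R}"
    have "((\<lambda>x. of_real x + \<i>) has_vector_derivative 1) (at x within {- R..R})"
      by (auto intro!: derivative_eq_intros)
    moreover have "(G has_field_derivative F (of_real x + \<i>) powr of_real p) (at (of_real x + \<i>))"
      by (rule G) (simp add: H_def)
    ultimately have "((G \<circ> (\<lambda>x. of_real x + \<i>)) has_vector_derivative 1 * (F (of_real x + \<i>) powr of_real p)) (at x within {- R..R})"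
      by (rule field_vector_diff_chain_within[OF _ DERIV_subset]) auto
    then show "((\<lambda>x. G (of_real x + \<i>)) has_vector_derivative F (of_real x + \<i>) powr of_real p) (at x within {- R..R})"
      by (simp add: o_def)
  qed (use that in simp)
  define D where "D = (\<Sum>j\<in>J. d j)"
  define M where "M = (\<Sum>j\<in>J. \<bar>real_of_int j\<bar>)"
  have M: "\<bar>of_int j\<bar> \<le> M" if "j \<in> J" for j
    unfolding M_def using J that by (intro member_le_sum) auto
  have D: "0 \<le> D" unfolding D_def using d by (intro sum_nonneg)
  have gb: "norm (F z powr of_real p) \<le> (D / (R - M)) powr p"
    if R: "M < R" and z: "z \<in> H" "R \<le> \<bar>Re z\<bar> \<or> R \<le> Im z" for z R
  proof -
    have "norm (F z) \<le> (\<Sum>j\<in>J. d j * (1 / (R - M)))"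
      unfolding F_def
    proof (rule sum_norm_le)
      fix j assume j: "j \<in> J"
      have "R - M \<le> norm (z - of_int j)"
        using z(2)
      proof
        assume "R \<le> \<bar>Re z\<bar>"
        then have "R - M \<le> \<bar>Re (z - of_int j)\<bar>" using M[OF j] by simp
        also have "\<dots> \<le> norm (z - of_int j)" by (rule abs_Re_le_cmod)
        finally show ?thesis .
      next
        assume "R \<le> Im z"
        then have "R - M \<le> \<bar>Im (z - of_int j)\<bar>" using M[OF j] by simp
        also have "\<dots> \<le> norm (z - of_int j)" by (rule abs_Im_le_cmod)
        finally show ?thesis .
      qed
      then have "1 / norm (z - of_int j) \<le> 1 / (R - M)" using R by (intro divide_left_mono mult_pos_pos) auto
      then show "norm (of_real (d j) * (\<i> / (z - of_int j))) \<le> d j * (1 / (R - M))"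
        using d[OF j] by (simp add: norm_mult norm_divide norm_inverse mult_left_mono divide_inverse)
    qed
    also have "\<dots> = D / (R - M)" by (simp add: D_def sum_distrib_right sum_divide_distrib)
    finally have "norm (F z) powr p \<le> (D / (R - M)) powr p" using p by (intro powr_mono2) auto
    then show ?thesis by (simp add: norm_powr_real_powr')
  qed
  have Gseg: "norm (G b - G a) \<le> (D / (R - M)) powr p * norm (b - a)"
    if R: "M < R" and seg: "closed_segment a b \<subseteq> H \<inter> {z. R \<le> \<bar>Re z\<bar> \<or> R \<le> Im z}" for a b R
  proof (rule field_differentiable_bound[of "closed_segment a b" G])
    show "(G has_field_derivative F z powr of_real p) (at z within closed_segment a b)" if "z \<in> closed_segment a b" for z
      using G seg that by (intro DERIV_subset[OF G]) auto
    show "norm (F z powr of_real p) \<le> (D / (R - M)) powr p" if "z \<in> closed_segment a b" for z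
      using that seg by (intro gb[OF R]) auto
  qed auto
  have Ibound: "norm (I R) \<le> (D / (R - M)) powr p * (4 * R)" if R: "M < R" "1 \<le> R" for R
  proof -
    \<comment> \<open>The corners of a rectangle that stands on the segment of integration.\<close>
    define a b c e where "a = Complex (- R) 1" "b = Complex (- R) (1 + R)" "c = Complex R (1 + R)" "e = Complex R 1"
    note abce = this
    have segs: "closed_segment a b \<subseteq> H \<inter> {z. R \<le> \<bar>Re z\<bar> \<or> R \<le> Im z}"
         "closed_segment b c \<subseteq> H \<inter> {z. R \<le> \<bar>Re z\<bar> \<or> R \<le> Im z}"
         "closed_segment c e \<subseteq> H \<inter> {z. R \<le> \<bar>Re z\<bar> \<or> R \<le> Im z}"
      using R unfolding abce H_def
      by (auto simp: closed_segment_same_Re closed_segment_same_Im closed_segment_eq_real_ivl)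
    have "I R = (G b - G a) + (G c - G b) + (G e - G c)"
      unfolding I_def abce by (simp add: Complex_eq)
    also have "norm \<dots> \<le> norm (G b - G a) + norm (G c - G b) + norm (G e - G c)"
      by (intro order_trans[OF norm_triangle_ineq] add_mono norm_triangle_ineq) auto
    also have "\<dots> \<le> (D / (R - M)) powr p * norm (b - a) + (D / (R - M)) powr p * norm (c - b) + (D / (R - M)) powr p * norm (e - c)"
      by (intro add_mono Gseg R segs)
    also have "norm (b - a) = R" using R by (simp add: abce cmod_def)
    also have "c - b = of_real (2 * R)" by (simp add: abce complex_eq_iff)
    also have "norm (complex_of_real (2 * R)) = 2 * R" unfolding norm_of_real using R by simp
    also have "norm (e - c) = R" using R by (simp add: abce cmod_def)
    finally show ?thesis by (simp add: algebra_simps)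
  qed
  have "((\<lambda>R. (D / (R - M)) powr p * (4 * R)) \<longlongrightarrow> 0) at_top"
  proof (cases "D = 0")
    case False
    with D have "0 < D" by simp
    then show ?thesis using p by real_asymp
  qed (use p in simp)
  then have lim: "(I \<longlongrightarrow> 0) at_top"
  proof (rule Lim_null_comparison[rotated])
    show "\<forall>\<^sub>F R in at_top. norm (I R) \<le> (D / (R - M)) powr p * (4 * R)"
      using eventually_gt_at_top[of M] eventually_ge_at_top[of 1] by eventually_elim (rule Ibound)
  qed
  show ?thesis using that[OF hasI lim Fpos] Fhol unfolding H_def by blast
qed

text \<open>Integrate \<open>norm F\<^sup>p \<le> A * (Re F)\<^sup>p - B * Re (F\<^sup>p)\<close> along the line \<open>Im z = 1\<close>. The last term
integrates to zero, and \<open>Re F\<close> is a positive combination of Poisson kernels, to which the Schur test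
applies.\<close>

lemma riesz_line_bound:
  assumes p: "1 < p" "p \<le> 2"
  obtains C where "0 < C" "\<And>J d. finite J \<Longrightarrow> (\<And>j. j \<in> J \<Longrightarrow> 0 \<le> d j) \<Longrightarrow>
    Lp_pow p lborel (hilbert_sum J (\<lambda>j. of_real (d j))) \<le> ennreal (C * (\<Sum>j\<in>J. d j powr p))"
proof -
  obtain A B where AB: "0 < A" "0 < B" "\<And>t. \<bar>t\<bar> < pi / 2 \<Longrightarrow> 1 \<le> A * cos t powr p - B * cos (p * t)"
    using pichorides_inequality[OF p] by metis
  define C where "C = A * (2 powr p * (3 * pi) powr p)"
  have "Lp_pow p lborel (hilbert_sum J (\<lambda>j. of_real (d j))) \<le> ennreal (C * (\<Sum>j\<in>J. d j powr p))"
    if J: "finite J" and d: "\<And>j. j \<in> J \<Longrightarrow> 0 \<le> d j" for J and d :: "int \<Rightarrow> real"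
  proof (cases "\<exists>j\<in>J. 0 < d j")
    case False
    then have "d j = 0" if "j \<in> J" for j using d[OF that] that by force
    then show ?thesis by (simp add: Lp_pow_def hilbert_sum_def)
  next
    case True
    define F where "F = (\<lambda>z. \<Sum>j\<in>J. of_real (d j) * (\<i> / (z - of_int j)))"
    obtain I where I: "\<And>R. 0 \<le> R \<Longrightarrow> ((\<lambda>x. F (of_real x + \<i>) powr of_real p) has_integral I R) {- R..R}"
      "(I \<longlongrightarrow> 0) at_top" and Fpos: "\<And>z. 0 < Im z \<Longrightarrow> 0 < Re (F z)"
      and Fhol: "F holomorphic_on {z. 0 < Im z}"
      using hilbert_sum_line_integral_powr_tendsto_0[OF p(1) J d True] unfolding F_def by blast
    have Fh: "F (of_real x + \<i>) = \<i> * hilbert_sum J (\<lambda>j. of_real (d j)) x" for x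
      unfolding F_def hilbert_sum_def sum_distrib_left
      by (intro sum.cong) (auto simp: hilbert_kernel_def add_diff_eq diff_add_eq)
    have nF: "norm (F (of_real x + \<i>)) = norm (hilbert_sum J (\<lambda>j. of_real (d j)) x)" for x
      unfolding Fh by (simp add: norm_mult)
    define u where "u x = (\<Sum>j\<in>J. d j * cauchy_kernel (x - of_int j))" for x
    have u: "Re (F (of_real x + \<i>)) = u x" for x
      unfolding F_def u_def Re_sum
    proof (intro sum.cong refl)
      fix j
      have "Re (\<i> / (of_real x + \<i> - of_int j)) = cauchy_kernel (x - of_int j)"
        by (simp add: Re_divide cauchy_kernel_def add.commute)
      then show "Re (of_real (d j) * (\<i> / (of_real x + \<i> - of_int j))) = d j * cauchy_kernel (x - of_int j)"
        by (simp only: times_complex.sel Re_complex_of_real Im_complex_of_real mult_zero_left diff_0_right)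
    qed
    have u_meas [measurable]: "u \<in> borel_measurable borel" unfolding u_def by measurable
    have u_nonneg: "0 \<le> u x" for x unfolding u_def using d by (intro sum_nonneg mult_nonneg_nonneg) auto
    have contF: "continuous_on UNIV (\<lambda>x. F (of_real x + \<i>))"
      by (rule continuous_on_compose2[OF holomorphic_on_imp_continuous_on[OF Fhol]]) (auto intro!: continuous_intros)
    have contU: "continuous_on UNIV (\<lambda>x. u x powr p)"
    proof (rule continuous_on_powr')
      show "continuous_on UNIV u"
        unfolding u[symmetric] by (intro continuous_intros contF)
    qed (use u_nonneg p in auto)
    define U where "U = (\<integral>\<^sup>+x. ennreal (u x powr p) \<partial>lborel)"
    have U: "U \<le> ennreal ((2 powr p * (3 * pi) powr p) * (\<Sum>j\<in>J. d j powr p))"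
    proof -
      let ?h = "\<lambda>j. ennreal (d j) * indicator J j"
      have "ennreal (u x powr p) = ennpow p (\<integral>\<^sup>+j. ennreal (cauchy_kernel (x - of_int j)) * ?h j \<partial>Z)" for x
      proof -
        have "(\<integral>\<^sup>+j. ennreal (cauchy_kernel (x - of_int j)) * ?h j \<partial>Z)
          = (\<Sum>j\<in>J. ennreal (cauchy_kernel (x - of_int j)) * ennreal (d j))"
          using J by (simp add: nn_integral_indicator_finite flip: mult.assoc)
        also have "\<dots> = ennreal (u x)"
          unfolding u_def using d by (subst sum_ennreal[symmetric]) (auto simp: ennreal_mult mult.commute)
        finally show ?thesis using u_nonneg by (simp add: ennpow_ennreal)
      qed
      then have "U \<le> ennreal (2 powr p * (3 * pi) powr p) * (\<integral>\<^sup>+j. ennpow p (?h j) \<partial>Z)"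
        unfolding U_def using cauchy_schur_RZ[OF p(1), of ?h] by simp
      also have "(\<integral>\<^sup>+j. ennpow p (?h j) \<partial>Z) = (\<integral>\<^sup>+j. ennreal (d j powr p) * indicator J j \<partial>Z)"
        using d by (intro nn_integral_cong) (auto simp: indicator_def ennpow_ennreal)
      also have "\<dots> = ennreal (\<Sum>j\<in>J. d j powr p)"
        using J by (simp add: nn_integral_indicator_finite sum_ennreal)
      finally show ?thesis by (simp add: ennreal_mult sum_nonneg)
    qed
    let ?N = "\<lambda>x. norm (F (of_real x + \<i>)) powr p"
    have contN: "continuous_on UNIV ?N"
      by (rule continuous_on_powr') (use p in \<open>auto intro!: continuous_intros contF\<close>)
    have block: "(\<integral>\<^sup>+x. ennreal (?N x) * indicator {- R..R} x \<partial>lborel) \<le> ennreal A * U + ennreal (B * norm (I R))"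
      if R: "0 \<le> R" for R
    proof -
      obtain iN where iN: "(?N has_integral iN) {- R..R}"
        using integrable_continuous_interval[OF continuous_on_subset[OF contN]] by (metis integrable_on_def top_greatest)
      obtain iU where iU: "((\<lambda>x. u x powr p) has_integral iU) {- R..R}"
        using integrable_continuous_interval[OF continuous_on_subset[OF contU]] by (metis integrable_on_def top_greatest)
      have iG: "((\<lambda>x. Re (F (of_real x + \<i>) powr of_real p)) has_integral Re (I R)) {- R..R}"
        using has_integral_linear[OF I(1)[OF R] bounded_linear_Re] by (simp add: o_def)
      have "iN \<le> A * iU - B * Re (I R)"
      proof (rule has_integral_le[OF iN])
        show "((\<lambda>x. A * u x powr p - B * Re (F (of_real x + \<i>) powr of_real p)) has_integral (A * iU - B * Re (I R))) {- R..R}"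
          by (intro has_integral_diff has_integral_mult_right iU iG)
        show "?N x \<le> A * u x powr p - B * Re (F (of_real x + \<i>) powr of_real p)" for x
          using powr_right_half_plane[OF AB(3) Fpos, of "of_real x + \<i>"] by (simp add: u)
      qed
      also have "\<dots> \<le> A * iU + B * norm (I R)"
        using AB abs_Re_le_cmod[of "I R"] by (smt (verit) mult_left_mono mult_minus_right)
      finally have le: "iN \<le> A * iU + B * norm (I R)" .
      have nnU: "(\<integral>\<^sup>+x. ennreal (u x powr p) * indicator {- R..R} x \<partial>lborel) = ennreal iU"
        using nn_integral_has_integral_lebesgue[OF _ iU] by (simp add: mult.commute nn_integral_completion ennreal_mult' ennreal_indicator)
      have nnN: "(\<integral>\<^sup>+x. ennreal (?N x) * indicator {- R..R} x \<partial>lborel) = ennreal iN"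
        using nn_integral_has_integral_lebesgue[OF _ iN] by (simp add: mult.commute nn_integral_completion ennreal_mult' ennreal_indicator)
      have iU0: "0 \<le> iU" by (rule has_integral_nonneg[OF iU]) simp
      have "ennreal iN \<le> ennreal (A * iU + B * norm (I R))" using le by (rule ennreal_leI)
      also have "\<dots> = ennreal A * ennreal iU + ennreal (B * norm (I R))"
        using AB iU0 by (simp add: ennreal_mult)
      also have "ennreal iU \<le> U"
        unfolding nnU[symmetric] U_def by (intro nn_integral_mono) (auto simp: indicator_def)
      finally show ?thesis unfolding nnN by (simp add: mult_left_mono)
    qed
    have block': "(\<integral>\<^sup>+x. ennreal (?N x) * indicator {- real n..real n} x \<partial>lborel) \<le> ennreal A * U" for n
    proof (rule ennreal_le_epsilon)
      fix e :: real assume e: "0 < e"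
      have "((\<lambda>R. B * norm (I R)) \<longlongrightarrow> B * norm (0::complex)) at_top"
        by (intro tendsto_intros I(2))
      then have "\<forall>\<^sub>F R in at_top. B * norm (I R) < e"
        using e by (intro order_tendstoD(2)) auto
      then have "\<forall>\<^sub>F R in at_top. B * norm (I R) < e \<and> real n \<le> R"
        using eventually_ge_at_top[of "real n"] by eventually_elim auto
      then obtain R where R: "B * norm (I R) < e" "real n \<le> R"
        using eventually_happens'[OF trivial_limit_at_top_linorder] by fast
      have "(\<integral>\<^sup>+x. ennreal (?N x) * indicator {- real n..real n} x \<partial>lborel)
          \<le> (\<integral>\<^sup>+x. ennreal (?N x) * indicator {- R..R} x \<partial>lborel)"
        using R by (intro nn_integral_mono) (auto simp: indicator_def)
      also have "\<dots> \<le> ennreal A * U + ennreal (B * norm (I R))"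
        using R by (intro block) auto
      also have "\<dots> \<le> ennreal A * U + ennreal e"
        using R by (intro add_left_mono ennreal_leI) auto
      finally show "(\<integral>\<^sup>+x. ennreal (?N x) * indicator {- real n..real n} x \<partial>lborel) \<le> ennreal A * U + ennreal e" .
    qed
    have "Lp_pow p lborel (hilbert_sum J (\<lambda>j. of_real (d j))) = (\<integral>\<^sup>+x. ennreal (?N x) \<partial>lborel)"
      by (simp add: Lp_pow_def nF)
    also have "\<dots> = (\<integral>\<^sup>+x. (SUP n. ennreal (?N x) * indicator {- real n..real n} x) \<partial>lborel)"
    proof (intro nn_integral_cong antisym SUP_least)
      fix x :: real
      obtain n where n: "\<bar>x\<bar> \<le> real n" using real_arch_simple by blast
      have "ennreal (?N x) = ennreal (?N x) * indicator {- real n..real n} x"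
        using n by (auto simp: indicator_def)
      also have "\<dots> \<le> (SUP n. ennreal (?N x) * indicator {- real n..real n} x)"
        by (rule SUP_upper) simp
      finally show "ennreal (?N x) \<le> (SUP n. ennreal (?N x) * indicator {- real n..real n} x)" .
    qed (auto simp: indicator_def)
    also have "\<dots> = (SUP n. \<integral>\<^sup>+x. ennreal (?N x) * indicator {- real n..real n} x \<partial>lborel)"
      unfolding nF
      by (intro nn_integral_monotone_convergence_SUP) (auto simp: incseq_def le_fun_def indicator_def)
    also have "\<dots> \<le> ennreal A * U"
      by (intro SUP_least block')
    also have "\<dots> \<le> ennreal A * ennreal ((2 powr p * (3 * pi) powr p) * (\<Sum>j\<in>J. d j powr p))"
      using U by (rule mult_left_mono) simp
    also have "\<dots> = ennreal (C * (\<Sum>j\<in>J. d j powr p))"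
      using AB by (simp add: C_def ennreal_mult sum_nonneg mult.assoc)
    finally show ?thesis .
  qed
  moreover have "0 < C" using AB by (simp add: C_def)
  ultimately show ?thesis using that by blast
qed

section \<open>The discrete Hilbert transform\<close>

lemma ennreal_mult_add_distrib:
  assumes "0 \<le> a" "0 \<le> x" "0 \<le> y"
  shows "ennreal a * (ennreal x + ennreal y) = ennreal (a * (x + y))"
proof -
  have "ennreal x + ennreal y = ennreal (x + y)" using assms by (intro ennreal_plus[symmetric])
  then show ?thesis using assms by (simp only: ennreal_mult[symmetric] add_nonneg_nonneg)
qed

lemma Lp_pow_floor: "Lp_pow p lborel (\<lambda>x. v \<lfloor>x::real\<rfloor>) = Lp_pow p Z v"
  unfolding Lp_pow_def using nn_integral_floor[of "\<lambda>k. ennreal (norm (v k) powr p)"] .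

lemma Lp_pow_cauchy_sum:
  assumes p: "1 < p" and J: "finite J" and a: "\<And>j. j \<in> J \<Longrightarrow> 0 \<le> a j"
  shows "Lp_pow p Z (\<lambda>k. of_real (\<Sum>j\<in>J. a j * cauchy_kernel (of_int k - of_int j)))
    \<le> ennreal ((2 powr p * (3 * pi) powr p) * (\<Sum>j\<in>J. a j powr p))"
proof -
  let ?h = "\<lambda>j. ennreal (a j) * indicator J j"
  have "ennreal (norm (complex_of_real (\<Sum>j\<in>J. a j * cauchy_kernel (of_int k - of_int j))) powr p)
      = ennpow p (\<integral>\<^sup>+j. ennreal (cauchy_kernel (of_int k - of_int j)) * ?h j \<partial>Z)" for k
  proof -
    have "(\<integral>\<^sup>+j. ennreal (cauchy_kernel (of_int k - of_int j)) * ?h j \<partial>Z)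
      = (\<Sum>j\<in>J. ennreal (cauchy_kernel (of_int k - of_int j)) * ennreal (a j))"
      using J by (simp add: nn_integral_indicator_finite flip: mult.assoc)
    also have "\<dots> = ennreal (\<Sum>j\<in>J. a j * cauchy_kernel (of_int k - of_int j))"
      using a by (subst sum_ennreal[symmetric]) (auto simp: ennreal_mult mult.commute)
    finally show ?thesis using a by (simp add: ennpow_ennreal sum_nonneg del: of_real_sum)
  qed
  then have "Lp_pow p Z (\<lambda>k. of_real (\<Sum>j\<in>J. a j * cauchy_kernel (of_int k - of_int j)))
      \<le> ennreal (2 powr p * (3 * pi) powr p) * (\<integral>\<^sup>+j. ennpow p (?h j) \<partial>Z)"
    unfolding Lp_pow_def using cauchy_schur_ZZ[OF p, of ?h] by simp
  also have "(\<integral>\<^sup>+j. ennpow p (?h j) \<partial>Z) = (\<integral>\<^sup>+j. ennreal (a j powr p) * indicator J j \<partial>Z)"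
    using a by (intro nn_integral_cong) (auto simp: indicator_def ennpow_ennreal)
  also have "\<dots> = ennreal (\<Sum>j\<in>J. a j powr p)"
    using J by (simp add: nn_integral_indicator_finite sum_ennreal)
  finally show ?thesis by (simp add: ennreal_mult sum_nonneg)
qed

text \<open>Within a unit cell the kernel \<open>hilbert_kernel\<close> varies by at most a multiple of the Cauchy kernel.
This passes from integrals along the line to sums over the integers.\<close>

lemma hilbert_sum_diff_le:
  assumes "\<bar>x - of_int k\<bar> \<le> 1"
  shows "norm (hilbert_sum J d x - hilbert_sum J d (of_int k)) \<le> (\<Sum>j\<in>J. (3 * norm (d j)) * cauchy_kernel (of_int k - of_int j))"
  unfolding hilbert_sum_def sum_subtractf[symmetric]
proof (rule sum_norm_le)
  fix j
  have *: "norm (hilbert_kernel (x - of_int j) - hilbert_kernel (of_int k - of_int j)) \<le> 3 * cauchy_kernel (of_int k - of_int j)"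
    using assms by (intro hilbert_kernel_diff_le) simp
  show "norm (d j * hilbert_kernel (x - of_int j) - d j * hilbert_kernel (of_int k - of_int j)) \<le> 3 * norm (d j) * cauchy_kernel (of_int k - of_int j)"
    using mult_left_mono[OF *, of "norm (d j)"] by (simp add: norm_mult mult_ac flip: right_diff_distrib)
qed

text \<open>For finitely supported sequences only, with a constant that is independent of the support; the
general case follows by Fatou's lemma after the passage to the sinc series.\<close>

definition hilbert_bounded :: "real \<Rightarrow> bool" where
  "hilbert_bounded p \<longleftrightarrow> (\<exists>C>0. \<forall>J d. finite J \<longrightarrow>
     Lp_pow p Z (\<lambda>k. hilbert_sum J d (of_int k)) \<le> ennreal (C * (\<Sum>j\<in>J. norm (d j) powr p)))"

text \<open>The line bound holds for nonnegative coefficients. It is first carried to the integers, and then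
extended to real and complex coefficients by splitting them into four nonnegative sequences.\<close>

lemma hilbert_bounded_le_2:
  assumes p: "1 < p" "p \<le> 2"
  shows "hilbert_bounded p"
proof -
  obtain C where C: "0 < C" "\<And>J d. finite J \<Longrightarrow> (\<And>j. j \<in> J \<Longrightarrow> 0 \<le> d j) \<Longrightarrow>
    Lp_pow p lborel (hilbert_sum J (\<lambda>j. of_real (d j))) \<le> ennreal (C * (\<Sum>j\<in>J. d j powr p))"
    using riesz_line_bound[OF p] by metis
  define K where "K = 2 powr p * (3 * pi) powr p"
  define C1 where "C1 = 2 powr p * (C + K * 3 powr p)"
  have K: "0 < K" by (simp add: K_def)
  have C1: "0 < C1" using C K by (simp add: C1_def add_pos_pos)
  have nonneg: "Lp_pow p Z (\<lambda>k. hilbert_sum J (\<lambda>j. of_real (d j)) (of_int k)) \<le> ennreal (C1 * (\<Sum>j\<in>J. d j powr p))"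
    if J: "finite J" and d: "\<And>j. j \<in> J \<Longrightarrow> 0 \<le> d j" for J and d :: "int \<Rightarrow> real"
  proof -
    let ?H = "hilbert_sum J (\<lambda>j. of_real (d j))"
    let ?E = "\<lambda>k::int. complex_of_real (\<Sum>j\<in>J. (3 * d j) * cauchy_kernel (of_int k - of_int j))"
    have "Lp_pow p Z (\<lambda>k. ?H (of_int k)) = Lp_pow p lborel (\<lambda>x. ?H x + (?H (of_int \<lfloor>x\<rfloor>) - ?H x))"
      using Lp_pow_floor[of p "\<lambda>k. ?H (of_int k)"] by simp
    also have "\<dots> \<le> ennreal (2 powr p) * (Lp_pow p lborel ?H + Lp_pow p lborel (\<lambda>x. ?H (of_int \<lfloor>x\<rfloor>) - ?H x))"
      using p by (intro Lp_pow_add) auto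
    also have "Lp_pow p lborel (\<lambda>x. ?H (of_int \<lfloor>x\<rfloor>) - ?H x) \<le> Lp_pow p lborel (\<lambda>x. ?E \<lfloor>x::real\<rfloor>)"
    proof (rule Lp_pow_mono)
      fix x :: real
      have "\<bar>x - of_int \<lfloor>x\<rfloor>\<bar> \<le> 1" using floor_correct[of x] by linarith
      then have "norm (?H x - ?H (of_int \<lfloor>x\<rfloor>)) \<le> (\<Sum>j\<in>J. (3 * norm (complex_of_real (d j))) * cauchy_kernel (of_int \<lfloor>x\<rfloor> - of_int j))"
        by (rule hilbert_sum_diff_le)
      also have "\<dots> = (\<Sum>j\<in>J. (3 * d j) * cauchy_kernel (of_int \<lfloor>x\<rfloor> - of_int j))"
        using d by (intro sum.cong) auto
      also have "\<dots> \<le> norm (?E \<lfloor>x\<rfloor>)" unfolding norm_of_real by simp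
      finally show "norm (?H (of_int \<lfloor>x\<rfloor>) - ?H x) \<le> norm (?E \<lfloor>x\<rfloor>)" by (simp add: norm_minus_commute)
    qed (use p in simp)
    also have "Lp_pow p lborel (\<lambda>x. ?E \<lfloor>x::real\<rfloor>) = Lp_pow p Z ?E" by (rule Lp_pow_floor)
    also have "Lp_pow p Z ?E \<le> ennreal (K * (\<Sum>j\<in>J. (3 * d j) powr p))"
      unfolding K_def using d by (intro Lp_pow_cauchy_sum p J) auto
    also have "(\<Sum>j\<in>J. (3 * d j) powr p) = 3 powr p * (\<Sum>j\<in>J. d j powr p)"
      using d by (simp add: powr_mult sum_distrib_left)
    also have "Lp_pow p lborel ?H \<le> ennreal (C * (\<Sum>j\<in>J. d j powr p))"
      using J d by (intro C)
    finally have "Lp_pow p Z (\<lambda>k. ?H (of_int k)) \<le> ennreal (2 powr p) *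
        (ennreal (C * (\<Sum>j\<in>J. d j powr p)) + ennreal (K * (3 powr p * (\<Sum>j\<in>J. d j powr p))))"
      by (simp add: mult_left_mono add_mono)
    also have "\<dots> = ennreal (2 powr p * (C * (\<Sum>j\<in>J. d j powr p) + K * (3 powr p * (\<Sum>j\<in>J. d j powr p))))"
      using C K by (intro ennreal_mult_add_distrib) (auto intro!: mult_nonneg_nonneg sum_nonneg)
    also have "2 powr p * (C * (\<Sum>j\<in>J. d j powr p) + K * (3 powr p * (\<Sum>j\<in>J. d j powr p))) = C1 * (\<Sum>j\<in>J. d j powr p)"
      by (simp add: C1_def algebra_simps)
    finally show ?thesis .
  qed
  define C2 where "C2 = 2 powr p * (C1 + C1)"
  have C2: "0 < C2" using C1 by (simp add: C2_def)
  have real: "Lp_pow p Z (\<lambda>k. hilbert_sum J (\<lambda>j. of_real (d j)) (of_int k)) \<le> ennreal (C2 * (\<Sum>j\<in>J. \<bar>d j\<bar> powr p))"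
    if J: "finite J" for J and d :: "int \<Rightarrow> real"
  proof -
    let ?P = "\<lambda>j. max (d j) 0" and ?M = "\<lambda>j. max (- d j) 0"
    have "hilbert_sum J (\<lambda>j. of_real (d j)) x = hilbert_sum J (\<lambda>j. of_real (?P j)) x - hilbert_sum J (\<lambda>j. of_real (?M j)) x" for x
      unfolding hilbert_sum_def sum_subtractf[symmetric] by (intro sum.cong) (auto simp: max_def)
    then have "Lp_pow p Z (\<lambda>k. hilbert_sum J (\<lambda>j. of_real (d j)) (of_int k))
        \<le> ennreal (2 powr p) * (Lp_pow p Z (\<lambda>k. hilbert_sum J (\<lambda>j. of_real (?P j)) (of_int k)) + Lp_pow p Z (\<lambda>k. hilbert_sum J (\<lambda>j. of_real (?M j)) (of_int k)))"
      using Lp_pow_diff[of p "\<lambda>k. hilbert_sum J (\<lambda>j. of_real (?P j)) (of_int k)" Z "\<lambda>k. hilbert_sum J (\<lambda>j. of_real (?M j)) (of_int k)"] p by simp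
    also have "\<dots> \<le> ennreal (2 powr p) * (ennreal (C1 * (\<Sum>j\<in>J. \<bar>d j\<bar> powr p)) + ennreal (C1 * (\<Sum>j\<in>J. \<bar>d j\<bar> powr p)))"
    proof (intro mult_left_mono add_mono)
      show "Lp_pow p Z (\<lambda>k. hilbert_sum J (\<lambda>j. of_real (?P j)) (of_int k)) \<le> ennreal (C1 * (\<Sum>j\<in>J. \<bar>d j\<bar> powr p))"
        using C1 p by (intro order_trans[OF nonneg[OF J]] ennreal_leI mult_left_mono sum_mono powr_mono2) auto
      show "Lp_pow p Z (\<lambda>k. hilbert_sum J (\<lambda>j. of_real (?M j)) (of_int k)) \<le> ennreal (C1 * (\<Sum>j\<in>J. \<bar>d j\<bar> powr p))"
        using C1 p by (intro order_trans[OF nonneg[OF J]] ennreal_leI mult_left_mono sum_mono powr_mono2) auto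
    qed auto
    also have "\<dots> = ennreal (C2 * (\<Sum>j\<in>J. \<bar>d j\<bar> powr p))"
      using C1 by (subst ennreal_mult_add_distrib) (auto simp: sum_nonneg C2_def algebra_simps)
    finally show ?thesis .
  qed
  define C3 where "C3 = 2 powr p * (C2 + C2)"
  have C3: "0 < C3" using C2 by (simp add: C3_def)
  have "Lp_pow p Z (\<lambda>k. hilbert_sum J d (of_int k)) \<le> ennreal (C3 * (\<Sum>j\<in>J. norm (d j) powr p))"
    if J: "finite J" for J and d :: "int \<Rightarrow> complex"
  proof -
    let ?P = "\<lambda>k::int. hilbert_sum J (\<lambda>j. of_real (Re (d j))) (of_int k)" and ?M = "\<lambda>k::int. \<i> * hilbert_sum J (\<lambda>j. of_real (Im (d j))) (of_int k)"
    have "hilbert_sum J d x = hilbert_sum J (\<lambda>j. of_real (Re (d j))) x + \<i> * hilbert_sum J (\<lambda>j. of_real (Im (d j))) x" for x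
      unfolding hilbert_sum_def sum_distrib_left sum.distrib[symmetric]
      by (intro sum.cong refl) (metis complex_eq distrib_right mult.assoc)
    then have "Lp_pow p Z (\<lambda>k. hilbert_sum J d (of_int k)) \<le> ennreal (2 powr p) * (Lp_pow p Z ?P + Lp_pow p Z ?M)"
      using Lp_pow_add[of p ?P Z ?M] p by simp
    also have "\<dots> \<le> ennreal (2 powr p) * (ennreal (C2 * (\<Sum>j\<in>J. norm (d j) powr p)) + ennreal (C2 * (\<Sum>j\<in>J. norm (d j) powr p)))"
    proof (intro mult_left_mono add_mono)
      show "Lp_pow p Z ?P \<le> ennreal (C2 * (\<Sum>j\<in>J. norm (d j) powr p))"
        using C2 p by (intro order_trans[OF real[OF J]] ennreal_leI mult_left_mono sum_mono powr_mono2 abs_Re_le_cmod) auto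
      show "Lp_pow p Z ?M \<le> ennreal (C2 * (\<Sum>j\<in>J. norm (d j) powr p))"
        using C2 p by (subst Lp_pow_cmult, simp)
          (simp, intro order_trans[OF real[OF J]] ennreal_leI mult_left_mono sum_mono powr_mono2 abs_Im_le_cmod, auto)
    qed auto
    also have "\<dots> = ennreal (C3 * (\<Sum>j\<in>J. norm (d j) powr p))"
      using C2 by (subst ennreal_mult_add_distrib) (auto simp: sum_nonneg C3_def algebra_simps)
    finally show ?thesis .
  qed
  with C3 show ?thesis unfolding hilbert_bounded_def by blast
qed

text \<open>The transpose of the kernel is minus its complex conjugate. So the pairing of the transform of \<open>d\<close>
with \<open>e\<close> is, up to sign and conjugation, that of \<open>d\<close> with the transform of the conjugate of \<open>e\<close>.
Testing with the \<open>e\<close> that realises the norm gives the bound for \<open>p\<close> from the bound for \<open>q\<close>.\<close>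

lemma hilbert_bounded_dual:
  assumes p: "1 < p" "1 < q" "1 / p + 1 / q = 1" and hq: "hilbert_bounded q"
  shows "hilbert_bounded p"
proof -
  obtain C where C: "0 < C" "\<And>J d. finite J \<Longrightarrow>
      Lp_pow q Z (\<lambda>k. hilbert_sum J d (of_int k)) \<le> ennreal (C * (\<Sum>j\<in>J. norm (d j) powr q))"
    using hq unfolding hilbert_bounded_def by blast
  \<comment> \<open>Weight in Young's inequality, small enough for the term with the transform of \<open>e\<close> to be absorbed.\<close>
  define l where "l = (1 / (2 * C)) powr (1 / q)"
  have l: "0 < l" using C by (simp add: l_def)
  have lq: "l powr q = 1 / (2 * C)" using C p by (simp add: l_def powr_powr)
  have pq: "(p - 1) * q = p" using p(3) p(1,2) by (simp add: field_simps)
  have "Lp_pow p Z (\<lambda>k. hilbert_sum J d (of_int k)) \<le> ennreal (2 * (1 / l) powr p * (\<Sum>j\<in>J. norm (d j) powr p))"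
    if J: "finite J" for J and d :: "int \<Rightarrow> complex"
  proof (rule Lp_pow_Z_leI)
    fix K :: "int set" assume K: "finite K"
    define y where "y k = hilbert_sum J d (of_int k)" for k :: int
    \<comment> \<open>The extremal test sequence: both \<open>y k * e k\<close> and the \<open>q\<close>-th power of \<open>\<bar>e k\<bar>\<close> are \<open>\<bar>y k\<bar>\<^sup>p\<close>.\<close>
    define e where "e k = cnj (y k) * of_real (norm (y k) powr (p - 2))" for k
    define S where "S = (\<Sum>k\<in>K. norm (y k) powr p)"
    have norm_e: "norm (e k) powr q = norm (y k) powr p" for k
    proof (cases "y k = 0")
      case False
      have "norm (e k) = norm (y k) powr 1 * norm (y k) powr (p - 2)" by (simp add: e_def norm_mult)
      also have "\<dots> = norm (y k) powr (p - 1)" by (subst powr_add[symmetric]) simp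
      finally show ?thesis using pq by (simp add: powr_powr)
    qed (simp add: e_def)
    have ye: "y k * e k = of_real (norm (y k) powr p)" for k
    proof (cases "y k = 0")
      case False
      have "y k * e k = (y k * cnj (y k)) * of_real (norm (y k) powr (p - 2))"
        by (simp add: e_def mult.assoc)
      also have "y k * cnj (y k) = of_real (norm (y k) powr 2)"
        using complex_norm_square[of "y k"] by simp
      also have "\<dots> * of_real (norm (y k) powr (p - 2)) = complex_of_real (norm (y k) powr 2 * norm (y k) powr (p - 2))"
        by (rule of_real_mult[symmetric])
      also have "norm (y k) powr 2 * norm (y k) powr (p - 2) = norm (y k) powr p"
        by (subst powr_add[symmetric]) simp
      finally show ?thesis .
    qed (simp add: e_def)
    define w where "w j = hilbert_sum K (\<lambda>k. cnj (e k)) (of_int j)" for j :: int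
    have "complex_of_real S = (\<Sum>k\<in>K. y k * e k)" by (simp add: S_def ye)
    also have "\<dots> = (\<Sum>k\<in>K. \<Sum>j\<in>J. d j * (e k * hilbert_kernel (of_int k - of_int j)))"
      unfolding y_def hilbert_sum_def sum_distrib_right by (intro sum.cong refl) (simp add: mult_ac)
    also have "\<dots> = (\<Sum>j\<in>J. \<Sum>k\<in>K. d j * (e k * hilbert_kernel (of_int k - of_int j)))"
      by (rule sum.swap)
    also have "\<dots> = (\<Sum>j\<in>J. d j * - cnj (w j))"
    proof (intro sum.cong refl)
      fix j
      have "e k * hilbert_kernel (of_int k - of_int j) = - cnj (cnj (e k) * hilbert_kernel (of_int j - of_int k))" for k
        using hilbert_kernel_minus[of "of_int j - of_int k"] by simp
      then show "(\<Sum>k\<in>K. d j * (e k * hilbert_kernel (of_int k - of_int j))) = d j * - cnj (w j)"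
        unfolding w_def hilbert_sum_def by (simp add: sum_distrib_left sum_negf)
    qed
    finally have "norm (complex_of_real S) \<le> (\<Sum>j\<in>J. norm (d j * - cnj (w j)))"
      by (metis norm_sum)
    moreover have "0 \<le> S" by (simp add: S_def sum_nonneg)
    ultimately have "S \<le> (\<Sum>j\<in>J. norm (d j) * norm (w j))" by (simp add: norm_mult)
    also have "\<dots> \<le> (\<Sum>j\<in>J. (1 / l) powr p * norm (d j) powr p + l powr q * norm (w j) powr q)"
    proof (rule sum_mono)
      fix j
      have "norm (d j) * norm (w j) = (1 / l * norm (d j)) * (l * norm (w j))" using l by simp
      also have "\<dots> \<le> (1 / l * norm (d j)) powr p / p + (l * norm (w j)) powr q / q"
        using p l by (intro Youngs_inequality) auto
      also have "\<dots> \<le> (1 / l * norm (d j)) powr p / 1 + (l * norm (w j)) powr q / 1"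
        using p by (intro add_mono divide_left_mono) auto
      also have "\<dots> = (1 / l) powr p * norm (d j) powr p + l powr q * norm (w j) powr q"
        using l by (simp only: powr_mult div_by_1)
      finally show "norm (d j) * norm (w j) \<le> (1 / l) powr p * norm (d j) powr p + l powr q * norm (w j) powr q" .
    qed
    also have "\<dots> = (1 / l) powr p * (\<Sum>j\<in>J. norm (d j) powr p) + l powr q * (\<Sum>j\<in>J. norm (w j) powr q)"
      by (simp add: sum.distrib sum_distrib_left)
    also have "(\<Sum>j\<in>J. norm (w j) powr q) \<le> C * S"
    proof -
      have "ennreal (\<Sum>j\<in>J. norm (w j) powr q) \<le> Lp_pow q Z w"
        by (rule sum_le_Lp_pow_Z[OF J])
      also have "\<dots> \<le> ennreal (C * (\<Sum>k\<in>K. norm (cnj (e k)) powr q))"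
        unfolding w_def by (rule C(2)[OF K])
      also have "(\<Sum>k\<in>K. norm (cnj (e k)) powr q) = S" by (simp add: S_def norm_e)
      finally show ?thesis using C \<open>0 \<le> S\<close> by (simp add: ennreal_le_iff)
    qed
    finally have "S \<le> (1 / l) powr p * (\<Sum>j\<in>J. norm (d j) powr p) + l powr q * (C * S)"
      by (simp add: mult_left_mono)
    also have "l powr q * (C * S) = S / 2" using C by (simp add: lq)
    finally show "(\<Sum>k\<in>K. norm (hilbert_sum J d (of_int k)) powr p) \<le> 2 * (1 / l) powr p * (\<Sum>j\<in>J. norm (d j) powr p)"
      by (simp add: S_def y_def)
  qed
  moreover have "0 < 2 * (1 / l) powr p" using l by simp
  ultimately show ?thesis unfolding hilbert_bounded_def by blast
qed

lemma hilbert_bounded: "1 < p \<Longrightarrow> hilbert_bounded p"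
proof (cases "p \<le> 2")
  case False
  then have "hilbert_bounded (p / (p - 1))" by (intro hilbert_bounded_le_2) (auto simp: field_simps)
  then show ?thesis by (rule hilbert_bounded_dual[rotated 3]) (use False in \<open>auto simp: field_simps\<close>)
qed (rule hilbert_bounded_le_2)

section \<open>The sinc series as an operator from lp to Lp\<close>

lemma sinc_pi_mult: "sin (pi * t) = pi * t * sinc_pi t"
  by (simp add: sinc_pi_def)

text \<open>Combines \<open>\<bar>sinc t\<bar> \<le> 1\<close> with the decay \<open>\<bar>t * sinc t\<bar> \<le> 1\<close>.\<close>

lemma abs_sinc_pi_le: "\<bar>sinc_pi t\<bar> * (\<bar>t\<bar> + 2) \<le> 3"
proof (cases "t = 0")
  case False
  have 1: "\<bar>sinc_pi t\<bar> \<le> 1"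
    using abs_sin_x_le_abs_x[of "pi * t"] False by (simp add: sinc_pi_def divide_simps)
  have "pi * (\<bar>t\<bar> * \<bar>sinc_pi t\<bar>) = \<bar>sin (pi * t)\<bar>"
    by (simp add: sinc_pi_mult abs_mult)
  also have "\<dots> \<le> pi * 1" using abs_sin_le_one[of "pi * t"] pi_ge_two by linarith
  finally have "\<bar>t\<bar> * \<bar>sinc_pi t\<bar> \<le> 1" by (subst (asm) mult_le_cancel_left_pos) auto
  with 1 show ?thesis by (simp add: algebra_simps)
qed (simp add: sinc_pi_def)

lemma sinc_pi_measurable [measurable]: "sinc_pi \<in> borel_measurable borel"
  unfolding sinc_pi_def by measurable

text \<open>Replacing \<open>1 / t\<close> in the sinc function by the kernel at a nearby integer costs only a multiple of the
Cauchy kernel, because \<open>sin (\<pi> * t) = \<pi> * t * sinc t\<close> turns the difference into a product of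
\<open>sinc t\<close>, the kernel, and a bounded factor.\<close>

lemma sinc_pi_hilbert_kernel:
  assumes "\<bar>t - of_int n\<bar> \<le> 1"
  shows "norm (complex_of_real (sinc_pi t) - of_real (sin (pi * t) / pi) * hilbert_kernel (of_int n)) \<le> 6 * cauchy_kernel (of_int n)"
proof -
  have "(of_int n + \<i>) * hilbert_kernel (of_int n) = 1"
    using real_plus_i_neq_0[of "of_int n"] by (simp add: hilbert_kernel_def)
  then have "complex_of_real (sinc_pi t) - of_real (sin (pi * t) / pi) * hilbert_kernel (of_int n)
     = of_real (sinc_pi t) * ((of_int n + \<i>) * hilbert_kernel (of_int n)) - of_real (t * sinc_pi t) * hilbert_kernel (of_int n)"
    by (simp add: sinc_pi_mult)
  also have "\<dots> = of_real (sinc_pi t) * ((of_real (of_int n - t) + \<i>) * hilbert_kernel (of_int n))"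
    by (simp add: algebra_simps)
  also have "norm \<dots> = \<bar>sinc_pi t\<bar> * (norm (of_real (of_int n - t) + \<i>) * sqrt (cauchy_kernel (of_int n)))"
    by (simp add: norm_mult norm_hilbert_kernel del: of_real_diff)
  also have "\<dots> \<le> (3 * sqrt (cauchy_kernel (of_int n))) * (2 * sqrt (cauchy_kernel (of_int n)))"
  proof (intro mult_mono)
    have "norm (complex_of_real (of_int n) + \<i>) \<le> \<bar>of_int n\<bar> + 1"
      using norm_triangle_ineq[of "complex_of_real (of_int n)" \<i>] by simp
    also have "\<dots> \<le> \<bar>t\<bar> + 2" using assms by linarith
    finally have s: "sqrt (1 + (of_int n)\<^sup>2) \<le> \<bar>t\<bar> + 2" by (simp only: norm_real_plus_i)
    have pos: "0 < sqrt (1 + (real_of_int n)\<^sup>2)" by (simp add: add_pos_nonneg)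
    have "\<bar>sinc_pi t\<bar> * sqrt (1 + (of_int n)\<^sup>2) \<le> \<bar>sinc_pi t\<bar> * (\<bar>t\<bar> + 2)"
      using s by (intro mult_left_mono) auto
    also have "\<dots> \<le> 3" by (rule abs_sinc_pi_le)
    finally show "\<bar>sinc_pi t\<bar> \<le> 3 * sqrt (cauchy_kernel (of_int n))"
      using pos by (simp add: cauchy_kernel_def real_sqrt_divide field_simps)
    have "norm (complex_of_real (of_int n - t) + \<i>) \<le> norm (complex_of_real (of_int n - t)) + norm \<i>"
      by (rule norm_triangle_ineq)
    also have "\<dots> \<le> 2" unfolding norm_of_real using assms by (simp add: abs_minus_commute)
    finally show "norm (complex_of_real (of_int n - t) + \<i>) \<le> 2" .
  qed auto
  also have "\<dots> = 6 * cauchy_kernel (of_int n)" by simp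
  finally show ?thesis .
qed

definition sinc_series :: "(int \<Rightarrow> complex) \<Rightarrow> real \<Rightarrow> complex" where
  "sinc_series d x = (\<Sum>\<^sub>\<infinity>k. d k * complex_of_real (sinc_pi (x - of_int k)))"

definition sinc_sum :: "int set \<Rightarrow> (int \<Rightarrow> complex) \<Rightarrow> real \<Rightarrow> complex" where
  "sinc_sum J d x = (\<Sum>k\<in>J. d k * complex_of_real (sinc_pi (x - of_int k)))"

lemma sinc_sum_measurable [measurable]: "sinc_sum J d \<in> borel_measurable borel"
  unfolding sinc_sum_def by measurable

text \<open>Since \<open>sin (\<pi> * (x - j)) = sin (\<pi> * x) * cos (\<pi> * j)\<close>, on each unit cell the sinc sum is a bounded
function times the discrete Hilbert transform of the coefficients with alternating signs, up to an
error that the Schur test controls.\<close>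

lemma sinc_sum_bounded:
  assumes p: "1 < p"
  obtains C where "0 < C"
    "\<And>J d. finite J \<Longrightarrow> Lp_pow p lborel (sinc_sum J d) \<le> ennreal (C * (\<Sum>j\<in>J. norm (d j) powr p))"
proof -
  obtain C where C: "0 < C" "\<And>J d. finite J \<Longrightarrow>
      Lp_pow p Z (\<lambda>k. hilbert_sum J d (of_int k)) \<le> ennreal (C * (\<Sum>j\<in>J. norm (d j) powr p))"
    using hilbert_bounded[OF p] unfolding hilbert_bounded_def by blast
  define K where "K = 2 powr p * (3 * pi) powr p"
  define C1 where "C1 = 2 powr p * (C + K * 6 powr p)"
  have K: "0 < K" by (simp add: K_def)
  have "Lp_pow p lborel (sinc_sum J d) \<le> ennreal (C1 * (\<Sum>j\<in>J. norm (d j) powr p))"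
    if J: "finite J" for J d
  proof -
    let ?d = "\<lambda>j. d j * of_real (cos (pi * of_int j))"
    have nd: "norm (?d j) = norm (d j)" for j
      by (simp add: norm_mult)
    let ?A = "\<lambda>k::int. hilbert_sum J ?d (of_int k)"
    let ?E = "\<lambda>k::int. complex_of_real (\<Sum>j\<in>J. (6 * norm (d j)) * cauchy_kernel (of_int k - of_int j))"
    have le: "norm (sinc_sum J d x - of_real (sin (pi * x) / pi) * ?A \<lfloor>x\<rfloor>) \<le> norm (?E \<lfloor>x\<rfloor>)" for x
    proof -
      have "norm (sinc_sum J d x - of_real (sin (pi * x) / pi) * ?A \<lfloor>x\<rfloor>)
          = norm (\<Sum>j\<in>J. d j * of_real (sinc_pi (x - of_int j)) - of_real (sin (pi * x) / pi) * (?d j * hilbert_kernel (of_int \<lfloor>x\<rfloor> - of_int j)))"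
        by (simp add: sinc_sum_def hilbert_sum_def sum_distrib_left sum_subtractf)
      also have "\<dots> \<le> (\<Sum>j\<in>J. (6 * norm (d j)) * cauchy_kernel (of_int \<lfloor>x\<rfloor> - of_int j))"
      proof (rule sum_norm_le)
        fix j
        have s: "sin (pi * x) * cos (pi * of_int j) = sin (pi * (x - of_int j))"
          using sin_npi_int[of j] by (simp add: right_diff_distrib sin_diff mult.commute)
        have "\<bar>(x - of_int j) - of_int (\<lfloor>x\<rfloor> - j)\<bar> \<le> 1" using floor_correct[of x] by simp linarith
        from sinc_pi_hilbert_kernel[OF this]
        have b: "norm (complex_of_real (sinc_pi (x - of_int j)) - of_real (sin (pi * (x - of_int j)) / pi) * hilbert_kernel (of_int \<lfloor>x\<rfloor> - of_int j))
            \<le> 6 * cauchy_kernel (of_int \<lfloor>x\<rfloor> - of_int j)" by simp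
        have "d j * of_real (sinc_pi (x - of_int j)) - of_real (sin (pi * x) / pi) * (?d j * hilbert_kernel (of_int \<lfloor>x\<rfloor> - of_int j))
          = d j * (complex_of_real (sinc_pi (x - of_int j)) - of_real (sin (pi * (x - of_int j)) / pi) * hilbert_kernel (of_int \<lfloor>x\<rfloor> - of_int j))"
          unfolding s[symmetric] by (simp add: algebra_simps)
        then show "norm (d j * of_real (sinc_pi (x - of_int j)) - of_real (sin (pi * x) / pi) * (?d j * hilbert_kernel (of_int \<lfloor>x\<rfloor> - of_int j)))
           \<le> 6 * norm (d j) * cauchy_kernel (of_int \<lfloor>x\<rfloor> - of_int j)"
          using mult_left_mono[OF b, of "norm (d j)"] by (simp add: norm_mult mult_ac)
      qed
      also have "\<dots> \<le> norm (?E \<lfloor>x\<rfloor>)" unfolding norm_of_real by simp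
      finally show ?thesis .
    qed
    have "Lp_pow p lborel (sinc_sum J d)
        = Lp_pow p lborel (\<lambda>x. of_real (sin (pi * x) / pi) * ?A \<lfloor>x\<rfloor> + (sinc_sum J d x - of_real (sin (pi * x) / pi) * ?A \<lfloor>x\<rfloor>))"
      by simp
    also have "\<dots> \<le> ennreal (2 powr p) * (Lp_pow p lborel (\<lambda>x::real. of_real (sin (pi * x) / pi) * ?A \<lfloor>x\<rfloor>)
        + Lp_pow p lborel (\<lambda>x. sinc_sum J d x - of_real (sin (pi * x) / pi) * ?A \<lfloor>x\<rfloor>))"
      using p by (intro Lp_pow_add) measurable
    also have "\<dots> \<le> ennreal (2 powr p) * (Lp_pow p lborel (\<lambda>x::real. ?A \<lfloor>x\<rfloor>) + Lp_pow p lborel (\<lambda>x::real. ?E \<lfloor>x\<rfloor>))"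
    proof (intro mult_left_mono add_mono Lp_pow_mono le)
      fix x :: real
      have "\<bar>sin (pi * x)\<bar> \<le> pi" using abs_sin_le_one[of "pi * x"] pi_ge_two by linarith
      then have "\<bar>sin (pi * x) / pi\<bar> \<le> 1" by (simp add: divide_simps)
      then have "norm (complex_of_real (sin (pi * x) / pi)) \<le> 1" unfolding norm_of_real .
      then show "norm (of_real (sin (pi * x) / pi) * ?A \<lfloor>x\<rfloor>) \<le> norm (?A \<lfloor>x\<rfloor>)"
        unfolding norm_mult by (rule mult_left_le_one_le[rotated 2]) auto
    qed (use p in auto)
    also have "Lp_pow p lborel (\<lambda>x::real. ?A \<lfloor>x\<rfloor>) = Lp_pow p Z ?A" by (rule Lp_pow_floor)
    also have "Lp_pow p lborel (\<lambda>x::real. ?E \<lfloor>x\<rfloor>) = Lp_pow p Z ?E" by (rule Lp_pow_floor)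
    also have "ennreal (2 powr p) * (Lp_pow p Z ?A + Lp_pow p Z ?E)
        \<le> ennreal (2 powr p) * (ennreal (C * (\<Sum>j\<in>J. norm (?d j) powr p)) + ennreal (K * (\<Sum>j\<in>J. (6 * norm (d j)) powr p)))"
      unfolding K_def by (intro mult_left_mono add_mono C(2)[OF J] Lp_pow_cauchy_sum p J) auto
    also have "\<dots> = ennreal (2 powr p * (C * (\<Sum>j\<in>J. norm (?d j) powr p) + K * (\<Sum>j\<in>J. (6 * norm (d j)) powr p)))"
      using C K by (intro ennreal_mult_add_distrib) (auto intro!: mult_nonneg_nonneg sum_nonneg)
    also have "2 powr p * (C * (\<Sum>j\<in>J. norm (?d j) powr p) + K * (\<Sum>j\<in>J. (6 * norm (d j)) powr p)) = C1 * (\<Sum>j\<in>J. norm (d j) powr p)"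
      unfolding nd by (simp add: powr_mult C1_def algebra_simps sum_distrib_left)
    finally show ?thesis .
  qed
  moreover have "0 < C1" using C K by (simp add: C1_def add_pos_pos)
  ultimately show ?thesis using that by blast
qed

lemma filterlim_int_exhaustion:
  fixes A :: "nat \<Rightarrow> int set"
  assumes "\<And>n. finite (A n)" "\<And>n x. \<bar>x\<bar> < int n \<Longrightarrow> x \<in> A n"
  shows "filterlim A (finite_subsets_at_top UNIV) sequentially"
  unfolding filterlim_finite_subsets_at_top
proof (intro allI impI)
  fix X :: "int set" assume "finite X \<and> X \<subseteq> UNIV"
  then have X: "finite X" by simp
  define N where "N = (\<Sum>x\<in>X. nat \<bar>x\<bar>)"
  have "nat \<bar>x\<bar> \<le> N" if "x \<in> X" for x unfolding N_def using X that by (intro member_le_sum) auto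
  then have "X \<subseteq> A n" if "Suc N \<le> n" for n
    using assms(2) that by fastforce
  then show "\<forall>\<^sub>F n in sequentially. finite (A n) \<and> X \<subseteq> A n \<and> A n \<subseteq> UNIV"
    using assms(1) by (intro eventually_mono[OF eventually_ge_at_top[of "Suc N"]]) simp
qed

lemma filterlim_symmetric_intervals:
  "filterlim (\<lambda>n. {- int n..int n}) (finite_subsets_at_top UNIV) sequentially"
  by (rule filterlim_int_exhaustion) auto

lemma summable_on_of_Lp_pow_1:
  assumes "Lp_pow 1 Z g < \<infinity>" shows "(\<lambda>k. norm (g k)) summable_on UNIV"
proof (rule nonneg_bdd_above_summable_on)
  obtain B where B: "0 \<le> B" "Lp_pow 1 Z g = ennreal B"
    using assms by (cases "Lp_pow 1 Z g") auto
  have "(\<Sum>k\<in>F. norm (g k)) \<le> B" if "finite F" for F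
    using sum_le_Lp_pow_Z[OF that, of g 1] B by simp
  then show "bdd_above (sum (\<lambda>k. norm (g k)) ` {F. F \<subseteq> UNIV \<and> finite F})"
    by (intro bdd_aboveI[of _ B]) auto
qed simp

text \<open>The sinc function decays like \<open>1 / \<bar>t\<bar>\<close>, so its integer translates are \<open>q\<close>-summable for every
\<open>q > 1\<close>. With the conjugate exponent this makes the sinc series of an \<open>lp\<close> sequence absolutely
convergent.\<close>

lemma sinc_powr_finite:
  assumes q: "1 < q"
  obtains B where "\<And>x. (\<integral>\<^sup>+k. ennreal (\<bar>sinc_pi (x - of_int k)\<bar> powr q) \<partial>Z) \<le> ennreal B"
proof -
  let ?g = "\<lambda>t::real. 3 powr q * (1 + \<bar>t\<bar>) powr (- q)"
  define I where "I = (\<integral>\<^sup>+t. ennreal (?g t) * indicator {0..} t \<partial>lborel)"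
  have "I = (\<integral>\<^sup>+t. ennreal (3 powr q * (1 + t) powr (- q)) * indicator {0..} t \<partial>lborel)"
    unfolding I_def by (intro nn_integral_cong) (auto simp: indicator_def)
  also have "\<dots> = ennreal (0 - (3 powr q * (1 + 0) powr (1 - q) / (1 - q)))"
  proof (rule nn_integral_FTC_atLeast)
    show "((\<lambda>t. 3 powr q * (1 + t) powr (1 - q) / (1 - q)) \<longlongrightarrow> 0) at_top"
      using q by real_asymp
    show "((\<lambda>t. 3 powr q * (1 + t) powr (1 - q) / (1 - q)) has_real_derivative 3 powr q * (1 + t) powr (- q)) (at t)"
      if "0 \<le> t" for t
      using that q by (auto intro!: derivative_eq_intros)
  qed auto
  finally have I: "I = ennreal (3 powr q / (q - 1))" using q by (simp flip: divide_minus_right)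
  have J: "(\<integral>\<^sup>+t. ennreal (?g t) \<partial>lborel) \<le> I + I"
  proof -
    have "(\<integral>\<^sup>+t. ennreal (?g t) \<partial>lborel)
      \<le> (\<integral>\<^sup>+t. ennreal (?g t) * indicator {0..} t + ennreal (?g (0 - t)) * indicator {0..} (0 - t) \<partial>lborel)"
      by (intro nn_integral_mono) (auto simp: indicator_def)
    also have "\<dots> = I + (\<integral>\<^sup>+t. ennreal (?g (0 - t)) * indicator {0..} (0 - t) \<partial>lborel)"
      unfolding I_def by (intro nn_integral_add) auto
    also have "(\<integral>\<^sup>+t. ennreal (?g (0 - t)) * indicator {0..} (0 - t) \<partial>lborel) = I"
      unfolding I_def by (rule nn_integral_lborel_reflect) measurable
    finally show ?thesis .
  qed
  have "(\<integral>\<^sup>+k. ennreal (\<bar>sinc_pi (x - of_int k)\<bar> powr q) \<partial>Z) \<le> I + I" for x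
  proof -
    have "(\<integral>\<^sup>+k. ennreal (\<bar>sinc_pi (x - of_int k)\<bar> powr q) \<partial>Z)
       = (\<integral>\<^sup>+t. ennreal (\<bar>sinc_pi (x - of_int \<lfloor>t::real\<rfloor>)\<bar> powr q) \<partial>lborel)"
      by (rule nn_integral_floor[symmetric])
    also have "\<dots> \<le> (\<integral>\<^sup>+t. ennreal (?g (x - t)) \<partial>lborel)"
    proof (intro nn_integral_mono ennreal_leI)
      fix t :: real
      have f: "1 + \<bar>x - t\<bar> \<le> \<bar>x - of_int \<lfloor>t\<rfloor>\<bar> + 2" using floor_correct[of t] by linarith
      have "\<bar>sinc_pi (x - of_int \<lfloor>t\<rfloor>)\<bar> * (1 + \<bar>x - t\<bar>) \<le> 3"
        using mult_left_mono[OF f, of "\<bar>sinc_pi (x - of_int \<lfloor>t\<rfloor>)\<bar>"] abs_sinc_pi_le[of "x - of_int \<lfloor>t\<rfloor>"] by simp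
      then have "\<bar>sinc_pi (x - of_int \<lfloor>t\<rfloor>)\<bar> \<le> 3 / (1 + \<bar>x - t\<bar>)" by (simp add: field_simps)
      then have "\<bar>sinc_pi (x - of_int \<lfloor>t\<rfloor>)\<bar> powr q \<le> (3 / (1 + \<bar>x - t\<bar>)) powr q"
        using q by (intro powr_mono2) auto
      also have "\<dots> = ?g (x - t)" by (simp add: powr_divide powr_minus_divide)
      finally show "\<bar>sinc_pi (x - of_int \<lfloor>t\<rfloor>)\<bar> powr q \<le> ?g (x - t)" .
    qed
    also have "\<dots> = (\<integral>\<^sup>+t. ennreal (?g t) \<partial>lborel)"
      by (rule nn_integral_lborel_reflect) measurable
    finally show ?thesis using J by (rule order_trans)
  qed
  moreover have "I + I = ennreal (2 * (3 powr q / (q - 1)))"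
    unfolding I using q by (subst ennreal_plus[symmetric]) auto
  ultimately show ?thesis using that by metis
qed

lemma sinc_series_summable:
  assumes p: "1 < p" and d: "Lp_pow p Z d < \<infinity>"
  shows "(\<lambda>k. norm (d k * complex_of_real (sinc_pi (x - of_int k)))) summable_on UNIV"
proof (rule summable_on_of_Lp_pow_1)
  define q where "q = p / (p - 1)"
  have q: "1 < q" "1 / p + 1 / q = 1" using p by (auto simp: q_def field_simps)
  obtain B where B: "\<And>x. (\<integral>\<^sup>+k. ennreal (\<bar>sinc_pi (x - of_int k)\<bar> powr q) \<partial>Z) \<le> ennreal B"
    using sinc_powr_finite[OF q(1)] by metis
  have "Lp_pow 1 Z (\<lambda>k. d k * complex_of_real (sinc_pi (x - of_int k)))
      \<le> (\<integral>\<^sup>+k. ennreal (norm (d k) powr p) + ennreal (\<bar>sinc_pi (x - of_int k)\<bar> powr q) \<partial>Z)"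
    unfolding Lp_pow_def
  proof (rule nn_integral_mono)
    fix k
    have "norm (d k) * \<bar>sinc_pi (x - of_int k)\<bar> \<le> norm (d k) powr p / p + \<bar>sinc_pi (x - of_int k)\<bar> powr q / q"
      using p q by (intro Youngs_inequality) auto
    also have "\<dots> \<le> norm (d k) powr p / 1 + \<bar>sinc_pi (x - of_int k)\<bar> powr q / 1"
      using p q by (intro add_mono divide_left_mono) auto
    finally have "norm (d k * complex_of_real (sinc_pi (x - of_int k))) powr 1 \<le> norm (d k) powr p + \<bar>sinc_pi (x - of_int k)\<bar> powr q"
      by (simp add: norm_mult)
    then have "ennreal (norm (d k * complex_of_real (sinc_pi (x - of_int k))) powr 1)
       \<le> ennreal (norm (d k) powr p + \<bar>sinc_pi (x - of_int k)\<bar> powr q)" by (rule ennreal_leI)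
    then show "ennreal (norm (d k * complex_of_real (sinc_pi (x - of_int k))) powr 1)
       \<le> ennreal (norm (d k) powr p) + ennreal (\<bar>sinc_pi (x - of_int k)\<bar> powr q)" by simp
  qed
  also have "\<dots> = Lp_pow p Z d + (\<integral>\<^sup>+k. ennreal (\<bar>sinc_pi (x - of_int k)\<bar> powr q) \<partial>Z)"
    by (simp add: nn_integral_add Lp_pow_def)
  also have "\<dots> < \<infinity>" using d B[of x] by (auto simp: less_top[symmetric] top_unique)
  finally show "Lp_pow 1 Z (\<lambda>k. d k * complex_of_real (sinc_pi (x - of_int k))) < \<infinity>" .
qed

lemma sinc_series_has_sum:
  assumes "1 < p" "Lp_pow p Z d < \<infinity>"
  shows "((\<lambda>k. d k * complex_of_real (sinc_pi (x - of_int k))) has_sum sinc_series d x) UNIV"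
  unfolding sinc_series_def by (rule has_sum_infsum[OF abs_summable_summable[OF sinc_series_summable[OF assms]]])

lemma sinc_series_add:
  assumes "1 < p" "Lp_pow p Z a < \<infinity>" "Lp_pow p Z b < \<infinity>"
  shows "sinc_series (\<lambda>k. a k + b k) x = sinc_series a x + sinc_series b x"
  unfolding sinc_series_def[of "\<lambda>k. a k + b k"]
  using has_sum_add[OF sinc_series_has_sum[OF assms(1,2)] sinc_series_has_sum[OF assms(1,3)]]
  by (intro infsumI) (simp add: distrib_right)

lemma sinc_series_LIMSEQ:
  assumes "1 < p" "Lp_pow p Z d < \<infinity>"
  shows "(\<lambda>n. sinc_sum {- int n..int n} d x) \<longlonglongrightarrow> sinc_series d x"
  using filterlim_compose[OF sinc_series_has_sum[OF assms, of x, unfolded has_sum_def] filterlim_symmetric_intervals]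
  unfolding sinc_sum_def .

lemma sinc_series_measurable:
  assumes "1 < p" "Lp_pow p Z d < \<infinity>"
  shows "sinc_series d \<in> borel_measurable borel"
  by (rule borel_measurable_LIMSEQ_metric[OF _ sinc_series_LIMSEQ[OF assms]]) measurable

text \<open>The finite bound is uniform, and the partial sums converge pointwise; Fatou's lemma concludes.\<close>

theorem sinc_series_bounded:
  assumes p: "1 < p"
  obtains C where "0 < C"
    "\<And>d. Lp_pow p Z d < \<infinity> \<Longrightarrow> Lp_pow p lborel (sinc_series d) \<le> ennreal C * Lp_pow p Z d"
proof -
  obtain C where C: "0 < C"
    "\<And>J d. finite J \<Longrightarrow> Lp_pow p lborel (sinc_sum J d) \<le> ennreal (C * (\<Sum>j\<in>J. norm (d j) powr p))"
    using sinc_sum_bounded[OF p] by metis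
  have "Lp_pow p lborel (sinc_series d) \<le> ennreal C * Lp_pow p Z d" if d: "Lp_pow p Z d < \<infinity>" for d
  proof -
    let ?u = "\<lambda>n x. ennreal (norm (sinc_sum {- int n..int n} d x) powr p)"
    have "ennreal (norm (sinc_series d x) powr p) = liminf (\<lambda>n. ?u n x)" for x
    proof -
      have "(\<lambda>n. norm (sinc_sum {- int n..int n} d x) powr p) \<longlonglongrightarrow> norm (sinc_series d x) powr p"
        by (rule tendsto_powr'[OF tendsto_norm[OF sinc_series_LIMSEQ[OF p d]] tendsto_const]) (use p in auto)
      then have "(\<lambda>n. ?u n x) \<longlonglongrightarrow> ennreal (norm (sinc_series d x) powr p)"
        by (rule tendsto_ennrealI)
      then show ?thesis by (intro lim_imp_Liminf[symmetric]) auto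
    qed
    then have "Lp_pow p lborel (sinc_series d) = (\<integral>\<^sup>+x. liminf (\<lambda>n. ?u n x) \<partial>lborel)"
      by (simp add: Lp_pow_def)
    also have "\<dots> \<le> liminf (\<lambda>n. \<integral>\<^sup>+x. ?u n x \<partial>lborel)"
      by (rule nn_integral_liminf) measurable
    also have "\<dots> \<le> liminf (\<lambda>n::nat. ennreal C * Lp_pow p Z d)"
    proof (intro Liminf_mono always_eventually allI)
      fix n
      have "(\<integral>\<^sup>+x. ?u n x \<partial>lborel) \<le> ennreal (C * (\<Sum>j\<in>{- int n..int n}. norm (d j) powr p))"
        using C(2)[of "{- int n..int n}" d] unfolding Lp_pow_def by simp
      also have "\<dots> = ennreal C * ennreal (\<Sum>j\<in>{- int n..int n}. norm (d j) powr p)"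
        using C by (intro ennreal_mult) (auto intro: sum_nonneg)
      also have "\<dots> \<le> ennreal C * Lp_pow p Z d"
        by (intro mult_left_mono sum_le_Lp_pow_Z) auto
      finally show "(\<integral>\<^sup>+x. ?u n x \<partial>lborel) \<le> ennreal C * Lp_pow p Z d" .
    qed
    also have "\<dots> = ennreal C * Lp_pow p Z d" by (simp add: Liminf_const)
    finally show ?thesis .
  qed
  with C(1) show ?thesis using that by blast
qed

section \<open>The cotangent series and the reproducing property of sinc\<close>

text \<open>The logarithmic derivative of the reflection formula \<open>Gamma z * Gamma (1 - z) = \<pi> / sin (\<pi> * z)\<close>.\<close>

lemma Digamma_reflection:
  fixes z :: complex
  assumes z: "z \<notin> \<int>"
  shows "Digamma (1 - z) - Digamma z = of_real pi * cot (of_real pi * z)"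
proof -
  have z1: "1 - z \<notin> \<int>"
    using z Ints_diff[of 1 "1 - z"] by auto
  have nz: "z \<notin> \<int>\<^sub>\<le>\<^sub>0" "1 - z \<notin> \<int>\<^sub>\<le>\<^sub>0" using z z1 nonpos_Ints_Int by blast+
  have s: "sin (of_real pi * z) \<noteq> 0"
  proof
    assume "sin (of_real pi * z) = 0"
    then obtain n where "complex_of_real pi * z = of_int n * of_real pi" using sin_eq_0 by auto
    then have "z = of_int n" by simp
    with z show False by simp
  qed
  have "((\<lambda>w. Gamma w * Gamma (1 - w)) has_field_derivative
      Gamma z * Digamma z * Gamma (1 - z) - Gamma z * (Gamma (1 - z) * Digamma (1 - z))) (at z)"
    using nz by (auto intro!: derivative_eq_intros)
  moreover have "((\<lambda>w. of_real pi / sin (of_real pi * w)) has_field_derivative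
      - (of_real pi * of_real pi * cos (of_real pi * z)) / (sin (of_real pi * z))\<^sup>2) (at z)"
    using s by (auto intro!: derivative_eq_intros simp: power2_eq_square)
  ultimately have "Gamma z * Digamma z * Gamma (1 - z) - Gamma z * (Gamma (1 - z) * Digamma (1 - z))
     = - (of_real pi * of_real pi * cos (of_real pi * z)) / (sin (of_real pi * z))\<^sup>2"
    unfolding Gamma_reflection_complex by (rule DERIV_unique)
  also have "Gamma z * Digamma z * Gamma (1 - z) - Gamma z * (Gamma (1 - z) * Digamma (1 - z))
     = (Gamma z * Gamma (1 - z)) * (Digamma z - Digamma (1 - z))" by (simp add: algebra_simps)
  finally have "of_real pi / sin (of_real pi * z) * (Digamma z - Digamma (1 - z))
     = - (of_real pi * of_real pi * cos (of_real pi * z)) / (sin (of_real pi * z))\<^sup>2"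
    unfolding Gamma_reflection_complex .
  then have "Digamma z - Digamma (1 - z) = - (of_real pi * cot (of_real pi * z))"
  proof -
    assume eq: "of_real pi / sin (of_real pi * z) * (Digamma z - Digamma (1 - z))
     = - (of_real pi * of_real pi * cos (of_real pi * z)) / (sin (of_real pi * z))\<^sup>2"
    have "Digamma z - Digamma (1 - z) = sin (of_real pi * z) / of_real pi
        * (of_real pi / sin (of_real pi * z) * (Digamma z - Digamma (1 - z)))"
      using s by simp
    also have "\<dots> = - (of_real pi * cot (of_real pi * z))"
      unfolding eq using s by (simp add: cot_def power2_eq_square)
    finally show ?thesis .
  qed
  then show ?thesis by (simp add: algebra_simps)
qed

lemma sum_greaterThanAtMost_int_split:
  fixes f :: "int \<Rightarrow> complex"
  shows "sum f {- int m<..int m} = (\<Sum>n<m. f (- int n) + f (int n + 1))"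
proof (induction m)
  case (Suc m)
  have "{- int (Suc m)<..int (Suc m)} = insert (- int m) (insert (int m + 1) {- int m<..int m})"
    by auto
  then show ?case using Suc by (simp add: add_ac)
qed simp

text \<open>Both Digamma values are limits of \<open>ln m\<close> minus a partial sum. In the difference the logarithms
cancel, and what remains is the sum of \<open>1 / (z - k)\<close> over \<open>- m < k \<le> m\<close>.\<close>

lemma cot_partial_fractions:
  fixes z :: complex
  assumes z: "z \<notin> \<int>"
  shows "(\<lambda>m. \<Sum>k\<in>{- int m<..int m}. 1 / (z - of_int k)) \<longlonglongrightarrow> of_real pi * cot (of_real pi * z)"
proof -
  have z1: "1 - z \<notin> \<int>"
    using z Ints_diff[of 1 "1 - z"] by auto
  have nz: "z \<noteq> 0" "1 - z \<noteq> 0" using z z1 by auto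
  have "(\<lambda>m. (of_real (ln (real m)) - (\<Sum>n<m. inverse ((1 - z) + of_nat n)))
      - (of_real (ln (real m)) - (\<Sum>n<m. inverse (z + of_nat n)))) \<longlonglongrightarrow> Digamma (1 - z) - Digamma z"
    by (intro tendsto_diff Digamma_LIMSEQ nz)
  moreover have "(of_real (ln (real m)) - (\<Sum>n<m. inverse ((1 - z) + of_nat n)))
      - (of_real (ln (real m)) - (\<Sum>n<m. inverse (z + of_nat n))) = (\<Sum>k\<in>{- int m<..int m}. 1 / (z - of_int k))" for m
  proof -
    have "inverse (z + of_nat n) - inverse ((1 - z) + of_nat n)
        = 1 / (z - of_int (- int n)) + 1 / (z - of_int (int n + 1))" for n
    proof -
      have "(1 - z) + of_nat n = - (z - of_int (int n + 1))" by simp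
      then show ?thesis by (simp only: inverse_minus_eq) (simp add: inverse_eq_divide)
    qed
    then show ?thesis
      unfolding sum_greaterThanAtMost_int_split by (simp add: sum_subtractf[symmetric])
  qed
  ultimately show ?thesis using Digamma_reflection[OF z] by simp
qed

lemma filterlim_shifted_intervals:
  "filterlim (\<lambda>n. {- int n<..int n}) (finite_subsets_at_top UNIV) sequentially"
  by (rule filterlim_int_exhaustion) auto

lemma sinc_pi_minus: "sinc_pi (- x) = sinc_pi x"
  by (simp add: sinc_pi_def)

lemma Lp_pow_sinc_finite:
  assumes "1 < p" shows "Lp_pow p Z (\<lambda>k. complex_of_real (sinc_pi (of_int k - y))) < \<infinity>"
proof -
  obtain B where B: "\<And>x. (\<integral>\<^sup>+k. ennreal (\<bar>sinc_pi (x - of_int k)\<bar> powr p) \<partial>Z) \<le> ennreal B"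
    using sinc_powr_finite[OF assms] by metis
  have "sinc_pi (of_int k - y) = sinc_pi (y - of_int k)" for k
    using sinc_pi_minus[of "y - of_int k"] by simp
  then show ?thesis using B[of y] by (auto simp: Lp_pow_def less_top[symmetric] top_unique)
qed

text \<open>By \<open>1 / ((k - y) * (x - k)) = (1 / (x - k) - 1 / (y - k)) / (x - y)\<close> the series is a difference of
two cotangent series, and \<open>cot (\<pi> * x) - cot (\<pi> * y)\<close> produces \<open>sin (\<pi> * (x - y))\<close>. Exceptional \<open>x\<close>
and \<open>y\<close> form a null set, which is all that is needed later.\<close>

lemma sinc_series_sinc_shift:
  assumes x: "x \<notin> \<int>" and y: "y \<notin> \<int>" and xy: "x \<noteq> y"
  shows "sinc_series (\<lambda>k. complex_of_real (sinc_pi (of_int k - y))) x = of_real (sinc_pi (x - y))"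
proof -
  let ?d = "\<lambda>k::int. complex_of_real (sinc_pi (of_int k - y))"
  let ?X = "complex_of_real x" and ?Y = "complex_of_real y"
  have hs: "((\<lambda>k. ?d k * complex_of_real (sinc_pi (x - of_int k))) has_sum sinc_series ?d x) UNIV"
    by (rule sinc_series_has_sum[of 2, OF _ Lp_pow_sinc_finite]) auto
  have lim: "(\<lambda>m. \<Sum>k\<in>{- int m<..int m}. ?d k * complex_of_real (sinc_pi (x - of_int k))) \<longlonglongrightarrow> sinc_series ?d x"
    using filterlim_compose[OF hs[unfolded has_sum_def] filterlim_shifted_intervals] .
  have X: "?X \<notin> \<int>" "?Y \<notin> \<int>" using x y by (auto simp: of_real_in_Ints_iff)
  have nint: "x \<noteq> of_int k" "y \<noteq> of_int k" for k using x y by auto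
  define c where "c = - (complex_of_real (sin (pi * x) * sin (pi * y)) / of_real (pi\<^sup>2 * (x - y)))"
  have summand: "?d k * complex_of_real (sinc_pi (x - of_int k)) = c * (1 / (?X - of_int k) - 1 / (?Y - of_int k))" for k
  proof -
    have ck: "(cos (pi * of_int k))\<^sup>2 = 1" by (simp add: power2_eq_square)
    have "sin (pi * (of_int k - y)) = - (cos (pi * of_int k) * sin (pi * y))"
         "sin (pi * (x - of_int k)) = sin (pi * x) * cos (pi * of_int k)"
      using sin_npi_int[of k] by (simp_all add: right_diff_distrib sin_diff mult.commute)
    then have "sin (pi * (of_int k - y)) * sin (pi * (x - of_int k)) = - ((cos (pi * of_int k))\<^sup>2 * (sin (pi * x) * sin (pi * y)))"
      by (simp add: power2_eq_square)
    then have s: "sin (pi * (of_int k - y)) * sin (pi * (x - of_int k)) = - (sin (pi * x) * sin (pi * y))"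
      by (simp only: ck mult_1)
    have nz: "of_int k - y \<noteq> 0" "x - of_int k \<noteq> 0" "y - of_int k \<noteq> 0" "x - y \<noteq> 0" using nint[of k] xy by auto
    have "sinc_pi (of_int k - y) * sinc_pi (x - of_int k)
        = (sin (pi * (of_int k - y)) * sin (pi * (x - of_int k))) / (pi\<^sup>2 * ((of_int k - y) * (x - of_int k)))"
      using nz by (simp add: sinc_pi_def power2_eq_square)
    also have "\<dots> = - (sin (pi * x) * sin (pi * y)) / pi\<^sup>2 * (1 / ((of_int k - y) * (x - of_int k)))"
      unfolding s by simp
    also have "1 / ((of_int k - y) * (x - of_int k)) = (1 / (x - of_int k) - 1 / (y - of_int k)) / (x - y)"
      using nz by (simp add: divide_simps) (simp add: algebra_simps)
    finally have "sinc_pi (of_int k - y) * sinc_pi (x - of_int k)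
        = - (sin (pi * x) * sin (pi * y) / (pi\<^sup>2 * (x - y))) * (1 / (x - of_int k) - 1 / (y - of_int k))"
      by simp
    then have "complex_of_real (sinc_pi (of_int k - y) * sinc_pi (x - of_int k))
        = complex_of_real (- (sin (pi * x) * sin (pi * y) / (pi\<^sup>2 * (x - y))) * (1 / (x - of_int k) - 1 / (y - of_int k)))"
      by (rule arg_cong)
    then show ?thesis by (simp add: c_def)
  qed
  have "(\<lambda>m. c * ((\<Sum>k\<in>{- int m<..int m}. 1 / (?X - of_int k)) - (\<Sum>k\<in>{- int m<..int m}. 1 / (?Y - of_int k))))
     \<longlonglongrightarrow> c * (of_real pi * cot (of_real pi * ?X) - of_real pi * cot (of_real pi * ?Y))"
    by (intro tendsto_intros cot_partial_fractions X)
  then have "(\<lambda>m. \<Sum>k\<in>{- int m<..int m}. ?d k * complex_of_real (sinc_pi (x - of_int k)))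
     \<longlonglongrightarrow> c * (of_real pi * cot (of_real pi * ?X) - of_real pi * cot (of_real pi * ?Y))"
    by (simp only: summand sum_distrib_left[symmetric] sum_subtractf)
  from LIMSEQ_unique[OF lim this]
  have "sinc_series ?d x = c * (of_real pi * cot (of_real pi * ?X) - of_real pi * cot (of_real pi * ?Y))" .
  also have "\<dots> = of_real (- (sin (pi * x) * sin (pi * y) / (pi\<^sup>2 * (x - y))) * (pi * cot (pi * x) - pi * cot (pi * y)))"
  proof -
    have "cot (of_real pi * complex_of_real w) = of_real (cot (pi * w))" for w
      by (metis cot_of_real of_real_mult)
    then show ?thesis by (simp add: c_def)
  qed
  also have "- (sin (pi * x) * sin (pi * y) / (pi\<^sup>2 * (x - y))) * (pi * cot (pi * x) - pi * cot (pi * y)) = sinc_pi (x - y)"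
  proof -
    have nz: "sin (pi * x) \<noteq> 0" "sin (pi * y) \<noteq> 0" "x - y \<noteq> 0"
      using nint xy by (auto simp: sin_zero_iff_int2)
    have "- (sin (pi * x) * sin (pi * y) / (pi\<^sup>2 * (x - y))) * (pi * cot (pi * x) - pi * cot (pi * y))
       = - (cos (pi * x) * sin (pi * y) - cos (pi * y) * sin (pi * x)) / (pi * (x - y))"
      using nz by (simp add: cot_def power2_eq_square divide_simps) (simp add: algebra_simps)
    also have "\<dots> = sin (pi * (x - y)) / (pi * (x - y))"
      by (simp add: right_diff_distrib sin_diff mult.commute)
    finally show ?thesis using nz by (simp add: sinc_pi_def)
  qed
  finally show ?thesis .
qed

section \<open>A rapidly decaying band-limited kernel\<close>

text \<open>Averaging sinc with its unit translate \<open>n\<close> times. Because \<open>sin (\<pi> * x)\<close> changes sign under unit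
translation, the average acts as a difference on the factor \<open>1 / x\<close> and gains one order of decay at
each step, while the result stays a finite combination of translated sinc functions.\<close>

primrec theta :: "nat \<Rightarrow> real \<Rightarrow> real" where
  "theta 0 x = sinc_pi x"
| "theta (Suc n) x = (theta n x + theta n (x + 1)) / 2"

lemma theta_measurable [measurable]: "theta n \<in> borel_measurable borel"
proof (induction n)
  case 0
  have "theta 0 = sinc_pi" by (rule ext) simp
  then show ?case by simp
next
  case (Suc n)
  note [measurable] = Suc
  have "theta (Suc n) = (\<lambda>x. (theta n x + theta n (x + 1)) / 2)" by (rule ext) simp
  then show ?case by simp
qed

text \<open>The \<open>n\<close>-th difference of \<open>1 / x\<close> is \<open>fact n / (x * (x + 1) * \<dots> * (x + n))\<close>. Multiplied out, the
identity also holds at the poles.\<close>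

lemma theta_times_prod:
  "theta n x * (\<Prod>j\<le>n. x + real j) = fact n / (2 ^ n * pi) * sin (pi * x)"
proof (induction n arbitrary: x)
  case (Suc n)
  have 1: "(\<Prod>j\<le>Suc n. x + real j) = x * (\<Prod>j\<le>n. (x + 1) + real j)"
    by (subst prod.atMost_Suc_shift) (simp add: add_ac)
  have 2: "(\<Prod>j\<le>Suc n. x + real j) = (\<Prod>j\<le>n. x + real j) * (x + real (Suc n))"
    by (rule prod.atMost_Suc)
  have "theta (Suc n) x * (\<Prod>j\<le>Suc n. x + real j)
     = theta n x * (\<Prod>j\<le>Suc n. x + real j) / 2 + theta n (x + 1) * (\<Prod>j\<le>Suc n. x + real j) / 2"
    by (simp only: theta.simps add_divide_distrib distrib_right times_divide_eq_left)
  also have "theta n x * (\<Prod>j\<le>Suc n. x + real j) = (theta n x * (\<Prod>j\<le>n. x + real j)) * (x + real (Suc n))"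
    by (simp only: 2 mult.assoc)
  also have "theta n (x + 1) * (\<Prod>j\<le>Suc n. x + real j) = (theta n (x + 1) * (\<Prod>j\<le>n. (x + 1) + real j)) * x"
    by (simp only: 1 mult_ac)
  also have "theta n x * (\<Prod>j\<le>n. x + real j) * (x + real (Suc n)) / 2 + theta n (x + 1) * (\<Prod>j\<le>n. (x + 1) + real j) * x / 2
     = fact n / (2 ^ n * pi) * (sin (pi * x) * (x + real (Suc n)) + sin (pi * (x + 1)) * x) / 2"
    unfolding Suc by (simp add: algebra_simps add_divide_distrib)
  also have "sin (pi * (x + 1)) = - sin (pi * x)" by (simp add: distrib_left)
  also have "fact n / (2 ^ n * pi) * (sin (pi * x) * (x + real (Suc n)) + - sin (pi * x) * x) / 2
     = fact (Suc n) / (2 ^ Suc n * pi) * sin (pi * x)"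
    by (simp add: field_simps)
  finally show ?case .
qed (simp add: sinc_pi_mult)

lemma abs_theta_le_2: "\<bar>theta n x\<bar> \<le> 2"
proof (induction n arbitrary: x)
  case 0
  have "\<bar>sinc_pi x\<bar> * 2 \<le> \<bar>sinc_pi x\<bar> * (\<bar>x\<bar> + 2)" by (intro mult_left_mono) auto
  then show ?case using abs_sinc_pi_le[of x] by simp
next
  case (Suc n)
  show ?case using Suc[of x] Suc[of "x + 1"] by simp
qed

lemma theta_decay: "\<exists>C>0. \<forall>x. \<bar>theta n x\<bar> * (1 + \<bar>x\<bar>) ^ Suc n \<le> C"
proof -
  \<comment> \<open>The first summand covers the range \<open>\<bar>x\<bar> \<le> 2 * n + 1\<close>, the second one the tails.\<close>
  define C where "C = 2 * (2 * real n + 2) ^ Suc n + fact n * 2 ^ Suc n"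
  have "0 < (2 * real n + 2) ^ Suc n" by (rule zero_less_power) simp
  then have C0: "0 < C" unfolding C_def by (intro add_pos_pos) (simp_all del: power_Suc)
  have "\<bar>theta n x\<bar> * (1 + \<bar>x\<bar>) ^ Suc n \<le> C" for x
  proof (cases "\<bar>x\<bar> \<le> 2 * real n + 1")
    case True
    have "\<bar>theta n x\<bar> * (1 + \<bar>x\<bar>) ^ Suc n \<le> 2 * (2 * real n + 2) ^ Suc n"
      using True by (intro mult_mono abs_theta_le_2 power_mono) auto
    also have "\<dots> \<le> C" by (simp add: C_def)
    finally show ?thesis .
  next
    case False
    have "((1 + \<bar>x\<bar>) / 2) ^ Suc n = (\<Prod>j\<le>n. (1 + \<bar>x\<bar>) / 2)" by simp
    also have "\<dots> \<le> (\<Prod>j\<le>n. \<bar>x + real j\<bar>)"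
    proof (rule prod_mono)
      fix j assume "j \<in> {..n}"
      then have "real j \<le> real n" by simp
      moreover have "\<bar>x\<bar> \<le> \<bar>x + real j\<bar> + real j"
        using abs_triangle_ineq[of "x + real j" "- real j"] by simp
      moreover have "1 + a \<le> 2 * b" if "a \<le> b + c" "c \<le> d" "\<not> a \<le> 2 * d + 1" for a b c d :: real
        using that by linarith
      ultimately have "1 + \<bar>x\<bar> \<le> 2 * \<bar>x + real j\<bar>" using False by blast
      then show "0 \<le> (1 + \<bar>x\<bar>) / 2 \<and> (1 + \<bar>x\<bar>) / 2 \<le> \<bar>x + real j\<bar>" by simp
    qed
    finally have "\<bar>theta n x\<bar> * ((1 + \<bar>x\<bar>) / 2) ^ Suc n \<le> \<bar>theta n x\<bar> * (\<Prod>j\<le>n. \<bar>x + real j\<bar>)"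
      by (intro mult_left_mono) auto
    also have "\<dots> = \<bar>fact n / (2 ^ n * pi) * sin (pi * x)\<bar>"
      unfolding theta_times_prod[symmetric] by (simp add: abs_mult abs_prod)
    also have "\<dots> \<le> fact n / 1 * 1"
      unfolding abs_mult
    proof (intro mult_mono)
      have "1 * 1 \<le> 2 ^ n * pi" using pi_ge_two by (intro mult_mono) auto
      then have "fact n / (2 ^ n * pi) \<le> (fact n :: real) / 1" by (intro divide_left_mono) auto
      then show "\<bar>fact n / (2 ^ n * pi)\<bar> \<le> (fact n :: real) / 1" by simp
    qed auto
    finally have "\<bar>theta n x\<bar> * (1 + \<bar>x\<bar>) ^ Suc n \<le> fact n * 2 ^ Suc n"
      by (simp only: power_divide) (simp add: field_simps)
    also have "\<dots> \<le> C" by (simp add: C_def)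
    finally show ?thesis .
  qed
  with C0 show ?thesis by blast
qed

lemma theta_weight_le:
  "\<exists>C>0. \<forall>x. \<bar>theta (Suc D) x\<bar> * (1 + \<bar>x\<bar>) ^ D \<le> C * cauchy_kernel x"
proof -
  obtain C where C: "0 < C" "\<And>x. \<bar>theta (Suc D) x\<bar> * (1 + \<bar>x\<bar>) ^ Suc (Suc D) \<le> C"
    using theta_decay by blast
  have "\<bar>theta (Suc D) x\<bar> * (1 + \<bar>x\<bar>) ^ D \<le> C * cauchy_kernel x" for x
  proof -
    have "1 + x\<^sup>2 \<le> (1 + \<bar>x\<bar>) ^ 2" by (simp add: power2_eq_square algebra_simps)
    then have "\<bar>theta (Suc D) x\<bar> * (1 + \<bar>x\<bar>) ^ D * (1 + x\<^sup>2) \<le> \<bar>theta (Suc D) x\<bar> * (1 + \<bar>x\<bar>) ^ D * (1 + \<bar>x\<bar>) ^ 2"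
      by (intro mult_left_mono) auto
    also have "\<dots> \<le> C" using C(2)[of x] by (simp add: power2_eq_square mult_ac)
    finally show ?thesis by (simp add: cauchy_kernel_def field_simps add_pos_nonneg)
  qed
  with C(1) show ?thesis by blast
qed

lemma Lp_pow_theta_finite: "1 < p \<Longrightarrow> Lp_pow p Z (\<lambda>k. complex_of_real (theta n (of_int k - y))) < \<infinity>"
proof (induction n arbitrary: y)
  case 0
  then show ?case using Lp_pow_sinc_finite[of p y] by simp
next
  case (Suc n)
  have eq: "of_int k - y + 1 = of_int k - (y - 1)" for k by simp
  have "Lp_pow p Z (\<lambda>k. complex_of_real (theta (Suc n) (of_int k - y)))
     = Lp_pow p Z (\<lambda>k. (1/2) * (complex_of_real (theta n (of_int k - y)) + complex_of_real (theta n (of_int k - (y - 1)))))"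
    by (simp add: eq)
  also have "\<dots> = ennreal ((1/2) powr p) * Lp_pow p Z (\<lambda>k. complex_of_real (theta n (of_int k - y)) + complex_of_real (theta n (of_int k - (y - 1))))"
    by (subst Lp_pow_cmult) auto
  also have "\<dots> \<le> ennreal ((1/2) powr p) * (ennreal (2 powr p) * (Lp_pow p Z (\<lambda>k. complex_of_real (theta n (of_int k - y)))
       + Lp_pow p Z (\<lambda>k. complex_of_real (theta n (of_int k - (y - 1))))))"
    using Suc.prems by (intro mult_left_mono Lp_pow_add) auto
  also have "\<dots> < \<infinity>"
    using Suc.IH[OF Suc.prems, of y] Suc.IH[OF Suc.prems, of "y - 1"] by (simp add: ennreal_mult_less_top)
  finally show ?case .
qed

lemma sinc_series_cmult: "sinc_series (\<lambda>k. c * d k) x = c * sinc_series d x"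
  unfolding sinc_series_def by (simp add: mult.assoc infsum_cmult_right')

lemma sinc_series_theta_shift:
  assumes "x \<notin> \<int>" "y \<notin> \<int>" "x - y \<notin> \<int>"
  shows "sinc_series (\<lambda>k. complex_of_real (theta n (of_int k - y))) x = of_real (theta n (x - y))"
  using assms
proof (induction n arbitrary: y)
  case 0
  then have "x \<noteq> y" by auto
  with 0 show ?case by (simp add: sinc_series_sinc_shift)
next
  case (Suc n)
  have eq: "of_int k - y + 1 = of_int k - (y - 1)" "x - y + 1 = x - (y - 1)" for k by simp_all
  have y1: "y - 1 \<notin> \<int>" "x - (y - 1) \<notin> \<int>"
    using Ints_add[OF _ Ints_1, of "y - 1"] Ints_diff[OF _ Ints_1, of "x - (y - 1)"] Suc.prems by auto
  have "sinc_series (\<lambda>k. complex_of_real (theta (Suc n) (of_int k - y))) x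
     = sinc_series (\<lambda>k. (1/2) * (complex_of_real (theta n (of_int k - y)) + complex_of_real (theta n (of_int k - (y - 1))))) x"
    by (simp add: eq)
  also have "\<dots> = (1/2) * (sinc_series (\<lambda>k. complex_of_real (theta n (of_int k - y))) x + sinc_series (\<lambda>k. complex_of_real (theta n (of_int k - (y - 1)))) x)"
    unfolding sinc_series_cmult by (subst sinc_series_add[of 2, OF _ Lp_pow_theta_finite Lp_pow_theta_finite]) auto
  also have "\<dots> = of_real (theta (Suc n) (x - y))"
    using Suc.IH[of y] Suc.IH[of "y - 1"] Suc.prems y1 by (simp add: eq)
  finally show ?case .
qed

text \<open>The sine integral is a primitive of sinc with limits \<open>\<plusminus>\<pi>/2\<close> at infinity; averaging with a translate
preserves the limits. This determines the integral of \<open>theta\<close>.\<close>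

lemma theta_primitive:
  "\<exists>F. (\<forall>x. (F has_real_derivative theta n x) (at x)) \<and> (F \<longlongrightarrow> 1/2) at_top \<and> (F \<longlongrightarrow> - 1/2) at_bot"
proof (induction n)
  case 0
  define F where "F x = Si (pi * x) / pi" for x
  have "(F has_real_derivative theta 0 x) (at x)" for x
    unfolding F_def by (auto intro!: derivative_eq_intros DERIV_chain'[OF _ DERIV_Si] simp: sinc_pi_def)
  moreover have top: "(F \<longlongrightarrow> 1/2) at_top"
  proof -
    have "filterlim (\<lambda>x::real. pi * x) at_top at_top" by real_asymp
    then have "((\<lambda>x. Si (pi * x) / pi) \<longlongrightarrow> (pi / 2) / pi) at_top"
      by (intro tendsto_divide filterlim_compose[OF Si_at_top] tendsto_const) auto
    then show ?thesis by (simp add: F_def[abs_def])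
  qed
  moreover have "(F \<longlongrightarrow> - 1/2) at_bot"
  proof -
    have "((\<lambda>x. - F x) \<longlongrightarrow> - (1/2)) at_top" by (intro tendsto_minus top)
    moreover have "\<forall>\<^sub>F x in at_top. - F x = F (- x)"
      using eventually_ge_at_top[of 0] by eventually_elim (simp add: F_def Si_neg)
    ultimately have "((\<lambda>x. F (- x)) \<longlongrightarrow> - (1/2)) at_top" by (rule Lim_transform_eventually)
    then show ?thesis by (simp add: filterlim_at_bot_mirror)
  qed
  ultimately show ?case by blast
next
  case (Suc n)
  then obtain F where F: "\<And>x. (F has_real_derivative theta n x) (at x)" "(F \<longlongrightarrow> 1/2) at_top" "(F \<longlongrightarrow> - 1/2) at_bot"
    by blast
  define G where "G x = (F x + F (x + 1)) / 2" for x
  have "(G has_real_derivative theta (Suc n) x) (at x)" for x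
  proof -
    have "((\<lambda>x. F (x + 1)) has_real_derivative theta n (x + 1)) (at x)"
      using F(1)[of "x + 1"] by (simp add: DERIV_shift)
    then show ?thesis unfolding G_def using F(1)[of x] by (auto intro!: derivative_eq_intros)
  qed
  moreover have l: "filterlim (\<lambda>x::real. x + 1) at_top at_top" "filterlim (\<lambda>x::real. x + 1) at_bot at_bot"
    by real_asymp+
  have "((\<lambda>x. (F x + F (x + 1)) / 2) \<longlongrightarrow> (1/2 + 1/2) / 2) at_top"
    by (intro tendsto_divide tendsto_add tendsto_const F(2) filterlim_compose[OF F(2) l(1)]) simp
  moreover have "((\<lambda>x. (F x + F (x + 1)) / 2) \<longlongrightarrow> (- 1/2 + - 1/2) / 2) at_bot"
    by (intro tendsto_divide tendsto_add tendsto_const F(3) filterlim_compose[OF F(3) l(2)]) simp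
  ultimately have "(\<forall>x. (G has_real_derivative theta (Suc n) x) (at x))" "(G \<longlongrightarrow> 1/2) at_top" "(G \<longlongrightarrow> - 1/2) at_bot"
    by (simp_all add: G_def[abs_def])
  then show ?case by blast
qed

lemma cauchy_kernel_integrable: "integrable lborel cauchy_kernel"
proof (rule integrableI_bounded)
  have "(\<integral>\<^sup>+x. ennreal (norm (cauchy_kernel x)) \<partial>lborel) \<le> ennreal pi"
    using nn_integral_cauchy_kernel by simp
  then show "(\<integral>\<^sup>+x. ennreal (norm (cauchy_kernel x)) \<partial>lborel) < \<infinity>"
    by (rule le_less_trans) simp
qed simp

lemma theta_integrable: "integrable lborel (theta (Suc n))"
proof -
  obtain C where "0 < C" and C: "\<And>x. \<bar>theta (Suc n) x\<bar> * (1 + \<bar>x\<bar>) ^ n \<le> C * cauchy_kernel x"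
    using theta_weight_le by blast
  show ?thesis
  proof (rule Bochner_Integration.integrable_bound)
    show "integrable lborel (\<lambda>x. C * cauchy_kernel x)" using cauchy_kernel_integrable by simp
    show "AE x in lborel. norm (theta (Suc n) x) \<le> norm (C * cauchy_kernel x)"
    proof (rule AE_I2)
      fix x :: real
      have "\<bar>theta (Suc n) x\<bar> * 1 \<le> \<bar>theta (Suc n) x\<bar> * (1 + \<bar>x\<bar>) ^ n"
        by (intro mult_left_mono one_le_power) auto
      then show "norm (theta (Suc n) x) \<le> norm (C * cauchy_kernel x)" using C[of x] by simp
    qed
  qed simp
qed

lemma theta_integral: "(LINT x|lborel. theta (Suc n) x) = 1"
proof -
  obtain F where F: "\<And>x. (F has_real_derivative theta (Suc n) x) (at x)" "(F \<longlongrightarrow> 1/2) at_top" "(F \<longlongrightarrow> - 1/2) at_bot"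
    using theta_primitive by blast
  have cont: "isCont (theta n) x" for n x
  proof (induction n arbitrary: x)
    case 0
    have "theta 0 = (\<lambda>x. sinc (pi * x))" by (rule ext) (simp add: sinc_pi_def)
    moreover have "isCont (\<lambda>x. sinc (pi * x)) x"
      by (rule isCont_o2[OF _ isCont_sinc]) (auto intro!: continuous_intros)
    ultimately show ?case by simp
  next
    case (Suc n)
    have "theta (Suc n) = (\<lambda>x. (theta n x + theta n (x + 1)) / 2)" by (rule ext) simp
    moreover have "isCont (\<lambda>x. theta n (x + 1)) x"
      by (rule isCont_o2[OF _ Suc]) (auto intro!: continuous_intros)
    ultimately show ?case using Suc by (auto intro!: continuous_intros)
  qed
  have "(LBINT x=-\<infinity>..\<infinity>. theta (Suc n) x) = 1/2 - (- 1/2)"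
  proof (rule interval_integral_FTC_integrable)
    show "set_integrable lborel (einterval (- \<infinity>) \<infinity>) (theta (Suc n))"
      using theta_integrable[of n] by (simp add: set_integrable_def del: theta.simps)
  qed (use F cont in \<open>auto simp: ereal_tendsto_simps has_real_derivative_iff_has_vector_derivative[symmetric] simp del: theta.simps\<close>)
  then show ?thesis by (simp add: interval_lebesgue_integral_def set_lebesgue_integral_def del: theta.simps)
qed

section \<open>Convolutions of bounded Borel functions\<close>

definition conv :: "(real \<Rightarrow> real) \<Rightarrow> (real \<Rightarrow> complex) \<Rightarrow> real \<Rightarrow> complex" where
  "conv K v x = (LINT u|lborel. K u *\<^sub>R v (x - u))"

text \<open>Boundedness makes every convolution with an integrable kernel converge at every point, and Borel
rather than Lebesgue measurability is what product measures need.\<close>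

definition bounded_borel :: "(real \<Rightarrow> complex) \<Rightarrow> bool" where
  "bounded_borel v \<longleftrightarrow> v \<in> borel_measurable borel \<and> (\<exists>B. \<forall>x. norm (v x) \<le> B)"

lemma bounded_borel_measurable: "bounded_borel v \<Longrightarrow> v \<in> borel_measurable borel"
  by (simp add: bounded_borel_def)

lemma bounded_borelE:
  assumes "bounded_borel v"
  obtains B where "0 \<le> B" "\<And>x. norm (v x) \<le> B"
  using assms unfolding bounded_borel_def by (meson norm_ge_zero order_trans)

lemma bounded_borel_add: "bounded_borel a \<Longrightarrow> bounded_borel b \<Longrightarrow> bounded_borel (\<lambda>x. a x + b x)"
  unfolding bounded_borel_def
  by (auto intro!: exI norm_triangle_le add_mono)

lemma bounded_borel_diff: "bounded_borel a \<Longrightarrow> bounded_borel b \<Longrightarrow> bounded_borel (\<lambda>x. a x - b x)"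
  unfolding bounded_borel_def
  by (auto intro!: exI norm_triangle_le_diff add_mono)

lemma bounded_borel_shift: "bounded_borel v \<Longrightarrow> bounded_borel (\<lambda>x. v (x + h))"
  unfolding bounded_borel_def by auto

lemma bounded_borel_sum:
  "(\<And>i. i \<in> I \<Longrightarrow> bounded_borel (g i)) \<Longrightarrow> bounded_borel (\<lambda>x. \<Sum>i\<in>I. g i x)"
proof (induction I rule: infinite_finite_induct)
  case (insert i I)
  then show ?case using bounded_borel_add[of "g i" "\<lambda>x. \<Sum>i\<in>I. g i x"] by simp
qed (auto simp: bounded_borel_def)

lemma conv_integrable:
  assumes K: "integrable lborel K" and v: "bounded_borel v"
  shows "integrable lborel (\<lambda>u. K u *\<^sub>R v (x - u))"
proof -
  obtain B where B: "0 \<le> B" "\<And>x. norm (v x) \<le> B" using bounded_borelE[OF v] by blast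
  have [measurable]: "K \<in> borel_measurable borel" "v \<in> borel_measurable borel"
    using K v by (auto simp: bounded_borel_def)
  show ?thesis
  proof (rule Bochner_Integration.integrable_bound)
    show "integrable lborel (\<lambda>u. \<bar>K u\<bar> * B)" using K by simp
    show "AE u in lborel. norm (K u *\<^sub>R v (x - u)) \<le> norm (\<bar>K u\<bar> * B)"
      using B by (intro AE_I2) (auto simp: abs_mult intro!: mult_left_mono)
  qed measurable
qed

lemma conv_bounded_borel:
  assumes K: "integrable lborel K" and v: "bounded_borel v"
  shows "bounded_borel (conv K v)"
proof -
  obtain B where B: "0 \<le> B" "\<And>x. norm (v x) \<le> B" using bounded_borelE[OF v] by blast
  have [measurable]: "K \<in> borel_measurable borel" "v \<in> borel_measurable borel"
    using K v by (auto simp: bounded_borel_def)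
  have "conv K v \<in> borel_measurable borel" unfolding conv_def by measurable
  moreover have "norm (conv K v x) \<le> (LINT u|lborel. \<bar>K u\<bar> * B)" for x
    unfolding conv_def
  proof (rule Bochner_Integration.integral_norm_bound_integral)
    show "norm (K u *\<^sub>R v (x - u)) \<le> \<bar>K u\<bar> * B" for u
      using B by (auto intro!: mult_left_mono)
  qed (use K conv_integrable[OF K v] in auto)
  ultimately show ?thesis unfolding bounded_borel_def by blast
qed

lemma conv_diff:
  assumes "integrable lborel K" "bounded_borel a" "bounded_borel b"
  shows "conv K (\<lambda>x. a x - b x) x = conv K a x - conv K b x"
  unfolding conv_def
  by (simp add: scaleR_diff_right Bochner_Integration.integral_diff conv_integrable[OF assms(1,2)] conv_integrable[OF assms(1,3)])

lemma conv_sum: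
  assumes "integrable lborel K" "\<And>i. i \<in> I \<Longrightarrow> bounded_borel (g i)"
  shows "conv K (\<lambda>x. \<Sum>i\<in>I. g i x) x = (\<Sum>i\<in>I. conv K (g i) x)"
  unfolding conv_def scaleR_sum_right
  by (rule Bochner_Integration.integral_sum) (rule conv_integrable[OF assms])

lemma conv_shift: "conv K (\<lambda>x. v (x + h)) x = conv K v (x + h)"
  unfolding conv_def by (simp add: algebra_simps)

text \<open>Convolving the kernels writes an iterated average as a single one. It also gives commutativity, because
the convolution of kernels is symmetric.\<close>

lemma conv_conv:
  assumes K: "integrable lborel K" and L: "integrable lborel L" and v: "bounded_borel v"
  shows "conv K (conv L v) x = conv (\<lambda>s. LINT t|lborel. K t * L (s - t)) v x"
proof -
  obtain B where B: "0 \<le> B" "\<And>x. norm (v x) \<le> B" using bounded_borelE[OF v] by blast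
  have [measurable]: "K \<in> borel_measurable borel" "L \<in> borel_measurable borel" "v \<in> borel_measurable borel"
    using K L v by (auto simp: bounded_borel_def)
  have Ls: "integrable lborel (\<lambda>s. L (s - t))" for t
    using lborel_integrable_real_affine[OF L, of 1 "- t"] by simp
  have Lsi: "(LINT s|lborel. \<bar>L (s - t)\<bar>) = (LINT s|lborel. \<bar>L s\<bar>)" for t
    using lborel_integral_real_affine[where f = "\<lambda>s. \<bar>L s\<bar>" and c = 1 and t = "- t"] by simp
  let ?f = "\<lambda>(t, s). K t *\<^sub>R (L (s - t) *\<^sub>R v (x - s))"
  have int_s: "integrable lborel (\<lambda>s. L (s - t) *\<^sub>R v (x - s))" for t
  proof (rule Bochner_Integration.integrable_bound)
    show "integrable lborel (\<lambda>s. \<bar>L (s - t)\<bar> * B)" using Ls[of t] by simp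
    show "AE s in lborel. norm (L (s - t) *\<^sub>R v (x - s)) \<le> norm (\<bar>L (s - t)\<bar> * B)"
      using B by (intro AE_I2) (auto simp: abs_mult intro!: mult_left_mono)
  qed measurable
  have int: "integrable (lborel \<Otimes>\<^sub>M lborel) ?f"
  proof (rule lborel_pair.Fubini_integrable)
    show "integrable lborel (\<lambda>t. LINT s|lborel. norm (?f (t, s)))"
    proof (rule Bochner_Integration.integrable_bound)
      show "integrable lborel (\<lambda>t. \<bar>K t\<bar> * (LINT s|lborel. \<bar>L s\<bar> * B))" using K by simp
      show "AE t in lborel. norm (LINT s|lborel. norm (?f (t, s))) \<le> norm (\<bar>K t\<bar> * (LINT s|lborel. \<bar>L s\<bar> * B))"
      proof (rule AE_I2)
        fix t
        have "(LINT s|lborel. norm (?f (t, s))) = \<bar>K t\<bar> * (LINT s|lborel. norm (L (s - t) *\<^sub>R v (x - s)))"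
          by (simp add: abs_mult mult.assoc)
        moreover have "(LINT s|lborel. norm (L (s - t) *\<^sub>R v (x - s))) \<le> (LINT s|lborel. \<bar>L (s - t)\<bar> * B)"
          using B Ls[of t] int_s[of t] by (intro integral_mono integrable_norm) (auto intro!: mult_left_mono)
        moreover have "0 \<le> (LINT s|lborel. norm (L (s - t) *\<^sub>R v (x - s)))" by simp
        ultimately show "norm (LINT s|lborel. norm (?f (t, s))) \<le> norm (\<bar>K t\<bar> * (LINT s|lborel. \<bar>L s\<bar> * B))"
          using Lsi[of t] B by (simp only: real_norm_def abs_mult abs_abs) (intro mult_left_mono, auto)
      qed
    qed measurable
    show "AE t in lborel. integrable lborel (\<lambda>s. ?f (t, s))"
      by (intro AE_I2, simp only: prod.case) (intro integrable_scaleR_right int_s)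
  qed measurable
  have "conv K (conv L v) x = (LINT t|lborel. K t *\<^sub>R (LINT s|lborel. L (s - t) *\<^sub>R v (x - s)))"
  proof -
    have "conv L v (x - t) = (LINT s|lborel. L (s - t) *\<^sub>R v (x - s))" for t
      unfolding conv_def by (subst lborel_integral_real_affine[where c = 1 and t = "- t"]) auto
    then show ?thesis by (simp add: conv_def[of K])
  qed
  also have "\<dots> = (LINT t|lborel. LINT s|lborel. K t *\<^sub>R (L (s - t) *\<^sub>R v (x - s)))"
    by (simp only: integral_scaleR_right)
  also have "\<dots> = (LINT s|lborel. LINT t|lborel. K t *\<^sub>R (L (s - t) *\<^sub>R v (x - s)))"
    using lborel_pair.Fubini_integral[OF int] by simp
  also have "\<dots> = (LINT s|lborel. (LINT t|lborel. K t * L (s - t)) *\<^sub>R v (x - s))"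
  proof (rule Bochner_Integration.integral_cong_AE)
    have "AE s in lborel. integrable lborel (\<lambda>t. ?f (t, s))"
      using lborel_pair.AE_integrable_fst[OF lborel_pair.integrable_product_swap[OF int]] by (simp add: case_prod_beta)
    then show "AE s in lborel. (LINT t|lborel. K t *\<^sub>R (L (s - t) *\<^sub>R v (x - s))) = (LINT t|lborel. K t * L (s - t)) *\<^sub>R v (x - s)"
    proof eventually_elim
      case (elim s)
      show ?case
      proof (cases "v (x - s) = 0")
        case False
        have "(\<lambda>t. Re (K t *\<^sub>R (L (s - t) *\<^sub>R v (x - s)) / v (x - s))) = (\<lambda>t. K t * L (s - t))"
          using False by (auto simp: scaleR_conv_of_real)
        moreover have "integrable lborel (\<lambda>t. Re (K t *\<^sub>R (L (s - t) *\<^sub>R v (x - s)) / v (x - s)))"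
          using elim by (intro integrable_Re integrable_divide) simp
        ultimately have "integrable lborel (\<lambda>t. K t * L (s - t))" by simp
        then show ?thesis by (simp flip: integral_scaleR_left)
      qed simp
    qed
  qed measurable
  also have "\<dots> = conv (\<lambda>s. LINT t|lborel. K t * L (s - t)) v x" by (simp add: conv_def)
  finally show ?thesis .
qed

lemma conv_commute:
  assumes K: "integrable lborel K" and L: "integrable lborel L" and v: "bounded_borel v"
  shows "conv K (conv L v) x = conv L (conv K v) x"
proof -
  have "(LINT t|lborel. K t * L (s - t)) = (LINT t|lborel. L t * K (s - t))" for s
    by (subst lborel_integral_real_affine[where c = "-1" and t = s]) (auto simp: mult.commute)
  then show ?thesis by (simp add: conv_conv[OF K L v] conv_conv[OF L K v])
qed

lemma norm_integral_le_nn_integral: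
  fixes f :: "'a \<Rightarrow> complex"
  shows "ennreal (norm (integral\<^sup>L M f)) \<le> (\<integral>\<^sup>+x. ennreal (norm (f x)) \<partial>M)"
proof (cases "integrable M f")
  case True
  then show ?thesis by (rule integral_norm_bound_ennreal)
qed (simp add: not_integrable_integral_eq)

lemma ennreal_norm_powr_le_ennpow:
  assumes "0 < p" "ennreal (norm z) \<le> b"
  shows "ennreal (norm z powr p) \<le> ennpow p b"
  using ennpow_mono[OF assms] by (simp add: ennpow_ennreal)

text \<open>A substitute for Minkowski's integral inequality in which the norm of \<open>G (\<cdot>, u)\<close> may grow like a
weight \<open>w\<close>, as long as \<open>K\<close> decays enough to integrate it.\<close>

lemma Lp_pow_weighted_integral:
  assumes p: "1 < p" and A: "0 < A"
    and [measurable]: "K \<in> borel_measurable borel" "(\<lambda>(x, u). G x u) \<in> borel_measurable (lborel \<Otimes>\<^sub>M lborel)"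
      "w \<in> borel_measurable borel"
    and K: "(\<integral>\<^sup>+u. ennreal \<bar>K u\<bar> \<partial>lborel) \<le> ennreal A"
    and Kw: "(\<integral>\<^sup>+u. ennreal \<bar>K u\<bar> * w u \<partial>lborel) \<le> ennreal A"
    and G: "\<And>u. Lp_pow p lborel (\<lambda>x. G x u) \<le> w u * X"
  shows "Lp_pow p lborel (\<lambda>x. LINT u|lborel. K u *\<^sub>R G x u) \<le> ennreal (2 powr p * A powr p) * X"
proof -
  have G'[measurable]: "(\<lambda>u. G x u) \<in> borel_measurable borel" for x by measurable
  have "Lp_pow p lborel (\<lambda>x. LINT u|lborel. K u *\<^sub>R G x u)
      \<le> (\<integral>\<^sup>+x. ennpow p (\<integral>\<^sup>+u. ennreal \<bar>K u\<bar> * ennreal (norm (G x u)) \<partial>lborel) \<partial>lborel)"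
    unfolding Lp_pow_def
  proof (intro nn_integral_mono ennreal_norm_powr_le_ennpow)
    fix x
    show "ennreal (norm (LINT u|lborel. K u *\<^sub>R G x u)) \<le> (\<integral>\<^sup>+u. ennreal \<bar>K u\<bar> * ennreal (norm (G x u)) \<partial>lborel)"
      using norm_integral_le_nn_integral[of lborel "\<lambda>u. K u *\<^sub>R G x u"] by (simp add: ennreal_mult)
  qed (use p in simp)
  also have "\<dots> \<le> (\<integral>\<^sup>+x. ennreal (2 powr p * A powr (p - 1)) * (\<integral>\<^sup>+u. ennreal \<bar>K u\<bar> * ennpow p (ennreal (norm (G x u))) \<partial>lborel) \<partial>lborel)"
    by (intro nn_integral_mono weighted_power_mean p A K) auto
  also have "\<dots> = ennreal (2 powr p * A powr (p - 1)) * (\<integral>\<^sup>+x. \<integral>\<^sup>+u. ennreal \<bar>K u\<bar> * ennpow p (ennreal (norm (G x u))) \<partial>lborel \<partial>lborel)"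
    by (intro nn_integral_cmult) measurable
  also have "(\<integral>\<^sup>+x. \<integral>\<^sup>+u. ennreal \<bar>K u\<bar> * ennpow p (ennreal (norm (G x u))) \<partial>lborel \<partial>lborel)
     = (\<integral>\<^sup>+u. \<integral>\<^sup>+x. ennreal \<bar>K u\<bar> * ennpow p (ennreal (norm (G x u))) \<partial>lborel \<partial>lborel)"
    by (rule lborel_pair.Fubini'[symmetric]) measurable
  also have "\<dots> = (\<integral>\<^sup>+u. ennreal \<bar>K u\<bar> * Lp_pow p lborel (\<lambda>x. G x u) \<partial>lborel)"
    unfolding Lp_pow_def by (intro nn_integral_cong, subst nn_integral_cmult) (auto simp: ennpow_ennreal)
  also have "\<dots> \<le> (\<integral>\<^sup>+u. (ennreal \<bar>K u\<bar> * w u) * X \<partial>lborel)"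
    using G by (intro nn_integral_mono) (simp add: mult.assoc mult_left_mono)
  also have "\<dots> = (\<integral>\<^sup>+u. ennreal \<bar>K u\<bar> * w u \<partial>lborel) * X"
    by (intro nn_integral_multc) measurable
  also have "\<dots> \<le> ennreal A * X" using Kw by (rule mult_right_mono) simp
  finally have "Lp_pow p lborel (\<lambda>x. LINT u|lborel. K u *\<^sub>R G x u) \<le> ennreal (2 powr p * A powr (p - 1)) * (ennreal A * X)"
    by (simp add: mult_left_mono)
  also have "\<dots> = ennreal (2 powr p * A powr (p - 1) * A) * X"
    using A by (simp add: ennreal_mult mult.assoc)
  also have "2 powr p * A powr (p - 1) * A = 2 powr p * A powr p"
    using A by (simp add: powr_diff)
  finally show ?thesis .
qed

lemma Lp_pow_lborel_shift:
  fixes v :: "real \<Rightarrow> complex"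
  assumes "v \<in> borel_measurable borel"
  shows "Lp_pow p lborel (\<lambda>x. v (x + h)) = Lp_pow p lborel v"
proof -
  note [measurable] = assms
  show ?thesis unfolding Lp_pow_def
    by (rule nn_integral_lborel_shift[where F = "\<lambda>x. ennreal (norm (v x) powr p)"]) measurable
qed

lemma Lp_pow_conv:
  assumes p: "1 < p" and A: "0 < A" and [measurable]: "K \<in> borel_measurable borel" and v: "bounded_borel v"
    and K: "(\<integral>\<^sup>+u. ennreal \<bar>K u\<bar> \<partial>lborel) \<le> ennreal A"
  shows "Lp_pow p lborel (conv K v) \<le> ennreal (2 powr p * A powr p) * Lp_pow p lborel v"
proof -
  have [measurable]: "v \<in> borel_measurable borel" using v by (rule bounded_borel_measurable)
  show ?thesis
    unfolding conv_def
  proof (rule Lp_pow_weighted_integral[OF p A, where w = "\<lambda>_. 1"])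
    show "Lp_pow p lborel (\<lambda>x. v (x - u)) \<le> 1 * Lp_pow p lborel v" for u
      using Lp_pow_lborel_shift[of v p "- u"] by simp
  qed (use K in auto)
qed

lemma conv_reflect: "conv K v x = (LINT y|lborel. K (x - y) *\<^sub>R v y)"
  unfolding conv_def by (subst lborel_integral_real_affine[where c = "-1" and t = x]) auto

text \<open>Sampling at the integers is not defined on \<open>Lp\<close>, but sampling after a convolution is bounded, by the
Schur test between the line and the integers.\<close>

lemma Lp_pow_conv_integers:
  assumes p: "1 < p" and C: "0 \<le> C" and [measurable]: "K \<in> borel_measurable borel" and v: "bounded_borel v"
    and K: "\<And>u. \<bar>K u\<bar> \<le> C * cauchy_kernel u"
  shows "Lp_pow p Z (\<lambda>k. conv K v (of_int k)) \<le> ennreal (C powr p * (2 powr p * (3 * pi) powr p)) * Lp_pow p lborel v"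
proof -
  have [measurable]: "v \<in> borel_measurable borel" using v by (rule bounded_borel_measurable)
  have "Lp_pow p Z (\<lambda>k. conv K v (of_int k))
      \<le> (\<integral>\<^sup>+k. ennpow p (ennreal C * (\<integral>\<^sup>+y. ennreal (cauchy_kernel (of_int k - y)) * ennreal (norm (v y)) \<partial>lborel)) \<partial>Z)"
    unfolding Lp_pow_def
  proof (intro nn_integral_mono ennreal_norm_powr_le_ennpow)
    fix k :: int
    have "ennreal (norm (conv K v (of_int k))) \<le> (\<integral>\<^sup>+y. ennreal (norm (K (of_int k - y) *\<^sub>R v y)) \<partial>lborel)"
      unfolding conv_reflect by (rule norm_integral_le_nn_integral)
    also have "\<dots> \<le> (\<integral>\<^sup>+y. ennreal C * (ennreal (cauchy_kernel (of_int k - y)) * ennreal (norm (v y))) \<partial>lborel)"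
    proof (rule nn_integral_mono)
      fix y
      have "norm (K (of_int k - y) *\<^sub>R v y) \<le> C * cauchy_kernel (of_int k - y) * norm (v y)"
        using K[of "of_int k - y"] by (simp add: mult_right_mono)
      then have "ennreal (norm (K (of_int k - y) *\<^sub>R v y)) \<le> ennreal (C * cauchy_kernel (of_int k - y) * norm (v y))"
        by (rule ennreal_leI)
      then show "ennreal (norm (K (of_int k - y) *\<^sub>R v y)) \<le> ennreal C * (ennreal (cauchy_kernel (of_int k - y)) * ennreal (norm (v y)))"
        using C by (simp add: ennreal_mult mult.assoc)
    qed
    also have "\<dots> = ennreal C * (\<integral>\<^sup>+y. ennreal (cauchy_kernel (of_int k - y)) * ennreal (norm (v y)) \<partial>lborel)"
      by (intro nn_integral_cmult) measurable
    finally show "ennreal (norm (conv K v (of_int k))) \<le> \<dots>" .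
  qed (use p in simp)
  also have "\<dots> = (\<integral>\<^sup>+k. ennreal (C powr p) * ennpow p (\<integral>\<^sup>+y. ennreal (cauchy_kernel (of_int k - y)) * ennreal (norm (v y)) \<partial>lborel) \<partial>Z)"
    using C by (simp add: ennpow_mult ennpow_ennreal)
  also have "\<dots> = ennreal (C powr p) * (\<integral>\<^sup>+k. ennpow p (\<integral>\<^sup>+y. ennreal (cauchy_kernel (of_int k - y)) * ennreal (norm (v y)) \<partial>lborel) \<partial>Z)"
    by (intro nn_integral_cmult) measurable
  also have "\<dots> \<le> ennreal (C powr p) * (ennreal (2 powr p * (3 * pi) powr p) * (\<integral>\<^sup>+y. ennpow p (ennreal (norm (v y))) \<partial>lborel))"
    by (intro mult_left_mono cauchy_schur_ZR p) auto
  also have "\<dots> = ennreal (C powr p * (2 powr p * (3 * pi) powr p)) * Lp_pow p lborel v"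
    by (simp add: ennpow_ennreal Lp_pow_def ennreal_mult mult.assoc)
  finally show ?thesis .
qed

section \<open>The sampling theorem for band-limited convolutions\<close>

lemma AE_not_integer: "AE y in lborel. (y::real) \<notin> \<int>"
proof (rule AE_I')
  show "(\<int>::real set) \<in> null_sets lborel"
    by (intro countable_imp_null_set_lborel) (simp add: Ints_def)
qed auto

text \<open>Inserting the definition of the convolution into the sinc series and interchanging sum and integral
reduces the claim to the reproduction of the translates of \<open>theta\<close>. The partial sums are interchanged
trivially, and dominated convergence passes to the limit; the dominating function is integrable because
the samples of the convolution of \<open>\<bar>theta\<bar>\<close> with \<open>\<bar>v\<bar>\<close> are \<open>p\<close>-summable.\<close>

lemma sampling_theorem_conv:
  assumes p: "1 < p" and v: "bounded_borel v" and vp: "Lp_pow p lborel v < \<infinity>" and x: "x \<notin> \<int>"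
  shows "sinc_series (\<lambda>k. conv (theta (Suc n)) v (of_int k)) x = conv (theta (Suc n)) v x"
proof -
  let ?t = "theta (Suc n)"
  have [measurable]: "v \<in> borel_measurable borel" using v by (rule bounded_borel_measurable)
  obtain C where C: "0 < C" "\<And>x. \<bar>?t x\<bar> \<le> C * cauchy_kernel x"
  proof -
    obtain C where C: "0 < C" "\<And>x. \<bar>?t x\<bar> * (1 + \<bar>x\<bar>) ^ n \<le> C * cauchy_kernel x"
      using theta_weight_le by blast
    have "\<bar>?t x\<bar> * 1 \<le> \<bar>?t x\<bar> * (1 + \<bar>x\<bar>) ^ n" for x
      by (intro mult_left_mono one_le_power) auto
    with C show ?thesis using that by (metis mult.right_neutral order_trans)
  qed
  define a where "a k = (\<integral>\<^sup>+y. ennreal \<bar>?t (of_int k - y)\<bar> * ennreal (norm (v y)) \<partial>lborel)" for k :: int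
  \<comment> \<open>Dominates all partial sums below; its integral is finite by Young's inequality for conjugate exponents.\<close>
  define M where "M y = (\<integral>\<^sup>+k. ennreal \<bar>sinc_pi (x - of_int k)\<bar> * ennreal \<bar>?t (of_int k - y)\<bar> \<partial>Z) * ennreal (norm (v y))" for y
  have [measurable]: "M \<in> borel_measurable borel"
  proof -
    interpret Z: sigma_finite_measure Z by (rule sigma_finite_Z)
    show ?thesis unfolding M_def by measurable
  qed
  have M_fin: "(\<integral>\<^sup>+y. M y \<partial>lborel) < \<infinity>"
  proof -
    interpret Z: sigma_finite_measure Z by (rule sigma_finite_Z)
    interpret ZL: pair_sigma_finite Z lborel ..
    define q where "q = p / (p - 1)"
    have q: "1 < q" "1 / p + 1 / q = 1" using p by (auto simp: q_def field_simps)
    have a_fin: "(\<integral>\<^sup>+k. ennpow p (a k) \<partial>Z) < \<infinity>"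
    proof -
      have "(\<integral>\<^sup>+k. ennpow p (a k) \<partial>Z)
        \<le> (\<integral>\<^sup>+k. ennpow p (\<integral>\<^sup>+y. ennreal (cauchy_kernel (of_int k - y)) * ennreal (C * norm (v y)) \<partial>lborel) \<partial>Z)"
      proof (intro nn_integral_mono ennpow_mono)
        fix k :: int
        have "ennreal \<bar>?t (of_int k - y)\<bar> * ennreal (norm (v y)) \<le> ennreal (cauchy_kernel (of_int k - y)) * ennreal (C * norm (v y))" for y
        proof -
          have "\<bar>?t (of_int k - y)\<bar> * norm (v y) \<le> cauchy_kernel (of_int k - y) * (C * norm (v y))"
            using mult_right_mono[OF C(2)[of "of_int k - y"], of "norm (v y)"] by (simp add: mult_ac del: theta.simps)
          then show ?thesis using C by (simp add: ennreal_mult[symmetric] ennreal_leI del: theta.simps)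
        qed
        then show "a k \<le> (\<integral>\<^sup>+y. ennreal (cauchy_kernel (of_int k - y)) * ennreal (C * norm (v y)) \<partial>lborel)"
          unfolding a_def by (intro nn_integral_mono)
      qed (use p in simp)
      also have "\<dots> \<le> ennreal (2 powr p * (3 * pi) powr p) * (\<integral>\<^sup>+y. ennpow p (ennreal (C * norm (v y))) \<partial>lborel)"
        by (intro cauchy_schur_ZR p) measurable
      also have "(\<integral>\<^sup>+y. ennpow p (ennreal (C * norm (v y))) \<partial>lborel) = Lp_pow p lborel (\<lambda>y. of_real C * v y)"
        using C by (simp add: ennpow_ennreal Lp_pow_def norm_mult)
      also have "\<dots> = ennreal (C powr p) * Lp_pow p lborel v"
        using C by (subst Lp_pow_cmult) auto
      finally show ?thesis by (rule le_less_trans) (use vp in \<open>simp add: ennreal_mult_less_top\<close>)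
    qed
    have "(\<integral>\<^sup>+y. M y \<partial>lborel) = (\<integral>\<^sup>+y. \<integral>\<^sup>+k. ennreal \<bar>sinc_pi (x - of_int k)\<bar> * ennreal \<bar>?t (of_int k - y)\<bar> * ennreal (norm (v y)) \<partial>Z \<partial>lborel)"
      unfolding M_def by (subst nn_integral_multc) auto
    also have "\<dots> = (\<integral>\<^sup>+k. \<integral>\<^sup>+y. ennreal \<bar>sinc_pi (x - of_int k)\<bar> * ennreal \<bar>?t (of_int k - y)\<bar> * ennreal (norm (v y)) \<partial>lborel \<partial>Z)"
      by (rule ZL.Fubini') measurable
    also have "\<dots> = (\<integral>\<^sup>+k. ennreal \<bar>sinc_pi (x - of_int k)\<bar> * a k \<partial>Z)"
      unfolding a_def mult.assoc by (intro nn_integral_cong nn_integral_cmult) measurable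
    also have "\<dots> \<le> (\<integral>\<^sup>+k. ennpow p (a k) + ennreal (\<bar>sinc_pi (x - of_int k)\<bar> powr q) \<partial>Z)"
    proof (rule nn_integral_mono)
      fix k
      show "ennreal \<bar>sinc_pi (x - of_int k)\<bar> * a k \<le> ennpow p (a k) + ennreal (\<bar>sinc_pi (x - of_int k)\<bar> powr q)"
      proof (cases "a k")
        case (real r)
        have "\<bar>sinc_pi (x - of_int k)\<bar> * r \<le> \<bar>sinc_pi (x - of_int k)\<bar> powr q / q + r powr p / p"
          using p q real by (intro Youngs_inequality) auto
        also have "\<dots> \<le> \<bar>sinc_pi (x - of_int k)\<bar> powr q / 1 + r powr p / 1"
          using p q by (intro add_mono divide_left_mono) auto
        finally have "ennreal (\<bar>sinc_pi (x - of_int k)\<bar> * r) \<le> ennreal (r powr p + \<bar>sinc_pi (x - of_int k)\<bar> powr q)"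
          by (intro ennreal_leI) simp
        with real show ?thesis by (simp add: ennreal_mult ennpow_ennreal)
      qed simp
    qed
    also have "\<dots> = (\<integral>\<^sup>+k. ennpow p (a k) \<partial>Z) + (\<integral>\<^sup>+k. ennreal (\<bar>sinc_pi (x - of_int k)\<bar> powr q) \<partial>Z)"
      by (intro nn_integral_add) auto
    also have "\<dots> < \<infinity>"
    proof -
      obtain B where "\<And>x. (\<integral>\<^sup>+k. ennreal (\<bar>sinc_pi (x - of_int k)\<bar> powr q) \<partial>Z) \<le> ennreal B"
        using sinc_powr_finite[OF q(1)] by metis
      then have "(\<integral>\<^sup>+k. ennreal (\<bar>sinc_pi (x - of_int k)\<bar> powr q) \<partial>Z) < \<infinity>"
        by (rule le_less_trans) simp
      with a_fin show ?thesis by simp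
    qed
    finally show ?thesis .
  qed
  let ?s = "\<lambda>m y. sinc_sum {- int m..int m} (\<lambda>k. complex_of_real (?t (of_int k - y))) x * v y"
  have lim: "(\<lambda>m. LINT y|lborel. ?s m y) \<longlonglongrightarrow> (LINT y|lborel. of_real (?t (x - y)) * v y)"
  proof (rule integral_dominated_convergence[where w = "\<lambda>y. enn2real (M y)"])
    show "integrable lborel (\<lambda>y. enn2real (M y))"
    proof (rule integrableI_bounded)
      have "(\<integral>\<^sup>+y. ennreal (norm (enn2real (M y))) \<partial>lborel) \<le> (\<integral>\<^sup>+y. M y \<partial>lborel)"
        by (intro nn_integral_mono) (simp add: ennreal_enn2real_if)
      then show "(\<integral>\<^sup>+y. ennreal (norm (enn2real (M y))) \<partial>lborel) < \<infinity>" using M_fin by (rule le_less_trans)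
    qed measurable
    have "AE y in lborel. x - y \<notin> \<int>"
    proof -
      have "(\<lambda>n. x - n) ` (\<int>::real set) \<in> null_sets lborel"
        by (intro countable_imp_null_set_lborel) (simp add: Ints_def)
      then show ?thesis by (rule AE_I') (auto intro!: image_eqI[where x = "x - y" for y])
    qed
    with AE_not_integer show "AE y in lborel. (\<lambda>m. ?s m y) \<longlonglongrightarrow> of_real (?t (x - y)) * v y"
    proof eventually_elim
      case (elim y)
      show ?case
        using sinc_series_LIMSEQ[OF _ Lp_pow_theta_finite, of 2 "Suc n" y x] sinc_series_theta_shift[OF x elim, of "Suc n"]
        by (intro tendsto_mult tendsto_const) (simp del: theta.simps)
    qed
    fix m
    have "AE y in lborel. M y \<noteq> \<infinity>"
      using M_fin by (intro nn_integral_noteq_infinite) auto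
    then show "AE y in lborel. norm (?s m y) \<le> enn2real (M y)"
    proof eventually_elim
      case (elim y)
      have "ennreal (norm (?s m y)) \<le> M y"
      proof -
        have "norm (sinc_sum {- int m..int m} (\<lambda>k. complex_of_real (?t (of_int k - y))) x)
          \<le> (\<Sum>k\<in>{- int m..int m}. \<bar>sinc_pi (x - of_int k)\<bar> * \<bar>?t (of_int k - y)\<bar>)"
          unfolding sinc_sum_def by (rule sum_norm_le) (simp add: norm_mult mult.commute del: theta.simps)
        also have "\<dots> = (\<Sum>k\<in>{- int m..int m}. norm (sinc_pi (x - of_int k) * ?t (of_int k - y)) powr 1)"
          by (simp add: abs_mult del: theta.simps)
        finally have "ennreal (norm (sinc_sum {- int m..int m} (\<lambda>k. complex_of_real (?t (of_int k - y))) x))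
          \<le> ennreal (\<Sum>k\<in>{- int m..int m}. norm (complex_of_real (sinc_pi (x - of_int k) * ?t (of_int k - y))) powr 1)"
          unfolding norm_of_real real_norm_def by (rule ennreal_leI)
        also have "\<dots> \<le> Lp_pow 1 Z (\<lambda>k. complex_of_real (sinc_pi (x - of_int k) * ?t (of_int k - y)))"
          by (rule sum_le_Lp_pow_Z) simp
        also have "\<dots> = (\<integral>\<^sup>+k. ennreal \<bar>sinc_pi (x - of_int k)\<bar> * ennreal \<bar>?t (of_int k - y)\<bar> \<partial>Z)"
          unfolding Lp_pow_def norm_of_real by (simp add: abs_mult ennreal_mult del: theta.simps)
        finally show ?thesis
          unfolding M_def norm_mult by (simp add: ennreal_mult mult_right_mono del: theta.simps)
      qed
      then show ?case using elim by (cases "M y") (auto simp: ennreal_le_iff)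
    qed
  qed (measurable, auto simp: sinc_sum_def simp del: theta.simps)
  have fin: "(LINT y|lborel. ?s m y) = sinc_sum {- int m..int m} (\<lambda>k. conv ?t v (of_int k)) x" for m
  proof -
    have int: "integrable lborel (\<lambda>y. of_real (?t (of_int k - y)) * v y)" for k :: int
      using conv_integrable[OF theta_integrable[of n] v, of "of_int k"]
        lborel_integrable_real_affine[where f = "\<lambda>u. ?t u *\<^sub>R v (of_int k - u)" and c = "-1" and t = "of_int k"]
      by (simp add: scaleR_conv_of_real del: theta.simps)
    have "?s m y = (\<Sum>k\<in>{- int m..int m}. of_real (sinc_pi (x - of_int k)) * (of_real (?t (of_int k - y)) * v y))" for y
      unfolding sinc_sum_def sum_distrib_right by (intro sum.cong refl) (simp add: mult_ac del: theta.simps)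
    then have "(LINT y|lborel. ?s m y) = (\<Sum>k\<in>{- int m..int m}. LINT y|lborel. of_real (sinc_pi (x - of_int k)) * (of_real (?t (of_int k - y)) * v y))"
      using int by (simp only:) (intro Bochner_Integration.integral_sum integrable_mult_right)
    also have "\<dots> = sinc_sum {- int m..int m} (\<lambda>k. conv ?t v (of_int k)) x"
      unfolding sinc_sum_def conv_reflect by (simp add: scaleR_conv_of_real mult.commute del: theta.simps)
    finally show ?thesis .
  qed
  have "Lp_pow p Z (\<lambda>k. conv ?t v (of_int k)) < \<infinity>"
    using Lp_pow_conv_integers[OF p less_imp_le[OF C(1)] theta_measurable v C(2)]
    by (rule le_less_trans) (use vp in \<open>simp add: ennreal_mult_less_top\<close>)
  from sinc_series_LIMSEQ[OF p this] have "(\<lambda>m. LINT y|lborel. ?s m y) \<longlonglongrightarrow> sinc_series (\<lambda>k. conv ?t v (of_int k)) x"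
    unfolding fin .
  from LIMSEQ_unique[OF this lim] show ?thesis
    unfolding conv_reflect by (simp add: scaleR_conv_of_real del: theta.simps)
qed

section \<open>Mixed and pure differences\<close>

lemma sum_powr_le:
  fixes a :: "'i \<Rightarrow> real"
  assumes "finite I" "\<And>i. i \<in> I \<Longrightarrow> 0 \<le> a i" "0 < p"
  shows "(\<Sum>i\<in>I. a i) powr p \<le> real (card I) powr p * (\<Sum>i\<in>I. a i powr p)"
proof (cases "I = {}")
  case False
  define m where "m = Max (a ` I)"
  have "m \<in> a ` I" unfolding m_def using assms(1) False by (intro Max_in) auto
  then obtain j where j: "j \<in> I" "m = a j" by blast
  have le: "a i \<le> m" if "i \<in> I" for i unfolding m_def using assms(1) that by (intro Max_ge) auto
  have "(\<Sum>i\<in>I. a i) \<le> real (card I) * m" using le by (rule sum_bounded_above)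
  then have "(\<Sum>i\<in>I. a i) powr p \<le> (real (card I) * m) powr p"
    using assms by (intro powr_mono2 sum_nonneg) auto
  also have "\<dots> = real (card I) powr p * a j powr p"
    using j assms by (simp add: powr_mult)
  also have "\<dots> \<le> real (card I) powr p * (\<Sum>i\<in>I. a i powr p)"
    using j assms(1) by (intro mult_left_mono member_le_sum) auto
  finally show ?thesis .
qed simp

lemma Lp_pow_sum:
  assumes I: "finite I" and p: "0 < p" and [measurable]: "\<And>i. i \<in> I \<Longrightarrow> g i \<in> borel_measurable M"
  shows "Lp_pow p M (\<lambda>x. \<Sum>i\<in>I. g i x) \<le> ennreal (real (card I) powr p) * (\<Sum>i\<in>I. Lp_pow p M (g i))"
proof -
  have "Lp_pow p M (\<lambda>x. \<Sum>i\<in>I. g i x)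
     \<le> (\<integral>\<^sup>+x. ennreal (real (card I) powr p) * (\<Sum>i\<in>I. ennreal (norm (g i x) powr p)) \<partial>M)"
    unfolding Lp_pow_def
  proof (rule nn_integral_mono)
    fix x
    have "norm (\<Sum>i\<in>I. g i x) powr p \<le> (\<Sum>i\<in>I. norm (g i x)) powr p"
      using p by (intro powr_mono2 norm_sum) auto
    also have "\<dots> \<le> real (card I) powr p * (\<Sum>i\<in>I. norm (g i x) powr p)"
      by (rule sum_powr_le[OF I _ p]) simp
    finally have "ennreal (norm (\<Sum>i\<in>I. g i x) powr p) \<le> ennreal (real (card I) powr p * (\<Sum>i\<in>I. norm (g i x) powr p))"
      by (rule ennreal_leI)
    then show "ennreal (norm (\<Sum>i\<in>I. g i x) powr p) \<le> ennreal (real (card I) powr p) * (\<Sum>i\<in>I. ennreal (norm (g i x) powr p))"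
      by (simp add: ennreal_mult sum_nonneg sum_ennreal)
  qed
  also have "\<dots> = ennreal (real (card I) powr p) * (\<Sum>i\<in>I. Lp_pow p M (g i))"
    unfolding Lp_pow_def by (subst nn_integral_cmult, measurable) (subst nn_integral_sum, auto)
  finally show ?thesis .
qed

lemma Lp_pow_sum_le:
  assumes I: "finite I" and p: "0 < p" and m: "\<And>i. i \<in> I \<Longrightarrow> g i \<in> borel_measurable M"
    and X: "\<And>i. i \<in> I \<Longrightarrow> Lp_pow p M (g i) \<le> X"
  shows "Lp_pow p M (\<lambda>x. \<Sum>i\<in>I. g i x) \<le> ennreal (real (card I) powr (p + 1)) * X"
proof -
  have "Lp_pow p M (\<lambda>x. \<Sum>i\<in>I. g i x) \<le> ennreal (real (card I) powr p) * (of_nat (card I) * X)"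
    using Lp_pow_sum[OF I p m] sum_bounded_above[of I "\<lambda>i. Lp_pow p M (g i)" X] X
    by (meson mult_left_mono order_trans zero_le)
  also have "\<dots> = ennreal (real (card I) powr p * real (card I)) * X"
    by (simp add: ennreal_mult ennreal_of_nat_eq_real_of_nat mult.assoc)
  also have "real (card I) powr p * real (card I) = real (card I) powr (p + 1)"
    using p by (simp add: powr_add)
  finally show ?thesis .
qed

definition step_diff :: "real \<Rightarrow> (real \<Rightarrow> complex) \<Rightarrow> real \<Rightarrow> complex" where
  "step_diff h v x = v (x + h) - v x"

primrec mixed_diff :: "real list \<Rightarrow> (real \<Rightarrow> complex) \<Rightarrow> real \<Rightarrow> complex" where
  "mixed_diff [] v = v"
| "mixed_diff (h # hs) v = step_diff h (mixed_diff hs v)"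

lemma step_diff_bounded_borel: "bounded_borel v \<Longrightarrow> bounded_borel (step_diff h v)"
  unfolding step_diff_def[abs_def] by (intro bounded_borel_diff bounded_borel_shift)

lemma mixed_diff_bounded_borel: "bounded_borel v \<Longrightarrow> bounded_borel (mixed_diff hs v)"
  by (induction hs) (auto intro: step_diff_bounded_borel)

lemma step_diff_commute: "step_diff a (step_diff b v) = step_diff b (step_diff a v)"
  by (rule ext) (simp add: step_diff_def add_ac)

lemma mixed_diff_step_commute: "mixed_diff hs (step_diff a v) = step_diff a (mixed_diff hs v)"
  by (induction hs) (simp_all add: step_diff_commute[of a])

lemma mixed_diff_append: "mixed_diff (as @ bs) v = mixed_diff as (mixed_diff bs v)"
  by (induction as) simp_all

text \<open>A difference with step \<open>n * h\<close> is a sum of \<open>n\<close> translated differences with step \<open>h\<close>.\<close>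

lemma Lp_pow_step_diff_multiple:
  assumes p: "0 < p" and v: "bounded_borel v"
  shows "Lp_pow p lborel (step_diff (real n * h) v) \<le> ennreal (real n powr (p + 1)) * Lp_pow p lborel (step_diff h v)"
proof -
  have m: "step_diff h v \<in> borel_measurable borel"
    by (intro bounded_borel_measurable step_diff_bounded_borel v)
  have "step_diff (real n * h) v x = (\<Sum>i<n. step_diff h v (x + real i * h))" for x
    by (induction n) (simp_all add: step_diff_def algebra_simps)
  then have "Lp_pow p lborel (step_diff (real n * h) v) = Lp_pow p lborel (\<lambda>x. \<Sum>i<n. step_diff h v (x + real i * h))"
    by (simp add: Lp_pow_def)
  also have "\<dots> \<le> ennreal (real (card {..<n}) powr (p + 1)) * Lp_pow p lborel (step_diff h v)"
  proof (rule Lp_pow_sum_le)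
    show "Lp_pow p lborel (\<lambda>x. step_diff h v (x + real i * h)) \<le> Lp_pow p lborel (step_diff h v)" for i
      by (simp add: Lp_pow_lborel_shift[OF m])
    show "(\<lambda>x. step_diff h v (x + real i * h)) \<in> borel_measurable lborel" for i
      using m by measurable
  qed (use p in auto)
  finally show ?thesis by simp
qed

lemma Lp_pow_mixed_diff_multiple:
  assumes p: "0 < p" and v: "bounded_borel v"
  shows "Lp_pow p lborel (mixed_diff (map (\<lambda>u. real (n u) * h u) us) v)
    \<le> ennreal (prod_list (map (\<lambda>u. real (n u) powr (p + 1)) us)) * Lp_pow p lborel (mixed_diff (map h us) v)"
  using v
proof (induction us arbitrary: v)
  case (Cons u us)
  let ?c = "\<lambda>u. real (n u) powr (p + 1)"
  have "Lp_pow p lborel (mixed_diff (map (\<lambda>u. real (n u) * h u) (u # us)) v)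
     \<le> ennreal (?c u) * Lp_pow p lborel (step_diff (h u) (mixed_diff (map (\<lambda>u. real (n u) * h u) us) v))"
    using Lp_pow_step_diff_multiple[OF p mixed_diff_bounded_borel[OF Cons.prems]] by simp
  also have "\<dots> = ennreal (?c u) * Lp_pow p lborel (mixed_diff (map (\<lambda>u. real (n u) * h u) us) (step_diff (h u) v))"
    by (simp add: mixed_diff_step_commute)
  also have "\<dots> \<le> ennreal (?c u) * (ennreal (prod_list (map ?c us)) * Lp_pow p lborel (mixed_diff (map h us) (step_diff (h u) v)))"
    by (intro mult_left_mono Cons.IH step_diff_bounded_borel Cons.prems) simp
  also have "\<dots> = ennreal (prod_list (map ?c (u # us))) * Lp_pow p lborel (mixed_diff (map h (u # us)) v)"
  proof -
    have "0 \<le> prod_list (map ?c us)" by (induction us) auto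
    then show ?thesis by (simp add: mixed_diff_step_commute mult.assoc ennreal_mult)
  qed
  finally show ?case .
qed simp

lemma mixed_diff_expand:
  "mixed_diff (map h [0..<n]) v x = (\<Sum>S\<in>Pow {..<n}. (-1) ^ (n + card S) * v (x + sum h S))"
proof (induction n arbitrary: v)
  case (Suc n)
  have "Pow {..<Suc n} = Pow {..<n} \<union> insert n ` Pow {..<n}"
    by (simp add: lessThan_Suc Pow_insert)
  moreover have "Pow {..<n} \<inter> insert n ` Pow {..<n} = {}" by auto
  moreover have inj: "inj_on (insert n) (Pow {..<n})" by (auto simp: inj_on_def)
  ultimately have "(\<Sum>S\<in>Pow {..<Suc n}. (-1) ^ (Suc n + card S) * v (x + sum h S))
     = (\<Sum>S\<in>Pow {..<n}. (-1) ^ (Suc n + card S) * v (x + sum h S))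
       + (\<Sum>S\<in>Pow {..<n}. (-1) ^ (Suc n + card (insert n S)) * v (x + sum h (insert n S)))"
    by (simp add: sum.union_disjoint sum.reindex)
  also have "(\<Sum>S\<in>Pow {..<n}. (-1) ^ (Suc n + card (insert n S)) * v (x + sum h (insert n S)))
     = (\<Sum>S\<in>Pow {..<n}. (-1) ^ (n + card S) * v (x + sum h S + h n))"
  proof (intro sum.cong refl)
    fix S assume "S \<in> Pow {..<n}"
    then have "finite S" "n \<notin> S" by (auto intro: finite_subset)
    then show "(-1) ^ (Suc n + card (insert n S)) * v (x + sum h (insert n S)) = (-1) ^ (n + card S) * v (x + sum h S + h n)"
      by (simp add: add_ac)
  qed
  also have "(\<Sum>S\<in>Pow {..<n}. (-1) ^ (Suc n + card S) * v (x + sum h S))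
       + (\<Sum>S\<in>Pow {..<n}. (-1) ^ (n + card S) * v (x + sum h S + h n))
     = (\<Sum>S\<in>Pow {..<n}. (-1) ^ (n + card S) * step_diff (h n) v (x + sum h S))"
    unfolding sum.distrib[symmetric] by (intro sum.cong refl) (simp add: step_diff_def algebra_simps)
  also have "\<dots> = mixed_diff (map h [0..<n]) (step_diff (h n) v) x"
    by (rule Suc.IH[symmetric])
  also have "\<dots> = mixed_diff (map h [0..<Suc n]) v x"
    by (simp add: mixed_diff_append)
  finally show ?case by simp
qed simp

text \<open>A step of size zero makes the terms of \<open>S\<close> and of \<open>insert j S\<close> cancel.\<close>

lemma alternating_sum_vanishes:
  fixes s :: "nat \<Rightarrow> real" and v :: "real \<Rightarrow> complex"
  assumes J: "finite J" "j \<in> J" "s j = 0"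
  shows "(\<Sum>S\<in>Pow J. (-1) ^ card S * v (x + sum s S)) = 0"
proof -
  let ?K = "J - {j}"
  have "Pow J = Pow ?K \<union> insert j ` Pow ?K"
    using J(2) Pow_insert[of j ?K] by (simp add: insert_absorb)
  moreover have "Pow ?K \<inter> insert j ` Pow ?K = {}" by auto
  moreover have "inj_on (insert j) (Pow ?K)" by (auto simp: inj_on_def)
  ultimately have "(\<Sum>S\<in>Pow J. (-1) ^ card S * v (x + sum s S))
     = (\<Sum>S\<in>Pow ?K. (-1) ^ card S * v (x + sum s S)) + (\<Sum>S\<in>Pow ?K. (-1) ^ card (insert j S) * v (x + sum s (insert j S)))"
    using J(1) by (simp add: sum.union_disjoint sum.reindex)
  also have "(\<Sum>S\<in>Pow ?K. (-1) ^ card (insert j S) * v (x + sum s (insert j S)))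
     = (\<Sum>S\<in>Pow ?K. - ((-1) ^ card S * v (x + sum s S)))"
  proof (intro sum.cong refl)
    fix S assume "S \<in> Pow ?K"
    then have "finite S" "j \<notin> S" using J(1) by (auto intro: finite_subset)
    then show "(-1) ^ card (insert j S) * v (x + sum s (insert j S)) = - ((-1) ^ card S * v (x + sum s S))"
      using J(3) by simp
  qed
  finally show ?thesis by (simp add: sum_negf)
qed

text \<open>Kemperman's identity. Expanding the pure differences, the coefficient of each \<open>k\<close> is a mixed
difference with steps \<open>h j * (1 - k / (j + 1))\<close>. It vanishes for \<open>1 \<le> k \<le> r\<close>, because the step with
\<open>j = k - 1\<close> is zero, and only \<open>k = 0\<close> is left.\<close>

lemma mixed_diff_via_fwd_difference:
  "mixed_diff (map h [0..<r]) v x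
    = (\<Sum>S\<in>Pow {..<r}. (-1) ^ card S * fwd_difference r (- (\<Sum>j\<in>S. h j / real (Suc j))) v (x + sum h S))"
proof -
  let ?s = "\<lambda>k j. h j * (1 - real k / real (Suc j))"
  have "(\<Sum>S\<in>Pow {..<r}. (-1) ^ card S * fwd_difference r (- (\<Sum>j\<in>S. h j / real (Suc j))) v (x + sum h S))
     = (\<Sum>S\<in>Pow {..<r}. \<Sum>k=0..r. of_nat (r choose k) * (-1) ^ (r - k) * ((-1) ^ card S * v (x + sum (?s k) S)))"
  proof (intro sum.cong refl)
    fix S
    have "x + sum h S + real k * - (\<Sum>j\<in>S. h j / real (Suc j)) = x + sum (?s k) S" for k
      by (simp add: right_diff_distrib sum_subtractf sum_distrib_left mult.commute)
    then show "(-1) ^ card S * fwd_difference r (- (\<Sum>j\<in>S. h j / real (Suc j))) v (x + sum h S)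
      = (\<Sum>k=0..r. of_nat (r choose k) * (-1) ^ (r - k) * ((-1) ^ card S * v (x + sum (?s k) S)))"
      unfolding fwd_difference_def sum_distrib_left by (simp only: mult_ac)
  qed
  also have "\<dots> = (\<Sum>k=0..r. of_nat (r choose k) * (-1) ^ (r - k) * (\<Sum>S\<in>Pow {..<r}. (-1) ^ card S * v (x + sum (?s k) S)))"
    by (subst sum.swap) (simp add: sum_distrib_left)
  also have "\<dots> = (\<Sum>k\<in>{0}. of_nat (r choose k) * (-1) ^ (r - k) * (\<Sum>S\<in>Pow {..<r}. (-1) ^ card S * v (x + sum (?s k) S)))"
  proof (rule sum.mono_neutral_right)
    show "\<forall>k\<in>{0..r} - {0}. of_nat (r choose k) * (-1) ^ (r - k) * (\<Sum>S\<in>Pow {..<r}. (-1) ^ card S * v (x + sum (?s k) S)) = 0"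
    proof
      fix k assume "k \<in> {0..r} - {0}"
      then have "k - 1 \<in> {..<r}" "?s k (k - 1) = 0" by auto
      then have "(\<Sum>S\<in>Pow {..<r}. (-1) ^ card S * v (x + sum (?s k) S)) = 0"
        by (intro alternating_sum_vanishes) auto
      then show "of_nat (r choose k) * (-1) ^ (r - k) * (\<Sum>S\<in>Pow {..<r}. (-1) ^ card S * v (x + sum (?s k) S)) = 0"
        by simp
    qed
  qed auto
  also have "\<dots> = mixed_diff (map h [0..<r]) v x"
    unfolding mixed_diff_expand by (simp add: sum_distrib_left power_add mult.assoc)
  finally show ?thesis by simp
qed

lemma fwd_difference_0: "1 \<le> r \<Longrightarrow> fwd_difference r 0 v x = 0"
proof -
  assume r: "1 \<le> r"
  have "(\<Sum>k=0..r. of_nat (r choose k) * (-1) ^ (r - k)) = (1 + (-1 :: complex)) ^ r"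
    by (subst binomial_ring) (simp add: atLeast0AtMost)
  then have "(\<Sum>k=0..r. of_nat (r choose k) * (-1) ^ (r - k)) = (0 :: complex)" using r by simp
  then show ?thesis by (simp add: fwd_difference_def flip: sum_distrib_right)
qed

lemma fwd_difference_minus: "fwd_difference r (- h) v x = (-1) ^ r * fwd_difference r h v (x + - (real r * h))"
proof -
  have "fwd_difference r (- h) v x = (\<Sum>k=0..r. of_nat (r choose (r - k)) * (-1) ^ k * v (x + real (r - k) * - h))"
    unfolding fwd_difference_def by (subst sum.atLeastAtMost_rev) (auto intro!: sum.cong)
  also have "\<dots> = (\<Sum>k=0..r. (-1) ^ r * (of_nat (r choose k) * (-1) ^ (r - k) * v (x + - (real r * h) + real k * h)))"
  proof (intro sum.cong refl)
    fix k assume "k \<in> {0..r}"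
    then have k: "k \<le> r" by simp
    have e: "r + (r - k) = k + 2 * (r - k)" using k by simp
    have "(-1 :: complex) ^ r * (-1) ^ (r - k) = (-1) ^ (k + 2 * (r - k))"
      unfolding power_add[symmetric] e ..
    also have "\<dots> = (-1) ^ k" by (simp add: power_add power_mult)
    finally have "(-1 :: complex) ^ r * (-1) ^ (r - k) = (-1) ^ k" .
    moreover have "r choose (r - k) = r choose k" using k by (simp add: binomial_symmetric[symmetric])
    moreover have "x + real (r - k) * - h = x + - (real r * h) + real k * h" using k by (simp add: of_nat_diff algebra_simps)
    ultimately show "of_nat (r choose (r - k)) * (-1) ^ k * v (x + real (r - k) * - h)
      = (-1) ^ r * (of_nat (r choose k) * (-1) ^ (r - k) * v (x + - (real r * h) + real k * h))"
      by (metis mult.assoc mult.left_commute)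
  qed
  finally show ?thesis by (simp add: fwd_difference_def sum_distrib_left)
qed

lemma fwd_difference_bounded_borel: "bounded_borel v \<Longrightarrow> bounded_borel (fwd_difference r h v)"
  unfolding fwd_difference_def[abs_def]
proof (rule bounded_borel_sum)
  fix k assume "bounded_borel v"
  then have "bounded_borel (\<lambda>x. v (x + real k * h))" by (rule bounded_borel_shift)
  then show "bounded_borel (\<lambda>x. of_nat (r choose k) * (-1) ^ (r - k) * v (x + real k * h))"
    unfolding bounded_borel_def
    by (auto simp: norm_mult norm_power intro!: exI mult_left_mono)
qed

lemma Lp_pow_fwd_difference_sign:
  assumes r: "1 \<le> r" and v: "bounded_borel v" and h: "\<bar>h\<bar> \<le> 1"
    and X: "\<And>h. 0 < h \<Longrightarrow> h \<le> 1 \<Longrightarrow> Lp_pow p lborel (fwd_difference r h v) \<le> X"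
  shows "Lp_pow p lborel (fwd_difference r h v) \<le> X"
proof -
  consider "0 < h" | "h = 0" | "h < 0" by linarith
  then show ?thesis
  proof cases
    case 1 then show ?thesis using X h by simp
  next
    case 2 then show ?thesis using r by (simp add: Lp_pow_def fwd_difference_0)
  next
    case 3
    have m: "fwd_difference r (- h) v \<in> borel_measurable borel"
      by (intro bounded_borel_measurable fwd_difference_bounded_borel v)
    have "Lp_pow p lborel (fwd_difference r h v) = Lp_pow p lborel (\<lambda>x. fwd_difference r (- h) v (x + real r * h))"
      unfolding Lp_pow_def using fwd_difference_minus[of r "- h" v] by (simp add: norm_mult norm_power)
    also have "\<dots> = Lp_pow p lborel (fwd_difference r (- h) v)" by (rule Lp_pow_lborel_shift[OF m])
    also have "\<dots> \<le> X" using X[of "- h"] 3 h by simp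
    finally show ?thesis .
  qed
qed

text \<open>If all steps are at most \<open>1 / r\<close> in size, the steps of the pure differences in Kemperman's identity
are at most one, so a bound on differences with steps in \<open>{0<..1}\<close> suffices.\<close>

lemma Lp_pow_mixed_diff_small:
  assumes p: "0 < p" and r: "1 \<le> r" and v: "bounded_borel v" and us: "length us = r" "\<And>u. u \<in> set us \<Longrightarrow> \<bar>u\<bar> \<le> 1 / real r"
    and X: "\<And>h. 0 < h \<Longrightarrow> h \<le> 1 \<Longrightarrow> Lp_pow p lborel (fwd_difference r h v) \<le> X"
  shows "Lp_pow p lborel (mixed_diff us v) \<le> ennreal ((2 ^ r) powr (p + 1)) * X"
proof -
  define h where "h j = us ! j" for j
  have "us = map h [0..<r]" using us(1) by (auto simp: h_def intro: nth_equalityI)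
  then have "Lp_pow p lborel (mixed_diff us v)
    = Lp_pow p lborel (\<lambda>x. \<Sum>S\<in>Pow {..<r}. (-1) ^ card S * fwd_difference r (- (\<Sum>j\<in>S. h j / real (Suc j))) v (x + sum h S))"
    by (simp add: Lp_pow_def mixed_diff_via_fwd_difference)
  also have "\<dots> \<le> ennreal (real (card (Pow {..<r})) powr (p + 1)) * X"
  proof (rule Lp_pow_sum_le)
    fix S assume S: "S \<in> Pow {..<r}"
    let ?k = "- (\<Sum>j\<in>S. h j / real (Suc j))"
    have m: "fwd_difference r ?k v \<in> borel_measurable borel"
      by (intro bounded_borel_measurable fwd_difference_bounded_borel v)
    then show "(\<lambda>x. (-1) ^ card S * fwd_difference r ?k v (x + sum h S)) \<in> borel_measurable lborel"
      by measurable
    have "\<bar>?k\<bar> \<le> (\<Sum>j\<in>S. 1 / real r)"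
      unfolding abs_minus_cancel
    proof (rule order_trans[OF sum_abs sum_mono])
      fix j assume "j \<in> S"
      then have "\<bar>h j\<bar> \<le> 1 / real r" using S us by (auto simp: h_def)
      moreover have "\<bar>h j / real (Suc j)\<bar> \<le> \<bar>h j\<bar> / 1"
        unfolding abs_divide by (intro divide_left_mono) auto
      ultimately show "\<bar>h j / real (Suc j)\<bar> \<le> 1 / real r" by simp
    qed
    also have "\<dots> = real (card S) / real r" by simp
    also have "\<dots> \<le> 1" using S card_mono[of "{..<r}" S] r by simp
    finally have "Lp_pow p lborel (fwd_difference r ?k v) \<le> X"
      by (rule Lp_pow_fwd_difference_sign[OF r v _ X])
    moreover have "Lp_pow p lborel (\<lambda>x. (-1) ^ card S * fwd_difference r ?k v (x + sum h S)) = Lp_pow p lborel (fwd_difference r ?k v)"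
      using Lp_pow_lborel_shift[OF m, of p "sum h S"] by (simp add: Lp_pow_def norm_mult norm_power)
    ultimately show "Lp_pow p lborel (\<lambda>x. (-1) ^ card S * fwd_difference r ?k v (x + sum h S)) \<le> X" by simp
  qed (use p in auto)
  finally show ?thesis by (simp add: card_Pow)
qed

text \<open>An upper bound for the price of dividing a step of size \<open>\<bar>u\<bar>\<close> into steps of size at most
\<open>1 / r\<close>. A natural exponent keeps it polynomial, so that \<open>theta\<close> can integrate it.\<close>

definition diff_weight :: "nat \<Rightarrow> nat \<Rightarrow> real \<Rightarrow> real" where
  "diff_weight r D u = (real (r + 2) * (1 + \<bar>u\<bar>)) ^ D"

lemma diff_weight_minus [simp]: "diff_weight r D (- u) = diff_weight r D u"
  by (simp add: diff_weight_def)

lemma diff_weight_ge_1: "1 \<le> diff_weight r D u"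
proof -
  have "1 * 1 \<le> real (r + 2) * (1 + \<bar>u\<bar>)" by (intro mult_mono) auto
  then show ?thesis unfolding diff_weight_def by (intro one_le_power) simp
qed

text \<open>Divide every step \<open>u\<close> by a natural number of size about \<open>r * \<bar>u\<bar>\<close>, and apply the bound for small steps.\<close>

lemma Lp_pow_mixed_diff:
  assumes p: "0 < p" and r: "1 \<le> r" and D: "p + 1 \<le> real D" and v: "bounded_borel v" and us: "length us = r"
    and X: "\<And>h. 0 < h \<Longrightarrow> h \<le> 1 \<Longrightarrow> Lp_pow p lborel (fwd_difference r h v) \<le> X"
  shows "Lp_pow p lborel (mixed_diff us v)
    \<le> ennreal (prod_list (map (diff_weight r D) us)) * (ennreal ((2 ^ r) powr (p + 1)) * X)"
proof -
  define n where "n u = nat \<lceil>real r * \<bar>u\<bar>\<rceil> + 1" for u :: real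
  have n: "real r * \<bar>u\<bar> \<le> real (n u)" "real (n u) \<le> real r * \<bar>u\<bar> + 2" "0 < n u" for u
  proof -
    have "real (nat \<lceil>real r * \<bar>u\<bar>\<rceil>) = of_int \<lceil>real r * \<bar>u\<bar>\<rceil>" by simp
    then show "real r * \<bar>u\<bar> \<le> real (n u)" "real (n u) \<le> real r * \<bar>u\<bar> + 2" "0 < n u"
      unfolding n_def using ceiling_correct[of "real r * \<bar>u\<bar>"] by simp_all linarith+
  qed
  have w: "real (n u) powr (p + 1) \<le> diff_weight r D u" for u
  proof -
    have "real (n u) powr (p + 1) \<le> real (n u) powr real D"
      using n(3)[of u] D by (intro powr_mono) auto
    also have "\<dots> = real (n u) ^ D" using n(3)[of u] by (simp add: powr_realpow)
    also have "\<dots> \<le> diff_weight r D u"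
      unfolding diff_weight_def
    proof (rule power_mono)
      show "real (n u) \<le> real (r + 2) * (1 + \<bar>u\<bar>)" using n(2)[of u] by (simp add: algebra_simps)
    qed simp
    finally show ?thesis .
  qed
  have us_eq: "map (\<lambda>u. real (n u) * (u / real (n u))) us = us"
    using n(3) by (intro map_idI) simp
  have "Lp_pow p lborel (mixed_diff us v)
     \<le> ennreal (prod_list (map (\<lambda>u. real (n u) powr (p + 1)) us)) * Lp_pow p lborel (mixed_diff (map (\<lambda>u. u / real (n u)) us) v)"
    using Lp_pow_mixed_diff_multiple[OF p v, of n "\<lambda>u. u / real (n u)" us] unfolding us_eq .
  also have "\<dots> \<le> ennreal (prod_list (map (diff_weight r D) us)) * (ennreal ((2 ^ r) powr (p + 1)) * X)"
  proof (intro mult_mono ennreal_leI)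
    show "prod_list (map (\<lambda>u. real (n u) powr (p + 1)) us) \<le> prod_list (map (diff_weight r D) us)"
    proof (induction us)
      case (Cons u us)
      then show ?case
        using w[of u] diff_weight_ge_1[of r D u] by (auto intro!: mult_mono prod_list_nonneg)
    qed simp
    show "Lp_pow p lborel (mixed_diff (map (\<lambda>u. u / real (n u)) us) v) \<le> ennreal ((2 ^ r) powr (p + 1)) * X"
    proof (rule Lp_pow_mixed_diff_small[OF p r v _ _ X])
      fix y assume "y \<in> set (map (\<lambda>u. u / real (n u)) us)"
      then obtain u where "y = u / real (n u)" by auto
      then show "\<bar>y\<bar> \<le> 1 / real r"
        using n(1,3)[of u] r by (simp only: abs_divide abs_of_nat) (simp add: divide_simps mult.commute)
    qed (use us in auto)
  qed auto
  finally show ?thesis .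
qed

section \<open>Jackson's estimate\<close>

definition residual :: "(real \<Rightarrow> real) \<Rightarrow> (real \<Rightarrow> complex) \<Rightarrow> real \<Rightarrow> complex" where
  "residual K v x = v x - conv K v x"

lemma residual_bounded_borel: "integrable lborel K \<Longrightarrow> bounded_borel v \<Longrightarrow> bounded_borel (residual K v)"
  unfolding residual_def[abs_def] by (intro bounded_borel_diff conv_bounded_borel)

lemma residual_pow_bounded_borel:
  "integrable lborel K \<Longrightarrow> bounded_borel v \<Longrightarrow> bounded_borel ((residual K ^^ n) v)"
  by (induction n) (auto intro: residual_bounded_borel)

lemma step_diff_residual:
  assumes "integrable lborel K" "bounded_borel v"
  shows "step_diff h (residual K v) = residual K (step_diff h v)"
proof
  fix x
  have "conv K (step_diff h v) x = conv K v (x + h) - conv K v x"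
    unfolding step_diff_def[abs_def]
    using conv_diff[OF assms(1) bounded_borel_shift[OF assms(2)] assms(2)] by (simp add: conv_shift)
  then show "step_diff h (residual K v) x = residual K (step_diff h v) x"
    by (simp add: step_diff_def residual_def)
qed

lemma mixed_diff_residual:
  assumes "integrable lborel K" "bounded_borel v"
  shows "mixed_diff us (residual K v) = residual K (mixed_diff us v)"
  using assms by (induction us) (auto simp: step_diff_residual mixed_diff_bounded_borel)

text \<open>As \<open>K\<close> has integral one, the error of the convolution is an average of first differences.\<close>

lemma residual_eq_integral:
  assumes K: "integrable lborel K" "(LINT u|lborel. K u) = 1" and v: "bounded_borel v"
  shows "residual K v x = - (LINT u|lborel. K u *\<^sub>R step_diff (- u) v x)"
proof -
  have "(LINT u|lborel. K u *\<^sub>R v x) = v x"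
    using K by simp
  moreover have "integrable lborel (\<lambda>u. K u *\<^sub>R v x)" using K by simp
  ultimately show ?thesis
    unfolding residual_def conv_def step_diff_def
    using conv_integrable[OF K(1) v, of x] by (simp add: scaleR_diff_right)
qed

text \<open>Each factor \<open>residual K\<close> contributes one difference and one integration against \<open>K\<close>. It commutes with
the differences already present, so an induction on the number of factors applies.\<close>

lemma Lp_pow_residual_pow:
  assumes p: "1 < p" and K: "integrable lborel K" "(LINT u|lborel. K u) = 1" and A: "0 < A"
    and KA: "(\<integral>\<^sup>+u. ennreal \<bar>K u\<bar> \<partial>lborel) \<le> ennreal A"
    and Kw: "(\<integral>\<^sup>+u. ennreal \<bar>K u\<bar> * ennreal (w u) \<partial>lborel) \<le> ennreal A"
    and w: "w \<in> borel_measurable borel" "\<And>u. 0 \<le> w u" "\<And>u. w (- u) = w u"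
    and v: "bounded_borel v"
    and X: "\<And>us. length us = r \<Longrightarrow> Lp_pow p lborel (mixed_diff us v) \<le> ennreal (prod_list (map w us)) * X"
  shows "Lp_pow p lborel ((residual K ^^ r) v) \<le> ennreal (2 powr p * A powr p) ^ r * X"
  using v X
proof (induction r arbitrary: v X)
  case 0
  then show ?case using 0(2)[of "[]"] by simp
next
  case (Suc r)
  let ?c = "ennreal (2 powr p * A powr p)"
  have [measurable]: "K \<in> borel_measurable borel" "v \<in> borel_measurable borel" "w \<in> borel_measurable borel"
    using K w Suc.prems(1) by (auto simp: bounded_borel_def)
  have "Lp_pow p lborel (mixed_diff us (residual K v)) \<le> ennreal (prod_list (map w us)) * (?c * X)"
    if us: "length us = r" for us
  proof -
    let ?m = "mixed_diff us v"
    have m: "bounded_borel ?m" by (rule mixed_diff_bounded_borel[OF Suc.prems(1)])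
    then have [measurable]: "?m \<in> borel_measurable borel" by (rule bounded_borel_measurable)
    have "Lp_pow p lborel (mixed_diff us (residual K v)) = Lp_pow p lborel (\<lambda>x. LINT u|lborel. K u *\<^sub>R step_diff (- u) ?m x)"
      unfolding Lp_pow_def mixed_diff_residual[OF K(1) Suc.prems(1)] residual_eq_integral[OF K m] by simp
    also have "\<dots> \<le> ?c * (ennreal (prod_list (map w us)) * X)"
    proof (rule Lp_pow_weighted_integral[OF p A])
      show "(\<lambda>(x, u). step_diff (- u) ?m x) \<in> borel_measurable (lborel \<Otimes>\<^sub>M lborel)"
        unfolding step_diff_def by measurable
      show "Lp_pow p lborel (\<lambda>x. step_diff (- u) ?m x) \<le> ennreal (w u) * (ennreal (prod_list (map w us)) * X)" for u
        using Suc.prems(2)[of "- u # us"] us w(2,3) by (simp add: ennreal_mult' prod_list_nonneg mult.assoc)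
    qed (use KA Kw in auto)
    finally show ?thesis by (simp add: mult_ac)
  qed
  then have "Lp_pow p lborel ((residual K ^^ r) (residual K v)) \<le> ?c ^ r * (?c * X)"
    by (intro Suc.IH residual_bounded_borel K Suc.prems)
  then show ?case by (simp add: funpow_swap1 mult_ac)
qed

section \<open>Steklov averages as convolutions\<close>

lemma AE_lborel_affine:
  assumes c: "c \<noteq> 0" and P: "AE x in lborel. P (x::real)"
  shows "AE x in lborel. P (t + c * x)"
proof -
  obtain N where N: "{x. \<not> P x} \<subseteq> N" "N \<in> null_sets lborel"
    using P by (auto simp: eventually_ae_filter)
  then have "AE x in lborel. x \<notin> N" by (intro AE_not_in)
  moreover have "Measurable.pred borel (\<lambda>x. x \<notin> N)" 
  proof -
    have [measurable]: "N \<in> sets borel" using N(2) by auto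
    show ?thesis by measurable
  qed
  ultimately have "AE x in lborel. t + c * x \<notin> N" by (intro AE_borel_affine c)
  then show ?thesis using N(1) by (auto elim!: eventually_mono)
qed

lemma measurable_lebesgue_affine:
  assumes "f \<in> borel_measurable lebesgue" "c \<noteq> (0::real)"
  shows "(\<lambda>x. f (t + c * x)) \<in> borel_measurable lebesgue"
proof -
  have "(\<lambda>x. t + c * x) \<in> lebesgue \<rightarrow>\<^sub>M lebesgue"
    using lebesgue_affine_measurable[where c = "\<lambda>x::real. c"] assms(2) by simp
  then show ?thesis using assms(1) by (rule measurable_compose)
qed

text \<open>With at least one integration, changing the integrand on a null set has no effect at any point \<open>c\<close>.
This allows Steklov averages of a Lebesgue measurable function to be computed from a Borel version.\<close>

lemma iterated_integral_cong_AE: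
  fixes F F' :: "real \<Rightarrow> complex"
  assumes F: "F \<in> borel_measurable lebesgue" and F': "F' \<in> borel_measurable lebesgue"
    and eq: "AE x in lborel. F x = F' x"
  shows "iterated_integral \<delta> (Suc n) (\<lambda>ts. F (c + sum_list ts)) = iterated_integral \<delta> (Suc n) (\<lambda>ts. F' (c + sum_list ts))"
proof (induction n arbitrary: c)
  case 0
  have ae: "AE t in lebesgue. F (c + 1 * t) = F' (c + 1 * t)"
    unfolding AE_completion_iff by (rule AE_lborel_affine[OF _ eq]) simp
  have m: "(\<lambda>t. indicator {0..\<delta>} t *\<^sub>R G (c + t)) \<in> borel_measurable lebesgue"
    if "G \<in> borel_measurable lebesgue" for G :: "real \<Rightarrow> complex"
    using measurable_lebesgue_affine[OF that, of 1 c]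
    by (intro borel_measurable_scaleR borel_measurable_indicator) simp_all
  have "(LINT t|lebesgue. indicator {0..\<delta>} t *\<^sub>R F (c + t)) = (LINT t|lebesgue. indicator {0..\<delta>} t *\<^sub>R F' (c + t))"
    using ae by (intro integral_cong_AE m F F') (auto elim!: eventually_mono)
  then show ?case by (simp add: set_lebesgue_integral_def)
next
  case (Suc n)
  have "iterated_integral \<delta> (Suc n) (\<lambda>ts. F (c + sum_list (t # ts))) = iterated_integral \<delta> (Suc n) (\<lambda>ts. F' (c + sum_list (t # ts)))" for t
    using Suc[of "c + t"] by (simp only: sum_list.Cons add.assoc)
  then show ?case by (subst (1 2) iterated_integral.simps(2)) (simp only:)
qed

lemma iterated_integral_scale:
  fixes F :: "real \<Rightarrow> complex"
  assumes "0 < \<delta>"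
  shows "iterated_integral \<delta> n (\<lambda>ts. F (c + sum_list ts)) = \<delta> ^ n * iterated_integral 1 n (\<lambda>ts. F (c + \<delta> * sum_list ts))"
proof (induction n arbitrary: c)
  case (Suc n)
  have "iterated_integral \<delta> (Suc n) (\<lambda>ts. F (c + sum_list ts))
     = (LINT t|lebesgue. indicator {0..\<delta>} t *\<^sub>R (of_real (\<delta> ^ n) * iterated_integral 1 n (\<lambda>ts. F (c + t + \<delta> * sum_list ts))))"
    unfolding iterated_integral.simps set_lebesgue_integral_def
    by (intro Bochner_Integration.integral_cong refl) (simp only: sum_list.Cons add.assoc[symmetric] Suc of_real_power)
  also have "\<dots> = \<delta> *\<^sub>R (LINT t|lebesgue. indicator {0..\<delta>} (0 + \<delta> * t) *\<^sub>R (of_real (\<delta> ^ n) * iterated_integral 1 n (\<lambda>ts. F (c + (0 + \<delta> * t) + \<delta> * sum_list ts))))"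
    using assms by (subst lebesgue_integral_real_affine[where c = \<delta> and t = 0]) auto
  also have "\<dots> = \<delta> *\<^sub>R (LINT t|lebesgue. of_real (\<delta> ^ n) * (indicator {0..1} t *\<^sub>R iterated_integral 1 n (\<lambda>ts. F (c + \<delta> * t + \<delta> * sum_list ts))))"
    using assms by (intro arg_cong[where f = "\<lambda>z. \<delta> *\<^sub>R z"] Bochner_Integration.integral_cong)
      (auto simp: indicator_def zero_le_mult_iff)
  also have "\<dots> = of_real (\<delta> ^ Suc n) * (LINT t|lebesgue. indicator {0..1} t *\<^sub>R iterated_integral 1 n (\<lambda>ts. F (c + \<delta> * t + \<delta> * sum_list ts)))"
    by (subst integral_mult_right_zero) (simp add: scaleR_conv_of_real)
  finally show ?case
    by (simp add: set_lebesgue_integral_def distrib_left add.assoc)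
qed simp

definition unit_box :: "real \<Rightarrow> real" where "unit_box = indicator {0..1}"

lemma unit_box_measurable [measurable]: "unit_box \<in> borel_measurable borel" unfolding unit_box_def by measurable

lemma unit_box_integrable: "integrable lborel unit_box" unfolding unit_box_def by simp

lemma iterated_integral_eq_conv_pow:
  assumes v: "bounded_borel v"
  shows "iterated_integral 1 n (\<lambda>ts. v (x - sum_list ts)) = (conv unit_box ^^ n) v x"
proof (induction n arbitrary: x)
  case (Suc n)
  have bb: "bounded_borel ((conv unit_box ^^ n) v)" for n
    by (induction n) (auto intro: v conv_bounded_borel unit_box_integrable)
  have [measurable]: "(conv unit_box ^^ n) v \<in> borel_measurable borel" using bb by (rule bounded_borel_measurable)
  have "iterated_integral 1 (Suc n) (\<lambda>ts. v (x - sum_list ts)) = (LINT t|lebesgue. indicator {0..1} t *\<^sub>R (conv unit_box ^^ n) v (x - t))"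
    using Suc[of "x - t" for t] by (simp add: set_lebesgue_integral_def diff_diff_eq)
  also have "\<dots> = (LINT t|lborel. indicator {0..1} t *\<^sub>R (conv unit_box ^^ n) v (x - t))"
    by (rule integral_completion) measurable
  also have "\<dots> = (conv unit_box ^^ Suc n) v x" by (simp add: conv_def unit_box_def)
  finally show ?case .
qed simp

text \<open>The density of a sum of \<open>n\<close> independent uniform variables on the unit interval, that is, a cardinal
B-spline.\<close>

lemma spline_density:
  assumes "1 \<le> n"
  shows "\<exists>M. M \<in> borel_measurable borel \<and> integrable lborel M \<and> (\<forall>s. 0 \<le> M s \<and> M s \<le> 1) \<and>
    (\<forall>s. s \<notin> {0..real n} \<longrightarrow> M s = 0) \<and> (\<forall>v x. bounded_borel v \<longrightarrow> (conv unit_box ^^ n) v x = conv M v x)"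
  using assms
proof (induction n rule: dec_induct)
  case base
  show ?case by (intro exI[of _ unit_box]) (auto simp: unit_box_integrable unit_box_def)
next
  case (step n)
  then obtain M where M: "M \<in> borel_measurable borel" "integrable lborel M" "\<And>s. 0 \<le> M s" "\<And>s. M s \<le> 1"
    "\<And>s. s \<notin> {0..real n} \<Longrightarrow> M s = 0" "\<And>v x. bounded_borel v \<Longrightarrow> (conv unit_box ^^ n) v x = conv M v x" by blast
  note [measurable] = M(1)
  define N where "N s = (LINT t|lborel. unit_box t * M (s - t))" for s
  have [measurable]: "N \<in> borel_measurable borel" unfolding N_def by measurable
  have int: "integrable lborel (\<lambda>t. unit_box t * M (s - t))" for s
    using M(3,4) by (intro Bochner_Integration.integrable_bound[OF unit_box_integrable] AE_I2)
      (auto simp: abs_mult intro!: mult_left_le)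
  have N01: "0 \<le> N s" "N s \<le> 1" for s
  proof -
    show "0 \<le> N s" unfolding N_def using M(3) by (intro integral_nonneg_AE AE_I2) (auto simp: unit_box_def)
    have "N s \<le> (LINT t|lborel. unit_box t)"
      unfolding N_def using M(4) by (intro integral_mono int unit_box_integrable) (auto simp: unit_box_def intro!: mult_left_le)
    also have "\<dots> = 1" by (simp add: unit_box_def)
    finally show "N s \<le> 1" .
  qed
  have N0: "N s = 0" if "s \<notin> {0..real (Suc n)}" for s
  proof -
    have "unit_box t * M (s - t) = 0" for t
      using that M(5)[of "s - t"] by (auto simp: unit_box_def indicator_def)
    then have "(\<lambda>t. unit_box t * M (s - t)) = (\<lambda>t. 0)" by (rule ext)
    then show ?thesis by (simp only: N_def integral_zero)
  qed
  have Nint: "integrable lborel N"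
  proof (rule Bochner_Integration.integrable_bound)
    show "integrable lborel (indicator {0..real (Suc n)} :: real \<Rightarrow> real)" by simp
    show "AE s in lborel. norm (N s) \<le> norm (indicator {0..real (Suc n)} s :: real)"
      using N01 N0 by (intro AE_I2) (auto simp: indicator_def)
  qed measurable
  have "(conv unit_box ^^ Suc n) v x = conv N v x" if v: "bounded_borel v" for v x
  proof -
    have "(conv unit_box ^^ Suc n) v x = conv unit_box (conv M v) x"
      using M(6)[OF v] by (simp add: conv_def[of unit_box])
    also have "\<dots> = conv N v x"
      unfolding N_def by (rule conv_conv[OF unit_box_integrable M(2) v])
    finally show ?thesis .
  qed
  with Nint N01 N0 show ?case by (intro exI[of _ N]) auto
qed

text \<open>Substituting \<open>y = - (m / r) * u\<close> in each term turns the Steklov average into a convolution with a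
bounded kernel of compact support. Since the spline has integral one, adding the term \<open>m = 0\<close> shows that
the error of the average is, up to sign, a mean of \<open>r\<close>-th differences with steps \<open>u / r\<close> of size at
most one.\<close>

lemma steklov_kernel:
  fixes r :: nat
  assumes r: "1 \<le> r"
  obtains \<kappa> C where "\<kappa> \<in> borel_measurable borel" "integrable lborel \<kappa>" "0 \<le> C" "\<And>u. \<bar>\<kappa> u\<bar> \<le> C * cauchy_kernel u"
    "\<forall>f g x. f \<in> borel_measurable lebesgue \<and> bounded_borel g \<and> (AE x in lborel. f x = g x)
      \<longrightarrow> steklov 1 r f x = conv \<kappa> g x"
    "\<forall>p v X. 1 < p \<and> bounded_borel v \<and> (\<forall>h. 0 < h \<and> h \<le> 1 \<longrightarrow> Lp_pow p lborel (fwd_difference r h v) \<le> X)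
      \<longrightarrow> Lp_pow p lborel (residual \<kappa> v) \<le> ennreal (2 powr p) * X"
proof -
  obtain M where M: "M \<in> borel_measurable borel" "integrable lborel M" "\<And>s. 0 \<le> M s" "\<And>s. M s \<le> 1"
    "\<And>s. s \<notin> {0..real r} \<Longrightarrow> M s = 0" "\<And>v x. bounded_borel v \<Longrightarrow> (conv unit_box ^^ r) v x = conv M v x"
    using spline_density[OF r] by blast
  note [measurable] = M(1)
  have M1: "(LINT u|lborel. M u) = 1"
  proof -
    have one: "(conv unit_box ^^ n) (\<lambda>_. 1) x = 1" for n x
    proof (induction n arbitrary: x)
      case (Suc n)
      then have "(conv unit_box ^^ n) (\<lambda>_. 1) = (\<lambda>_. 1)" by auto
      then have "(conv unit_box ^^ Suc n) (\<lambda>_. 1) x = conv unit_box (\<lambda>_. 1) x" by simp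
      also have "\<dots> = 1" unfolding conv_def unit_box_def by simp
      finally show ?case .
    qed simp
    have "bounded_borel (\<lambda>_. 1)" by (auto simp: bounded_borel_def)
    then have "conv M (\<lambda>_. 1) 0 = 1" using M(6) one by metis
    then have "complex_of_real (LINT u|lborel. M u) = 1"
      using M(2) by (simp add: conv_def scaleR_conv_of_real)
    then show ?thesis by simp
  qed
  define c where "c m = (-1) ^ (r - m + 1) * real (r choose m)" for m
  define \<kappa> where "\<kappa> y = (\<Sum>m=1..r. (-1) ^ r * c m * (real r / real m * M (- (real r / real m) * y)))" for y
  have \<kappa>_meas [measurable]: "\<kappa> \<in> borel_measurable borel" unfolding \<kappa>_def by measurable
  define C where "C = (\<Sum>m=1..r. \<bar>c m\<bar> * real r) * (1 + (real r)\<^sup>2)"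
  have C: "0 \<le> C" unfolding C_def by (intro mult_nonneg_nonneg sum_nonneg) auto
  have \<kappa>_le: "\<bar>\<kappa> y\<bar> \<le> C * cauchy_kernel y" for y
  proof -
    have M_le: "M (- (real r / real m) * y) \<le> (1 + (real r)\<^sup>2) * cauchy_kernel y" if m: "m \<in> {1..r}" for m
    proof (cases "M (- (real r / real m) * y) = 0")
      case False
      then have "- (real r / real m) * y \<in> {0..real r}" using M(5) by blast
      then have y: "y \<le> 0" "(- y) * real r \<le> real m * real r" using m r by (auto simp: field_simps mult_le_0_iff)
      have "- y \<le> real m" using r by (intro mult_right_le_imp_le[OF y(2)]) simp
      with y(1) have y: "y \<le> 0" "- y \<le> real m" by auto
      then have "\<bar>y\<bar> \<le> \<bar>real r\<bar>" using m by auto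
      then have "1 + y\<^sup>2 \<le> 1 + (real r)\<^sup>2" unfolding abs_le_square_iff by simp
      then have "1 \<le> (1 + (real r)\<^sup>2) * cauchy_kernel y"
        by (simp add: cauchy_kernel_def add_pos_nonneg)
      then show ?thesis using M(4) order_trans by blast
    qed simp
    have "\<bar>\<kappa> y\<bar> \<le> (\<Sum>m=1..r. \<bar>c m\<bar> * real r * ((1 + (real r)\<^sup>2) * cauchy_kernel y))"
      unfolding \<kappa>_def
    proof (rule order_trans[OF sum_abs sum_mono])
      fix m assume m: "m \<in> {1..r}"
      have "real r / real m \<le> real r / 1" using m by (intro divide_left_mono) auto
      then have "real r / real m * M (- (real r / real m) * y) \<le> real r * ((1 + (real r)\<^sup>2) * cauchy_kernel y)"
        using M_le[OF m] M(3) by (intro mult_mono) auto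
      then have "\<bar>c m\<bar> * (real r / real m * M (- (real r / real m) * y)) \<le> \<bar>c m\<bar> * (real r * ((1 + (real r)\<^sup>2) * cauchy_kernel y))"
        by (rule mult_left_mono) simp
      then show "\<bar>(-1) ^ r * c m * (real r / real m * M (- (real r / real m) * y))\<bar> \<le> \<bar>c m\<bar> * real r * ((1 + (real r)\<^sup>2) * cauchy_kernel y)"
        using M(3) by (simp add: abs_mult power_abs mult.assoc)
    qed
    also have "\<dots> = C * cauchy_kernel y" by (simp add: C_def sum_distrib_right mult.assoc)
    finally show ?thesis .
  qed
  have \<kappa>_int: "integrable lborel \<kappa>"
  proof (rule Bochner_Integration.integrable_bound)
    show "integrable lborel (\<lambda>x. C * cauchy_kernel x)" using cauchy_kernel_integrable by simp
    show "AE x in lborel. norm (\<kappa> x) \<le> norm (C * cauchy_kernel x)"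
      using \<kappa>_le C by (intro AE_I2) auto
  qed measurable
  define a where "a g m x = (LINT u|lborel. M u *\<^sub>R g (x + real m / real r * u))" for g :: "real \<Rightarrow> complex" and m x
  have a_int: "integrable lborel (\<lambda>u. M u *\<^sub>R g (x + real m / real r * u))" if g: "bounded_borel g" for g :: "real \<Rightarrow> complex" and m x
  proof -
    obtain B where B: "0 \<le> B" "\<And>x. norm (g x) \<le> B" using bounded_borelE[OF g] by blast
    have [measurable]: "g \<in> borel_measurable borel" using g by (rule bounded_borel_measurable)
    show ?thesis
    proof (rule Bochner_Integration.integrable_bound)
      show "integrable lborel (\<lambda>u. M u * B)" using M(2) by simp
      show "AE u in lborel. norm (M u *\<^sub>R g (x + real m / real r * u)) \<le> norm (M u * B)"
        using B M(3) by (intro AE_I2) (auto simp: abs_mult intro!: mult_left_mono)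
    qed measurable
  qed
  have a_subst: "a g m x = (LINT y|lborel. (real r / real m * M (- (real r / real m) * y)) *\<^sub>R g (x - y))"
    if m: "m \<in> {1..r}" for g :: "real \<Rightarrow> complex" and m x
  proof -
    have nz: "real m \<noteq> 0" "real r \<noteq> 0" using m by auto
    have "a g m x = \<bar>- (real r / real m)\<bar> *\<^sub>R (LINT y|lborel. M (0 + - (real r / real m) * y) *\<^sub>R g (x + real m / real r * (0 + - (real r / real m) * y)))"
      unfolding a_def using nz by (intro lborel_integral_real_affine) simp
    also have "\<dots> = (LINT y|lborel. (real r / real m * M (- (real r / real m) * y)) *\<^sub>R g (x - y))"
      using nz by (subst integral_scaleR_right[symmetric]) simp
    finally show ?thesis .
  qed
  have conv_\<kappa>: "conv \<kappa> g x = (\<Sum>m=1..r. of_real ((-1) ^ r * c m) * a g m x)" if g: "bounded_borel g" for g x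
  proof -
    have int: "integrable lborel (\<lambda>y. (real r / real m * M (- (real r / real m) * y)) *\<^sub>R g (x - y))" if m: "m \<in> {1..r}" for m
    proof (rule conv_integrable[OF _ g])
      show "integrable lborel (\<lambda>y. real r / real m * M (- (real r / real m) * y))"
        using lborel_integrable_real_affine[OF M(2), of "- (real r / real m)" 0] m by simp
    qed
    have "conv \<kappa> g x = (LINT y|lborel. (\<Sum>m=1..r. ((-1) ^ r * c m) *\<^sub>R ((real r / real m * M (- (real r / real m) * y)) *\<^sub>R g (x - y))))"
      by (simp only: conv_def \<kappa>_def scaleR_sum_left scaleR_scaleR)
    also have "\<dots> = (\<Sum>m=1..r. LINT y|lborel. ((-1) ^ r * c m) *\<^sub>R ((real r / real m * M (- (real r / real m) * y)) *\<^sub>R g (x - y)))"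
      by (intro Bochner_Integration.integral_sum integrable_scaleR_right int)
    also have "\<dots> = (\<Sum>m=1..r. of_real ((-1) ^ r * c m) * a g m x)"
      by (intro sum.cong refl) (simp only: integral_scaleR_right a_subst, simp only: scaleR_conv_of_real)
    finally show ?thesis .
  qed
  have stek: "steklov 1 r f x = conv \<kappa> g x"
    if f: "f \<in> borel_measurable lebesgue" and g: "bounded_borel g" and ae: "AE x in lborel. f x = g x" for f g x
  proof -
    have [measurable]: "g \<in> borel_measurable borel" using g by (rule bounded_borel_measurable)
    define F where "F h s = (\<Sum>m=1..r. (-1) ^ (r - m + 1) * of_nat (r choose m) * h (x + real m / real r * s))" for h :: "real \<Rightarrow> complex" and s
    have Fg [measurable]: "F g \<in> borel_measurable borel" unfolding F_def by measurable
    have Ff: "F f \<in> borel_measurable lebesgue"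
      unfolding F_def by (intro borel_measurable_sum borel_measurable_times borel_measurable_const measurable_lebesgue_affine f) auto
    have Fg': "F g \<in> borel_measurable lebesgue" using measurable_completion[of "F g" lborel borel] by simp
    have Fae: "AE s in lborel. F f s = F g s"
    proof -
      have "AE s in lborel. \<forall>m\<in>{1..r}. f (x + real m / real r * s) = g (x + real m / real r * s)"
        by (intro AE_finite_allI AE_lborel_affine ae) auto
      then show ?thesis by eventually_elim (simp add: F_def)
    qed
    obtain n where n: "r = Suc n" using r by (cases r) auto
    have v: "bounded_borel (\<lambda>y. F g (- y))"
    proof -
      obtain B where B: "0 \<le> B" "\<And>x. norm (g x) \<le> B" using bounded_borelE[OF g] by blast
      have "norm (F g (- y)) \<le> (\<Sum>m=1..r. real (r choose m) * B)" for y
        unfolding F_def using B by (intro sum_norm_le) (auto simp: norm_mult norm_power intro!: mult_left_mono)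
      then show ?thesis unfolding bounded_borel_def by (intro conjI exI allI) auto
    qed
    have sgn: "complex_of_real ((- 1) powi (- int r)) = (-1) ^ r"
      by (cases "even r") (simp_all add: power_int_minus)
    have "steklov 1 r f x = (-1) ^ r * iterated_integral 1 r (\<lambda>ts. F f (0 + sum_list ts))"
      unfolding steklov_def F_def sgn by simp
    also have "iterated_integral 1 r (\<lambda>ts. F f (0 + sum_list ts)) = iterated_integral 1 r (\<lambda>ts. F g (0 + sum_list ts))"
      unfolding n by (rule iterated_integral_cong_AE[OF Ff[unfolded n] Fg'[unfolded n] Fae[unfolded n]])
    also have "iterated_integral 1 r (\<lambda>ts. F g (0 + sum_list ts)) = conv M (\<lambda>y. F g (- y)) 0"
      using iterated_integral_eq_conv_pow[OF v, of r 0] M(6)[OF v] by simp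
    also have "\<dots> = (LINT u|lborel. (\<Sum>m=1..r. of_real (c m) * (M u *\<^sub>R g (x + real m / real r * u))))"
      unfolding conv_def F_def c_def by (simp add: scaleR_sum_right scaleR_conv_of_real sum_distrib_left mult_ac)
    also have "\<dots> = (\<Sum>m=1..r. of_real (c m) * a g m x)"
      unfolding a_def integral_mult_right_zero[symmetric]
      by (intro Bochner_Integration.integral_sum integrable_mult_right a_int g)
    also have "(-1) ^ r * \<dots> = conv \<kappa> g x"
      unfolding conv_\<kappa>[OF g] sum_distrib_left by (simp add: mult.assoc)
    finally show ?thesis .
  qed
  have res: "Lp_pow p lborel (residual \<kappa> v) \<le> ennreal (2 powr p) * X"
    if p: "1 < p" and v: "bounded_borel v"
      and X: "\<And>h. 0 < h \<Longrightarrow> h \<le> 1 \<Longrightarrow> Lp_pow p lborel (fwd_difference r h v) \<le> X" for p v X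
  proof -
    have [measurable]: "v \<in> borel_measurable borel" using v by (rule bounded_borel_measurable)
    define G where "G x u = (if u \<in> {0..real r} then fwd_difference r (u / real r) v x else 0)" for x u
    have G_meas [measurable]: "(\<lambda>(x, u). G x u) \<in> borel_measurable (lborel \<Otimes>\<^sub>M lborel)"
      unfolding G_def fwd_difference_def by measurable
    have resid: "residual \<kappa> v x = (-1) ^ r * (LINT u|lborel. M u *\<^sub>R G x u)" for x
    proof -
      have "M u *\<^sub>R G x u = (\<Sum>k=0..r. (of_nat (r choose k) * (-1) ^ (r - k)) * (M u *\<^sub>R v (x + real k / real r * u)))" for u
      proof (cases "u \<in> {0..real r}")
        case True
        then show ?thesis by (simp add: G_def fwd_difference_def scaleR_sum_right scaleR_conv_of_real sum_distrib_left mult_ac)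
      next
        case False
        then show ?thesis using M(5)[OF False] by simp
      qed
      then have "(LINT u|lborel. M u *\<^sub>R G x u) = (\<Sum>k=0..r. (of_nat (r choose k) * (-1) ^ (r - k)) * a v k x)"
        unfolding a_def integral_mult_right_zero[symmetric]
        by (simp only:) (intro Bochner_Integration.integral_sum integrable_mult_right a_int v)
      also have "\<dots> = (-1) ^ r * a v 0 x + (\<Sum>k=1..r. (of_nat (r choose k) * (-1) ^ (r - k)) * a v k x)"
        by (subst sum.atLeast_Suc_atMost) auto
      also have "a v 0 x = v x" using M1 M(2) by (simp add: a_def)
      also have "(\<Sum>k=1..r. (of_nat (r choose k) * (-1) ^ (r - k)) * a v k x) = - (\<Sum>k=1..r. of_real (c k) * a v k x)"
        unfolding sum_negf[symmetric] by (intro sum.cong refl) (simp add: c_def)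
      finally have L: "(LINT u|lborel. M u *\<^sub>R G x u) = (-1) ^ r * v x + - (\<Sum>k=1..r. of_real (c k) * a v k x)" .
      have "(-1) ^ r * (LINT u|lborel. M u *\<^sub>R G x u)
         = ((-1) ^ r * (-1) ^ r) * v x - (-1) ^ r * (\<Sum>k=1..r. of_real (c k) * a v k x)"
        unfolding L by (simp only: distrib_left mult.assoc mult_minus_right) simp
      also have "(-1) ^ r * (\<Sum>k=1..r. of_real (c k) * a v k x) = (\<Sum>k=1..r. of_real ((-1) ^ r * c k) * a v k x)"
        by (simp add: sum_distrib_left mult.assoc)
      also have "(-1 :: complex) ^ r * (-1) ^ r = 1" by (simp flip: power_mult_distrib)
      finally show ?thesis unfolding residual_def conv_\<kappa>[OF v] by simp
    qed
    have nnM: "(\<integral>\<^sup>+u. ennreal \<bar>M u\<bar> \<partial>lborel) \<le> ennreal 1"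
      using M(2,3) M1 by (simp add: nn_integral_eq_integral)
    have "Lp_pow p lborel (residual \<kappa> v) = Lp_pow p lborel (\<lambda>x. LINT u|lborel. M u *\<^sub>R G x u)"
      unfolding Lp_pow_def resid by (simp add: norm_mult norm_power)
    also have "\<dots> \<le> ennreal (2 powr p * 1 powr p) * X"
    proof (rule Lp_pow_weighted_integral[OF p, where w = "\<lambda>_. 1"])
      fix u
      show "Lp_pow p lborel (\<lambda>x. G x u) \<le> 1 * X"
      proof (cases "u \<in> {0..real r}")
        case True
        then have "\<bar>u / real r\<bar> \<le> 1" using r by simp
        from Lp_pow_fwd_difference_sign[OF r v this X] True show ?thesis by (simp add: G_def)
      next
        case False
        then have "G x u = 0" for x by (simp only: G_def if_False)
        then show ?thesis by (simp add: Lp_pow_def)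
      qed
    qed (use nnM in auto)
    finally show ?thesis by simp
  qed
  show ?thesis
  proof (rule that[OF \<kappa>_meas \<kappa>_int C \<kappa>_le])
    show "\<forall>f g x. f \<in> borel_measurable lebesgue \<and> bounded_borel g \<and> (AE x in lborel. f x = g x)
      \<longrightarrow> steklov 1 r f x = conv \<kappa> g x" using stek by blast
    show "\<forall>p v X. 1 < p \<and> bounded_borel v \<and> (\<forall>h. 0 < h \<and> h \<le> 1 \<longrightarrow> Lp_pow p lborel (fwd_difference r h v) \<le> X)
      \<longrightarrow> Lp_pow p lborel (residual \<kappa> v) \<le> ennreal (2 powr p) * X" using res by blast
  qed
qed

section \<open>The estimate at unit scale\<close>

lemma borel_version:
  fixes f :: "real \<Rightarrow> complex"
  assumes f: "f \<in> borel_measurable lebesgue" and b: "bounded (range f)"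
  obtains g where "bounded_borel g" "AE x in lborel. f x = g x"
proof -
  have "(\<lambda>x. Re (f x)) \<in> borel_measurable lebesgue" "(\<lambda>x. Im (f x)) \<in> borel_measurable lebesgue"
    using f by measurable
  then obtain g1 g2 where g: "g1 \<in> borel_measurable lborel" "AE x in lborel. Re (f x) = g1 x"
      "g2 \<in> borel_measurable lborel" "AE x in lborel. Im (f x) = g2 x"
    using completion_ex_borel_measurable_real by metis
  obtain B where B: "\<And>x. norm (f x) \<le> B" using b by (auto simp: bounded_iff)
  \<comment> \<open>Truncation restores the bound on the null set where the versions of the parts differ.\<close>
  define g where "g x = (if norm (Complex (g1 x) (g2 x)) \<le> B then Complex (g1 x) (g2 x) else 0)" for x
  have [measurable]: "g1 \<in> borel_measurable borel" "g2 \<in> borel_measurable borel" using g by simp_all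
  have "g \<in> borel_measurable borel" unfolding g_def Complex_eq by measurable
  moreover have "norm (g x) \<le> \<bar>B\<bar>" for x by (auto simp: g_def)
  ultimately have "bounded_borel g" unfolding bounded_borel_def by blast
  moreover have "AE x in lborel. f x = g x"
    using g(2,4)
  proof eventually_elim
    case (elim x)
    then have "Complex (g1 x) (g2 x) = f x" by (simp add: complex_eq_iff)
    then show ?case using B[of x] by (simp add: g_def)
  qed
  ultimately show ?thesis by (rule that)
qed

lemma Lp_pow_lebesgue_eq:
  assumes "AE x in lborel. f x = g x" and [measurable]: "g \<in> borel_measurable borel"
  shows "Lp_pow p lebesgue f = Lp_pow p lborel g"
proof -
  have "Lp_pow p lebesgue f = Lp_pow p lebesgue g"
    using assms(1) by (intro Lp_pow_cong_AE) (simp add: AE_completion_iff)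
  also have "\<dots> = Lp_pow p lborel g"
    unfolding Lp_pow_def by (rule nn_integral_completion) measurable
  finally show ?thesis .
qed

lemma residual_commute:
  assumes K: "integrable lborel K" and L: "integrable lborel L" and v: "bounded_borel v"
  shows "residual K (residual L v) = residual L (residual K v)"
proof
  fix x
  show "residual K (residual L v) x = residual L (residual K v) x"
    unfolding residual_def
    by (simp add: conv_diff[OF K v conv_bounded_borel[OF L v]] conv_diff[OF L v conv_bounded_borel[OF K v]] conv_commute[OF K L v])
qed

lemma residual_pow_commute:
  assumes "integrable lborel K" "integrable lborel L" "bounded_borel v"
  shows "(residual K ^^ n) (residual L v) = residual L ((residual K ^^ n) v)"
  by (induction n) (simp_all add: residual_commute residual_pow_bounded_borel assms)

text \<open>The geometric series \<open>P * (I + R + \<dots> + R\<^bsup>n - 1\<^esup>) = I - R\<^sup>n\<close> with \<open>P = I - R\<close>. It shows that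
\<open>I - R\<^sup>n\<close> is itself a convolution with the band-limited kernel \<open>K\<close>, hence reproduced by sampling.\<close>

lemma residual_pow_geometric:
  assumes K: "integrable lborel K" and v: "bounded_borel v"
  shows "conv K (\<lambda>y. \<Sum>i<n. (residual K ^^ i) v y) x = v x - (residual K ^^ n) v x"
proof -
  have "conv K (\<lambda>y. \<Sum>i<n. (residual K ^^ i) v y) x = (\<Sum>i<n. conv K ((residual K ^^ i) v) x)"
    by (rule conv_sum[OF K]) (rule residual_pow_bounded_borel[OF K v])
  also have "\<dots> = (\<Sum>i<n. (residual K ^^ i) v x - (residual K ^^ Suc i) v x)"
    by (simp add: residual_def)
  also have "\<dots> = v x - (residual K ^^ n) v x"
    by (induction n) simp_all
  finally show ?thesis .
qed

lemma Lp_pow_residual_sum: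
  assumes p: "1 < p" and K: "integrable lborel K" and A: "0 < A" and KA: "(\<integral>\<^sup>+u. ennreal \<bar>K u\<bar> \<partial>lborel) \<le> ennreal A"
  obtains c where "c < \<infinity>" "\<And>v. bounded_borel v \<Longrightarrow>
    Lp_pow p lborel (\<lambda>y. \<Sum>i<n. (residual K ^^ i) v y) \<le> c * Lp_pow p lborel v"
proof -
  have [measurable]: "K \<in> borel_measurable borel" using K by auto
  define q where "q = ennreal (2 powr p) * (1 + ennreal (2 powr p * A powr p))"
  have one: "Lp_pow p lborel (residual K v) \<le> q * Lp_pow p lborel v" if v: "bounded_borel v" for v
  proof -
    have "Lp_pow p lborel (residual K v) \<le> ennreal (2 powr p) * (Lp_pow p lborel v + Lp_pow p lborel (conv K v))"
      unfolding residual_def[abs_def] using p bounded_borel_measurable[OF v] bounded_borel_measurable[OF conv_bounded_borel[OF K v]]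
      by (intro Lp_pow_diff) auto
    also have "\<dots> \<le> ennreal (2 powr p) * (Lp_pow p lborel v + ennreal (2 powr p * A powr p) * Lp_pow p lborel v)"
      by (intro mult_left_mono add_left_mono Lp_pow_conv p A v KA) auto
    finally show ?thesis by (simp add: q_def algebra_simps)
  qed
  have pow: "Lp_pow p lborel ((residual K ^^ i) v) \<le> q ^ i * Lp_pow p lborel v" if v: "bounded_borel v" for i v
  proof (induction i)
    case (Suc i)
    have "Lp_pow p lborel ((residual K ^^ Suc i) v) \<le> q * Lp_pow p lborel ((residual K ^^ i) v)"
      using one[OF residual_pow_bounded_borel[OF K v]] by simp
    also have "\<dots> \<le> q * (q ^ i * Lp_pow p lborel v)" by (intro mult_left_mono Suc) simp
    finally show ?case by (simp add: mult.assoc)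
  qed simp
  have q1: "q < \<infinity>" by (simp add: q_def ennreal_mult_less_top)
  define c where "c = ennreal (real n powr p) * (\<Sum>i<n. q ^ i)"
  have "Lp_pow p lborel (\<lambda>y. \<Sum>i<n. (residual K ^^ i) v y) \<le> c * Lp_pow p lborel v" if v: "bounded_borel v" for v
  proof -
    have "Lp_pow p lborel (\<lambda>y. \<Sum>i<n. (residual K ^^ i) v y)
        \<le> ennreal (real (card {..<n}) powr p) * (\<Sum>i<n. Lp_pow p lborel ((residual K ^^ i) v))"
      using p bounded_borel_measurable[OF residual_pow_bounded_borel[OF K v]] by (intro Lp_pow_sum) auto
    also have "\<dots> \<le> ennreal (real (card {..<n}) powr p) * (\<Sum>i<n. q ^ i * Lp_pow p lborel v)"
      by (intro mult_left_mono sum_mono pow v) simp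
    finally show ?thesis by (simp add: c_def sum_distrib_right mult.assoc)
  qed
  moreover have "c < \<infinity>"
  proof -
    have "(\<Sum>i<n. q ^ i) < \<infinity>"
      using q1 by (simp add: power_less_top_ennreal)
    then show ?thesis by (simp add: c_def ennreal_mult_less_top)
  qed
  ultimately show ?thesis using that by blast
qed

text \<open>The decomposition \<open>f - S f = R - (S e + S s)\<close> almost everywhere, with \<open>R = f - \<Phi> f\<close>, with
\<open>e\<close> the samples of \<open>\<kappa> * f - \<Phi> f\<close> and \<open>s\<close> those of \<open>f - \<kappa> * f\<close>. The function \<open>f\<close> is replaced by a Borel
version \<open>g\<close> wherever only integrals enter; its samples at the integers are kept.\<close>

lemma unit_scale_bound:
  fixes p :: real and r :: nat
  assumes r: "1 \<le> r" and p: "1 < p"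
  obtains C where "C < \<infinity>"
    "\<And>f X. f \<in> borel_measurable lebesgue \<Longrightarrow> bounded (range f) \<Longrightarrow> Lp_pow p lebesgue f < \<infinity> \<Longrightarrow>
      Lp_pow p Z (\<lambda>k. f (of_int k)) < \<infinity> \<Longrightarrow>
      (\<And>h. 0 < h \<Longrightarrow> h \<le> 1 \<Longrightarrow> Lp_pow p lebesgue (fwd_difference r h f) \<le> X) \<Longrightarrow>
      Lp_pow p lebesgue (\<lambda>t. f t - sinc_series (\<lambda>k. f (of_int k)) t)
        \<le> C * (Lp_pow p Z (\<lambda>k. steklov 1 r f (of_int k) - f (of_int k)) + X)"
proof -
  \<comment> \<open>Dividing a step into \<open>n\<close> parts costs \<open>n\<^bsup>p + 1\<^esup>\<close>; the kernel must integrate this growth.\<close>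
  define D where "D = nat \<lceil>p + 1\<rceil>"
  have D: "p + 1 \<le> real D" using p by (simp add: D_def)
  define K where "K = theta (Suc D)"
  note K_int = theta_integrable[of D, folded K_def] and K_one = theta_integral[of D, folded K_def]
  have [measurable]: "K \<in> borel_measurable borel" unfolding K_def by (rule theta_measurable)
  obtain c where c: "0 < c" "\<And>x. \<bar>K x\<bar> * (1 + \<bar>x\<bar>) ^ D \<le> c * cauchy_kernel x"
    using theta_weight_le unfolding K_def by blast
  have K_le: "\<bar>K x\<bar> \<le> c * cauchy_kernel x" for x
  proof -
    have "\<bar>K x\<bar> * 1 \<le> \<bar>K x\<bar> * (1 + \<bar>x\<bar>) ^ D" by (intro mult_left_mono one_le_power) auto
    then show ?thesis using c(2)[of x] by simp
  qed
  define w where "w = diff_weight r D"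
  have w_meas [measurable]: "w \<in> borel_measurable borel" unfolding w_def diff_weight_def[abs_def] by measurable
  define A where "A = real (r + 2) ^ D * c * pi"
  have A: "0 < A" unfolding A_def using c by (intro mult_pos_pos zero_less_power) auto
  have Kw_le: "\<bar>K u\<bar> * w u \<le> real (r + 2) ^ D * c * cauchy_kernel u" for u
  proof -
    have "\<bar>K u\<bar> * w u = real (r + 2) ^ D * (\<bar>K u\<bar> * (1 + \<bar>u\<bar>) ^ D)"
      by (simp only: w_def diff_weight_def power_mult_distrib mult_ac)
    also have "\<dots> \<le> real (r + 2) ^ D * (c * cauchy_kernel u)" by (intro mult_left_mono c) simp
    finally show ?thesis by (simp add: mult.assoc)
  qed
  have Kw: "(\<integral>\<^sup>+u. ennreal \<bar>K u\<bar> * ennreal (w u) \<partial>lborel) \<le> ennreal A"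
  proof -
    have "(\<integral>\<^sup>+u. ennreal \<bar>K u\<bar> * ennreal (w u) \<partial>lborel) \<le> (\<integral>\<^sup>+u. ennreal (real (r + 2) ^ D * c) * ennreal (cauchy_kernel u) \<partial>lborel)"
    proof (rule nn_integral_mono)
      fix u
      have "ennreal \<bar>K u\<bar> * ennreal (w u) = ennreal (\<bar>K u\<bar> * w u)"
        by (rule ennreal_mult'[symmetric]) simp
      also have "\<dots> \<le> ennreal (real (r + 2) ^ D * c * cauchy_kernel u)" by (rule ennreal_leI[OF Kw_le])
      also have "\<dots> = ennreal (real (r + 2) ^ D * c) * ennreal (cauchy_kernel u)"
        by (rule ennreal_mult'') simp
      finally show "ennreal \<bar>K u\<bar> * ennreal (w u) \<le> ennreal (real (r + 2) ^ D * c) * ennreal (cauchy_kernel u)" .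
    qed
    also have "\<dots> = ennreal (real (r + 2) ^ D * c) * (\<integral>\<^sup>+u. ennreal (cauchy_kernel u) \<partial>lborel)"
      by (intro nn_integral_cmult) measurable
    also have "\<dots> \<le> ennreal (real (r + 2) ^ D * c) * ennreal pi"
      by (intro mult_left_mono nn_integral_cauchy_kernel) simp
    also have "\<dots> = ennreal A" by (simp add: A_def ennreal_mult'')
    finally show ?thesis .
  qed
  have KA: "(\<integral>\<^sup>+u. ennreal \<bar>K u\<bar> \<partial>lborel) \<le> ennreal A"
  proof -
    have "ennreal \<bar>K u\<bar> * 1 \<le> ennreal \<bar>K u\<bar> * ennreal (w u)" for u
      using diff_weight_ge_1[of r D u] by (intro mult_left_mono) (simp_all add: w_def)
    then have "(\<integral>\<^sup>+u. ennreal \<bar>K u\<bar> \<partial>lborel) \<le> (\<integral>\<^sup>+u. ennreal \<bar>K u\<bar> * ennreal (w u) \<partial>lborel)"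
      by (intro nn_integral_mono) simp
    then show ?thesis using Kw by (rule order_trans)
  qed
  obtain \<kappa> C\<^sub>\<kappa> where \<kappa>: "\<kappa> \<in> borel_measurable borel" "integrable lborel \<kappa>" "0 \<le> C\<^sub>\<kappa>" "\<And>u. \<bar>\<kappa> u\<bar> \<le> C\<^sub>\<kappa> * cauchy_kernel u"
    "\<forall>f g x. f \<in> borel_measurable lebesgue \<and> bounded_borel g \<and> (AE x in lborel. f x = g x)
      \<longrightarrow> steklov 1 r f x = conv \<kappa> g x"
    "\<forall>p v X. 1 < p \<and> bounded_borel v \<and> (\<forall>h. 0 < h \<and> h \<le> 1 \<longrightarrow> Lp_pow p lborel (fwd_difference r h v) \<le> X)
      \<longrightarrow> Lp_pow p lborel (residual \<kappa> v) \<le> ennreal (2 powr p) * X"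
    by (rule steklov_kernel[OF r]) (rule that)
  obtain c\<^sub>\<Psi> where c\<^sub>\<Psi>: "c\<^sub>\<Psi> < \<infinity>" "\<And>v. bounded_borel v \<Longrightarrow>
    Lp_pow p lborel (\<lambda>y. \<Sum>i<r. (residual K ^^ i) v y) \<le> c\<^sub>\<Psi> * Lp_pow p lborel v"
    using Lp_pow_residual_sum[OF p K_int A KA] by metis
  obtain c\<^sub>S where c\<^sub>S: "\<And>d. Lp_pow p Z d < \<infinity> \<Longrightarrow> Lp_pow p lborel (sinc_series d) \<le> ennreal c\<^sub>S * Lp_pow p Z d"
    using sinc_series_bounded[OF p] by metis
  define t where "t = ennreal (2 powr p)"
  define c\<^sub>R where "c\<^sub>R = ennreal (2 powr p * A powr p) ^ r * ennreal ((2 ^ r) powr (p + 1))"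
  define k\<^sub>\<kappa> where "k\<^sub>\<kappa> = ennreal (C\<^sub>\<kappa> powr p * (2 powr p * (3 * pi) powr p))"
  define k\<^sub>K where "k\<^sub>K = ennreal (c powr p * (2 powr p * (3 * pi) powr p))"
  define c\<^sub>G where "c\<^sub>G = t * (k\<^sub>\<kappa> * c\<^sub>R + k\<^sub>K * (c\<^sub>\<Psi> * t))"
  define C where "C = t * c\<^sub>R + t * (t * (ennreal c\<^sub>S * c\<^sub>G)) + t * (t * ennreal c\<^sub>S)"
  have fin: "t < \<infinity>" "c\<^sub>R < \<infinity>" "k\<^sub>\<kappa> < \<infinity>" "k\<^sub>K < \<infinity>"
    by (simp_all add: t_def c\<^sub>R_def k\<^sub>\<kappa>_def k\<^sub>K_def ennreal_mult_less_top power_less_top_ennreal)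
  then have "c\<^sub>G < \<infinity>" using c\<^sub>\<Psi>(1) by (simp add: c\<^sub>G_def ennreal_mult_less_top)
  then have C_fin: "C < \<infinity>" using fin by (simp add: C_def ennreal_mult_less_top)
  have "Lp_pow p lebesgue (\<lambda>t. f t - sinc_series (\<lambda>k. f (of_int k)) t)
        \<le> C * (Lp_pow p Z (\<lambda>k. steklov 1 r f (of_int k) - f (of_int k)) + X)"
    if f: "f \<in> borel_measurable lebesgue" and fb: "bounded (range f)" and fp: "Lp_pow p lebesgue f < \<infinity>"
      and fZ: "Lp_pow p Z (\<lambda>k. f (of_int k)) < \<infinity>"
      and X: "\<And>h. 0 < h \<Longrightarrow> h \<le> 1 \<Longrightarrow> Lp_pow p lebesgue (fwd_difference r h f) \<le> X" for f X
  proof -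
    obtain g where g: "bounded_borel g" and ae: "AE x in lborel. f x = g x"
      using borel_version[OF f fb] by metis
    have [measurable]: "g \<in> borel_measurable borel" using g by (rule bounded_borel_measurable)
    have gp: "Lp_pow p lborel g < \<infinity>" using fp Lp_pow_lebesgue_eq[OF ae] by simp
    have Xg: "Lp_pow p lborel (fwd_difference r h g) \<le> X" if "0 < h" "h \<le> 1" for h
    proof -
      have "AE x in lborel. \<forall>k\<in>{0..r}. f (real k * h + 1 * x) = g (real k * h + 1 * x)"
        by (intro AE_finite_allI AE_lborel_affine ae) auto
      then have "AE x in lborel. fwd_difference r h f x = fwd_difference r h g x"
        by eventually_elim (simp add: fwd_difference_def add.commute)
      then have "Lp_pow p lebesgue (fwd_difference r h f) = Lp_pow p lborel (fwd_difference r h g)"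
        by (rule Lp_pow_lebesgue_eq) (intro bounded_borel_measurable fwd_difference_bounded_borel g)
      with X[OF that] show ?thesis by simp
    qed
    define R where "R = (residual K ^^ r) g"
    have R_bb: "bounded_borel R" unfolding R_def by (rule residual_pow_bounded_borel[OF K_int g])
    have [measurable]: "R \<in> borel_measurable borel" using R_bb by (rule bounded_borel_measurable)
    have R_le: "Lp_pow p lborel R \<le> c\<^sub>R * X"
    proof -
      have "Lp_pow p lborel R \<le> ennreal (2 powr p * A powr p) ^ r * (ennreal ((2 ^ r) powr (p + 1)) * X)"
        unfolding R_def
      proof (rule Lp_pow_residual_pow[OF p K_int K_one A KA Kw w_meas _ _ g])
        show "Lp_pow p lborel (mixed_diff us g) \<le> ennreal (prod_list (map w us)) * (ennreal ((2 ^ r) powr (p + 1)) * X)"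
          if "length us = r" for us
          unfolding w_def using p by (intro Lp_pow_mixed_diff r D g that Xg) auto
      qed (use diff_weight_ge_1[of r D] in \<open>auto simp: w_def intro: order_trans[OF zero_le_one]\<close>)
      then show ?thesis by (simp add: c\<^sub>R_def mult.assoc)
    qed
    define \<Psi> where "\<Psi> = (\<lambda>v y. \<Sum>i<r. (residual K ^^ i) v y)"
    have \<Psi>_bb: "bounded_borel (\<Psi> v)" if "bounded_borel v" for v
      unfolding \<Psi>_def by (intro bounded_borel_sum residual_pow_bounded_borel[OF K_int that])
    have \<Psi>_le: "Lp_pow p lborel (\<Psi> v) \<le> c\<^sub>\<Psi> * Lp_pow p lborel v" if "bounded_borel v" for v
      unfolding \<Psi>_def by (rule c\<^sub>\<Psi>(2)[OF that])
    define \<phi> where "\<phi> = conv K (\<Psi> g)"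
    have \<phi>: "\<phi> x = g x - R x" for x
      unfolding \<phi>_def \<Psi>_def R_def by (rule residual_pow_geometric[OF K_int g])
    have \<Psi>g_fin: "Lp_pow p lborel (\<Psi> g) < \<infinity>"
      using \<Psi>_le[OF g] by (rule le_less_trans) (use c\<^sub>\<Psi>(1) gp in \<open>simp add: ennreal_mult_less_top\<close>)
    have samp: "sinc_series (\<lambda>k. \<phi> (of_int k)) x = \<phi> x" if "x \<notin> \<int>" for x
      using sampling_theorem_conv[OF p \<Psi>_bb[OF g] \<Psi>g_fin that, of D] by (simp add: \<phi>_def K_def)
    have K_Z: "Lp_pow p Z (\<lambda>k. conv K v (of_int k)) \<le> k\<^sub>K * Lp_pow p lborel v" if "bounded_borel v" for v
      unfolding k\<^sub>K_def using c by (intro Lp_pow_conv_integers p K_le that) auto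
    have \<kappa>_Z: "Lp_pow p Z (\<lambda>k. conv \<kappa> v (of_int k)) \<le> k\<^sub>\<kappa> * Lp_pow p lborel v" if "bounded_borel v" for v
      unfolding k\<^sub>\<kappa>_def by (intro Lp_pow_conv_integers p \<kappa> that)
    have \<phi>_fin: "Lp_pow p Z (\<lambda>k. \<phi> (of_int k)) < \<infinity>"
      unfolding \<phi>_def using K_Z[OF \<Psi>_bb[OF g]]
      by (rule le_less_trans) (use \<Psi>g_fin fin in \<open>simp add: ennreal_mult_less_top\<close>)
    define u where "u = residual \<kappa> g"
    have u_bb: "bounded_borel u" unfolding u_def by (rule residual_bounded_borel[OF \<kappa>(2) g])
    have u_le: "Lp_pow p lborel u \<le> t * X" unfolding u_def t_def using \<kappa>(6) p g Xg by blast
    have diff: "conv \<kappa> g x - \<phi> x = conv \<kappa> R x - conv K (\<Psi> u) x" for x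
    proof -
      have "conv K (\<Psi> u) x = u x - (residual K ^^ r) u x"
        unfolding \<Psi>_def by (rule residual_pow_geometric[OF K_int u_bb])
      also have "(residual K ^^ r) u = residual \<kappa> R"
        unfolding u_def R_def by (rule residual_pow_commute[OF K_int \<kappa>(2) g])
      finally have "conv K (\<Psi> u) x = u x - residual \<kappa> R x" .
      moreover have "u x = g x - conv \<kappa> g x" by (simp add: u_def residual_def)
      ultimately show ?thesis by (simp add: \<phi> residual_def)
    qed
    define e where "e = (\<lambda>k::int. conv \<kappa> g (of_int k) - \<phi> (of_int k))"
    have e_le: "Lp_pow p Z e \<le> c\<^sub>G * X"
    proof -
      have "Lp_pow p Z e \<le> t * (Lp_pow p Z (\<lambda>k. conv \<kappa> R (of_int k)) + Lp_pow p Z (\<lambda>k. conv K (\<Psi> u) (of_int k)))"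
        unfolding e_def diff t_def using p by (intro Lp_pow_diff) auto
      also have "\<dots> \<le> t * (k\<^sub>\<kappa> * (c\<^sub>R * X) + k\<^sub>K * (c\<^sub>\<Psi> * (t * X)))"
        by (intro mult_left_mono add_mono order_trans[OF \<kappa>_Z[OF R_bb]] order_trans[OF K_Z[OF \<Psi>_bb[OF u_bb]]]
          order_trans[OF \<Psi>_le[OF u_bb]] R_le u_le) auto
      finally show ?thesis by (simp add: c\<^sub>G_def algebra_simps)
    qed
    have \<kappa>g_fin: "Lp_pow p Z (\<lambda>k. conv \<kappa> g (of_int k)) < \<infinity>"
      using \<kappa>_Z[OF g] by (rule le_less_trans) (use gp fin in \<open>simp add: ennreal_mult_less_top\<close>)
    have e_fin: "Lp_pow p Z e < \<infinity>"
    proof -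
      have "Lp_pow p Z e \<le> ennreal (2 powr p) * (Lp_pow p Z (\<lambda>k. conv \<kappa> g (of_int k)) + Lp_pow p Z (\<lambda>k. \<phi> (of_int k)))"
        unfolding e_def using p by (intro Lp_pow_diff) auto
      then show ?thesis by (rule le_less_trans) (use \<kappa>g_fin \<phi>_fin in \<open>simp add: ennreal_mult_less_top\<close>)
    qed
    define s where "s = (\<lambda>k::int. f (of_int k) - conv \<kappa> g (of_int k))"
    have s_fin: "Lp_pow p Z s < \<infinity>"
    proof -
      have "Lp_pow p Z s \<le> ennreal (2 powr p) * (Lp_pow p Z (\<lambda>k. f (of_int k)) + Lp_pow p Z (\<lambda>k. conv \<kappa> g (of_int k)))"
        unfolding s_def using p by (intro Lp_pow_diff) auto
      then show ?thesis by (rule le_less_trans) (use \<kappa>g_fin fZ in \<open>simp add: ennreal_mult_less_top\<close>)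
    qed
    have es_fin: "Lp_pow p Z (\<lambda>k. e k + s k) < \<infinity>"
    proof -
      have "Lp_pow p Z (\<lambda>k. e k + s k) \<le> ennreal (2 powr p) * (Lp_pow p Z e + Lp_pow p Z s)"
        using p by (intro Lp_pow_add) auto
      then show ?thesis by (rule le_less_trans) (use e_fin s_fin in \<open>simp add: ennreal_mult_less_top\<close>)
    qed
    have s_eq: "Lp_pow p Z s = Lp_pow p Z (\<lambda>k. steklov 1 r f (of_int k) - f (of_int k))"
      using \<kappa>(5) f g ae by (simp add: s_def Lp_pow_def norm_minus_commute)
    have dec: "sinc_series (\<lambda>k. f (of_int k)) x = sinc_series (\<lambda>k. \<phi> (of_int k)) x + (sinc_series e x + sinc_series s x)" for x
    proof -
      have "sinc_series (\<lambda>k. f (of_int k)) x = sinc_series (\<lambda>k. \<phi> (of_int k) + (e k + s k)) x"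
        by (simp add: e_def s_def)
      also have "\<dots> = sinc_series (\<lambda>k. \<phi> (of_int k)) x + sinc_series (\<lambda>k. e k + s k) x"
        by (rule sinc_series_add[OF p \<phi>_fin es_fin])
      also have "sinc_series (\<lambda>k. e k + s k) x = sinc_series e x + sinc_series s x"
        by (rule sinc_series_add[OF p e_fin s_fin])
      finally show ?thesis .
    qed
    note [measurable] = sinc_series_measurable[OF p e_fin] sinc_series_measurable[OF p s_fin]
    have "AE x in lborel. f x - sinc_series (\<lambda>k. f (of_int k)) x = R x - (sinc_series e x + sinc_series s x)"
      using ae AE_not_integer
    proof eventually_elim
      case (elim x)
      show ?case using elim(1) samp[OF elim(2)] \<phi>[of x] dec[of x] by simp
    qed
    then have "Lp_pow p lebesgue (\<lambda>x. f x - sinc_series (\<lambda>k. f (of_int k)) x) = Lp_pow p lborel (\<lambda>x. R x - (sinc_series e x + sinc_series s x))"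
      by (rule Lp_pow_lebesgue_eq) measurable
    also have "\<dots> \<le> t * (Lp_pow p lborel R + Lp_pow p lborel (\<lambda>x. sinc_series e x + sinc_series s x))"
      unfolding t_def using p by (intro Lp_pow_diff) auto
    also have "\<dots> \<le> t * (Lp_pow p lborel R + t * (Lp_pow p lborel (sinc_series e) + Lp_pow p lborel (sinc_series s)))"
      unfolding t_def using p by (intro mult_left_mono add_left_mono Lp_pow_add) auto
    also have "\<dots> \<le> t * (c\<^sub>R * X + t * (ennreal c\<^sub>S * (c\<^sub>G * X) + ennreal c\<^sub>S * Lp_pow p Z s))"
      by (intro mult_left_mono add_mono R_le c\<^sub>S[OF s_fin] order_trans[OF c\<^sub>S[OF e_fin]] e_le) auto
    also have "\<dots> = (t * c\<^sub>R + t * (t * (ennreal c\<^sub>S * c\<^sub>G))) * X + (t * (t * ennreal c\<^sub>S)) * Lp_pow p Z s"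
      by (simp add: algebra_simps)
    also have "\<dots> \<le> C * X + C * Lp_pow p Z s"
      unfolding C_def
      by (intro add_mono mult_right_mono add_increasing2[OF zero_le order_refl] add_increasing[OF zero_le order_refl]) simp_all
    finally show ?thesis unfolding s_eq by (simp add: distrib_left add.commute)
  qed
  with C_fin show ?thesis using that by blast
qed

section \<open>Scaling and the passage from sequences to functions\<close>

lemma ennroot_ennpow: "ennroot p a = ennpow (1 / p) a"
  by (simp add: ennpow_def)

lemma ennpow_ennpow: "0 < p \<Longrightarrow> ennpow (1 / p) (ennpow p a) = a"
  by (cases a) (simp_all add: ennpow_ennreal powr_powr)

lemma ennpow_ennpow': "0 < p \<Longrightarrow> ennpow p (ennpow (1 / p) a) = a"
  by (cases a) (simp_all add: ennpow_ennreal powr_powr)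

lemma Lp_norm_eq: "Lp_norm p f = ennpow (1 / p) (Lp_pow p lebesgue f)"
  by (simp add: Lp_norm_def Lp_pow_def ennroot_ennpow)

lemma lp_norm_uniform_grid:
  assumes "0 < W"
  shows "lp_norm p (uniform_grid W) f = ennpow (1 / p) (ennreal (1 / W) * Lp_pow p Z (\<lambda>k. f (of_int k / W)))"
proof -
  have "(\<Sum>\<^sub>\<infinity>j. ennreal (norm (f (uniform_grid W j)) powr p * (uniform_grid W j - uniform_grid W (j - 1))))
     = (\<integral>\<^sup>+k. ennreal (1 / W) * ennreal (norm (f (of_int k / W)) powr p) \<partial>Z)"
    unfolding infsum_eq_nn_integral_int
  proof (rule nn_integral_cong)
    fix j :: int
    have "uniform_grid W j - uniform_grid W (j - 1) = 1 / W"
      by (simp add: uniform_grid_def diff_divide_distrib[symmetric])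
    then have "norm (f (uniform_grid W j)) powr p * (uniform_grid W j - uniform_grid W (j - 1)) = 1 / W * norm (f (of_int j / W)) powr p"
      by (simp only: mult.commute) (simp add: uniform_grid_def)
    then show "ennreal (norm (f (uniform_grid W j)) powr p * (uniform_grid W j - uniform_grid W (j - 1)))
      = ennreal (1 / W) * ennreal (norm (f (of_int j / W)) powr p)"
      using assms by (simp only: ennreal_mult') (intro ennreal_mult, auto)
  qed
  then show ?thesis by (simp add: lp_norm_def ennroot_ennpow Lp_pow_def nn_integral_cmult)
qed

lemma Lp_pow_lebesgue_scale:
  fixes f :: "real \<Rightarrow> complex"
  assumes f: "f \<in> borel_measurable lebesgue" and W: "0 < W"
  shows "Lp_pow p lebesgue f = ennreal (1 / W) * Lp_pow p lebesgue (\<lambda>x. f (x / W))"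
proof -
  have m: "(\<lambda>x. ennreal (norm (f x) powr p)) \<in> borel_measurable lebesgue" using f by measurable
  have "Lp_pow p lebesgue f = ennreal \<bar>1 / W\<bar> * (\<integral>\<^sup>+x. ennreal (norm (f (0 + 1 / W * x)) powr p) \<partial>lebesgue)"
    unfolding Lp_pow_def by (rule nn_integral_real_affine_lebesgue[OF m]) (use W in simp)
  then show ?thesis using W by (simp add: Lp_pow_def)
qed

lemma measurable_lebesgue_scale:
  fixes f :: "real \<Rightarrow> complex"
  assumes "f \<in> borel_measurable lebesgue" "0 < W"
  shows "(\<lambda>x. f (x / W)) \<in> borel_measurable lebesgue"
  using measurable_lebesgue_affine[OF assms(1), of "1 / W" 0] assms(2) by simp

text \<open>The factor \<open>W\<^sup>r\<close> of the average cancels the Jacobian of the \<open>r\<close>-fold integral.\<close>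

lemma steklov_scale:
  assumes W: "0 < W"
  shows "steklov (1 / W) r f (x / W) = steklov 1 r (\<lambda>y. f (y / W)) x"
proof -
  define F where "F s = (\<Sum>m=1..r. (-1) ^ (r - m + 1) * of_nat (r choose m) * f (x / W + real m / real r * s))" for s
  have "iterated_integral (1 / W) r (\<lambda>ts. F (0 + sum_list ts)) = of_real ((1 / W) ^ r) * iterated_integral 1 r (\<lambda>ts. F (0 + 1 / W * sum_list ts))"
    using W by (subst iterated_integral_scale) auto
  moreover have "(- (1 / W)) powi (- int r) * (1 / W) ^ r = (- 1) powi (- int r)"
  proof -
    have "(- (1 / W)) powi (- int r) = (- 1) powi (- int r) * (1 / W) powi (- int r)"
      using power_int_mult_distrib[of "- 1" "1 / W" "- int r"] by simp
    also have "(1 / W) powi (- int r) * (1 / W) ^ r = 1"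
      using W by (simp add: power_int_minus)
    then have "(- 1) powi (- int r) * (1 / W) powi (- int r) * (1 / W) ^ r = (- 1) powi (- int r)"
      by (simp only: mult.assoc mult_1_right)
    finally show ?thesis .
  qed
  then have "complex_of_real ((- (1 / W)) powi (- int r)) * of_real ((1 / W) ^ r) = complex_of_real ((- 1) powi (- int r))"
    by (simp only: of_real_mult[symmetric])
  ultimately have "complex_of_real ((- (1 / W)) powi (- int r)) * iterated_integral (1 / W) r (\<lambda>ts. F (0 + sum_list ts))
     = complex_of_real ((- 1) powi (- int r)) * iterated_integral 1 r (\<lambda>ts. F (0 + 1 / W * sum_list ts))"
    by (metis mult.assoc)
  moreover have "F (0 + 1 / W * s) = (\<Sum>m=1..r. (-1) ^ (r - m + 1) * of_nat (r choose m) * f ((x + real m / real r * s) / W))" for s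
    unfolding F_def by (simp add: add_divide_distrib)
  ultimately show ?thesis
    unfolding steklov_def F_def by simp
qed

lemma fwd_difference_scale:
  "W \<noteq> 0 \<Longrightarrow> fwd_difference r h f (x / W) = fwd_difference r (h * W) (\<lambda>y. f (y / W)) x"
  by (simp add: fwd_difference_def add_divide_distrib)

lemma sampling_series_scale:
  "W \<noteq> 0 \<Longrightarrow> sampling_series W f (x / W) = sinc_series (\<lambda>k. f (of_int k / W)) x"
  by (simp add: sampling_series_def sinc_series_def)

lemma fwd_difference_measurable_lebesgue:
  assumes "f \<in> borel_measurable lebesgue"
  shows "fwd_difference r h f \<in> borel_measurable lebesgue"
proof -
  have "(\<lambda>x. f (x + real k * h)) \<in> borel_measurable lebesgue" for k
    using measurable_lebesgue_affine[OF assms, of 1 "real k * h"] by (simp add: add.commute)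
  then show ?thesis
    unfolding fwd_difference_def[abs_def]
    by (intro borel_measurable_sum borel_measurable_times borel_measurable_const)
qed

lemma admissibleI:
  assumes "\<And>j. a \<le> \<Sigma> j - \<Sigma> (j - 1)" "\<And>j. \<Sigma> j - \<Sigma> (j - 1) \<le> b" "0 < a"
  shows "admissible \<Sigma>"
  unfolding admissible_def
proof
  have "0 < ereal a" using assms(3) by simp
  also have "ereal a \<le> (INF j. ereal (\<Sigma> j - \<Sigma> (j - 1)))" using assms(1) by (intro INF_greatest) simp
  finally show "0 < (INF j. ereal (\<Sigma> j - \<Sigma> (j - 1)))" .
  have "(SUP j. ereal (\<Sigma> j - \<Sigma> (j - 1))) \<le> ereal b" using assms(2) by (intro SUP_least) simp
  then show "(SUP j. ereal (\<Sigma> j - \<Sigma> (j - 1))) < \<infinity>" by (rule le_less_trans) simp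
qed

lemma ennpow_less_top: "ennpow p a < \<infinity> \<Longrightarrow> a < \<infinity>"
  by (cases a) auto

lemma Lambda_space_grid_finite:
  assumes f: "f \<in> Lambda_space p" and W: "0 < W"
  shows "Lp_pow p Z (\<lambda>k. f (of_int k / W)) < \<infinity>"
proof -
  have "admissible (uniform_grid W)"
    using W by (intro admissibleI[of "1 / W" _ "1 / W"]) (simp_all add: uniform_grid_def diff_divide_distrib[symmetric])
  then have "lp_norm p (uniform_grid W) f < \<infinity>" using f by (simp add: Lambda_space_def)
  then have "ennreal (1 / W) * Lp_pow p Z (\<lambda>k. f (of_int k / W)) < \<infinity>"
    unfolding lp_norm_uniform_grid[OF W] by (rule ennpow_less_top)
  then show ?thesis using W by (auto simp: ennreal_mult_less_top ennreal_eq_0_iff)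
qed

text \<open>If all values were below half of the mean, so would be the mean.\<close>

lemma cell_representative:
  fixes \<phi> :: "real \<Rightarrow> real"
  assumes "\<And>x. \<phi> x \<le> B" "\<And>x. 0 \<le> \<phi> x"
  shows "\<exists>x\<in>{a..<a + 1}. (\<integral>\<^sup>+x. ennreal (\<phi> x) * indicator {a..<a + 1} x \<partial>lebesgue) \<le> ennreal (2 * \<phi> x)"
proof (rule ccontr)
  let ?I = "\<integral>\<^sup>+x. ennreal (\<phi> x) * indicator {a..<a + 1} x \<partial>lebesgue"
  assume "\<not> ?thesis"
  then have less: "ennreal (2 * \<phi> x) < ?I" if "x \<in> {a..<a + 1}" for x using that by (auto simp: not_le)
  have em: "emeasure lebesgue {a..<a + 1} = 1" by simp
  have le: "?I \<le> ennreal c" if "\<And>x. x \<in> {a..<a + 1} \<Longrightarrow> \<phi> x \<le> c" for c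
  proof -
    have "?I \<le> (\<integral>\<^sup>+x. ennreal c * indicator {a..<a + 1} x \<partial>lebesgue)"
      using that by (intro nn_integral_mono) (auto simp: indicator_def intro!: ennreal_leI)
    also have "\<dots> = ennreal c" using em by (subst nn_integral_cmult_indicator) auto
    finally show ?thesis .
  qed
  have "?I \<le> ennreal B" using assms by (intro le)
  then obtain i where i: "0 \<le> i" "?I = ennreal i" by (cases ?I) (auto simp: top_unique)
  have "\<phi> x \<le> i / 2" if "x \<in> {a..<a + 1}" for x
    using less[OF that] i assms(2)[of x] by (simp add: ennreal_less_iff)
  then have "?I \<le> ennreal (i / 2)" by (rule le)
  then have "i = 0" using i by simp
  then show False using less[of a] i by simp
qed

text \<open>In each unit cell pick a point where \<open>\<bar>f\<bar>\<^sup>p\<close> is at least half of its mean. The points from the even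
cells have gaps between one and three and thus form an admissible sequence, and so do those from the
odd cells.\<close>

lemma Lambda_space_Lp:
  assumes p: "0 < p" and f: "f \<in> Lambda_space p"
  shows "Lp_pow p lebesgue f < \<infinity>"
proof -
  have fm: "f \<in> borel_measurable lebesgue" and fb: "bounded (range f)"
    using f by (auto simp: Lambda_space_def bounded_measurable_def)
  obtain B where B: "\<And>x. norm (f x) \<le> B" using fb by (auto simp: bounded_iff)
  let ?\<phi> = "\<lambda>x. norm (f x) powr p"
  define h where "h k = (\<integral>\<^sup>+x. ennreal (?\<phi> x) * indicator {real_of_int k..<real_of_int k + 1} x \<partial>lebesgue)" for k
  have "\<forall>k. \<exists>x\<in>{real_of_int k..<real_of_int k + 1}. h k \<le> ennreal (2 * ?\<phi> x)"
    unfolding h_def using p B by (intro allI cell_representative[where B = "B powr p"] powr_mono2) auto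
  then obtain x where x: "\<And>k. x k \<in> {real_of_int k..<real_of_int k + 1}" "\<And>k. h k \<le> ennreal (2 * ?\<phi> (x k))"
    by metis
  have sub: "(\<integral>\<^sup>+j. h (2 * j + q) \<partial>Z) < \<infinity>" for q
  proof -
    define \<Sigma> where "\<Sigma> j = x (2 * j + q)" for j
    have gap: "1 \<le> \<Sigma> j - \<Sigma> (j - 1)" "\<Sigma> j - \<Sigma> (j - 1) \<le> 3" for j
      using x(1)[of "2 * j + q"] x(1)[of "2 * (j - 1) + q"] by (auto simp: \<Sigma>_def)
    then have "admissible \<Sigma>" by (intro admissibleI[of 1 _ 3]) auto
    then have "lp_norm p \<Sigma> f < \<infinity>" using f by (simp add: Lambda_space_def)
    then have S: "(\<integral>\<^sup>+j. ennreal (?\<phi> (\<Sigma> j) * (\<Sigma> j - \<Sigma> (j - 1))) \<partial>Z) < \<infinity>"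
      unfolding lp_norm_def ennroot_ennpow infsum_eq_nn_integral_int by (rule ennpow_less_top)
    have "(\<integral>\<^sup>+j. h (2 * j + q) \<partial>Z) \<le> (\<integral>\<^sup>+j. 2 * ennreal (?\<phi> (\<Sigma> j) * (\<Sigma> j - \<Sigma> (j - 1))) \<partial>Z)"
    proof (rule nn_integral_mono)
      fix j
      have "?\<phi> (\<Sigma> j) * 1 \<le> ?\<phi> (\<Sigma> j) * (\<Sigma> j - \<Sigma> (j - 1))" using gap[of j] by (intro mult_left_mono) auto
      then have "ennreal (2 * ?\<phi> (\<Sigma> j)) \<le> ennreal (2 * (?\<phi> (\<Sigma> j) * (\<Sigma> j - \<Sigma> (j - 1))))"
        by (intro ennreal_leI) simp
      also have "\<dots> = 2 * ennreal (?\<phi> (\<Sigma> j) * (\<Sigma> j - \<Sigma> (j - 1)))"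
        by (subst ennreal_mult') auto
      finally show "h (2 * j + q) \<le> 2 * ennreal (?\<phi> (\<Sigma> j) * (\<Sigma> j - \<Sigma> (j - 1)))"
        using x(2)[of "2 * j + q"] by (simp add: \<Sigma>_def)
    qed
    also have "\<dots> = 2 * (\<integral>\<^sup>+j. ennreal (?\<phi> (\<Sigma> j) * (\<Sigma> j - \<Sigma> (j - 1))) \<partial>Z)"
      by (rule nn_integral_cmult) simp
    also have "\<dots> < \<infinity>" using S by (simp add: ennreal_mult_less_top)
    finally show ?thesis .
  qed
  have split: "(\<integral>\<^sup>+k. h k \<partial>Z) = (\<integral>\<^sup>+j. h (2 * j + 0) \<partial>Z) + (\<integral>\<^sup>+j. h (2 * j + 1) \<partial>Z)"
  proof -
    have b0: "bij_betw (\<lambda>j. 2 * j + 0) (UNIV :: int set) {k. even k}"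
      by (rule bij_betwI[where g = "\<lambda>k. k div 2"]) auto
    have b1: "bij_betw (\<lambda>j. 2 * j + 1) (UNIV :: int set) {k. odd k}"
      by (rule bij_betwI[where g = "\<lambda>k. k div 2"]) auto
    have "(\<integral>\<^sup>+k. h k \<partial>Z) = (\<integral>\<^sup>+k. h k * indicator {k. even k} k + h k * indicator {k. odd k} k \<partial>Z)"
      by (intro nn_integral_cong) (auto simp: indicator_def)
    also have "\<dots> = (\<integral>\<^sup>+k. h k * indicator {k. even k} k \<partial>Z) + (\<integral>\<^sup>+k. h k * indicator {k. odd k} k \<partial>Z)"
      by (rule nn_integral_add) auto
    also have "\<dots> = (\<integral>\<^sup>+k. h k \<partial>count_space {k. even k}) + (\<integral>\<^sup>+k. h k \<partial>count_space {k. odd k})"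
      by (simp add: nn_integral_count_space_indicator)
    also have "\<dots> = (\<integral>\<^sup>+j. h (2 * j + 0) \<partial>Z) + (\<integral>\<^sup>+j. h (2 * j + 1) \<partial>Z)"
      by (simp only: nn_integral_bij_count_space[OF b0] nn_integral_bij_count_space[OF b1])
    finally show ?thesis .
  qed
  obtain g where g: "bounded_borel g" and ae: "AE x in lborel. f x = g x"
    using borel_version[OF fm fb] by metis
  have [measurable]: "g \<in> borel_measurable borel" using g by (rule bounded_borel_measurable)
  have "Lp_pow p lebesgue f = Lp_pow p lborel g" using ae by (rule Lp_pow_lebesgue_eq) measurable
  also have "\<dots> = (\<integral>\<^sup>+k. (\<integral>\<^sup>+x. ennreal (norm (g x) powr p) * indicator {real_of_int k..<real_of_int k + 1} x \<partial>lborel) \<partial>Z)"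
    unfolding Lp_pow_def by (rule nn_integral_unit_cells) measurable
  also have "\<dots> = (\<integral>\<^sup>+k. h k \<partial>Z)"
  proof (rule nn_integral_cong)
    fix k :: int
    have "h k = (\<integral>\<^sup>+x. ennreal (norm (g x) powr p) * indicator {real_of_int k..<real_of_int k + 1} x \<partial>lebesgue)"
      unfolding h_def using ae by (intro nn_integral_cong_AE) (auto simp: AE_completion_iff elim!: eventually_mono)
    also have "\<dots> = (\<integral>\<^sup>+x. ennreal (norm (g x) powr p) * indicator {real_of_int k..<real_of_int k + 1} x \<partial>lborel)"
      by (rule nn_integral_completion) measurable
    finally show "(\<integral>\<^sup>+x. ennreal (norm (g x) powr p) * indicator {real_of_int k..<real_of_int k + 1} x \<partial>lborel) = h k" ..
  qed
  also have "\<dots> < \<infinity>" unfolding split using sub[of 0] sub[of 1] by simp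
  finally show ?thesis .
qed

theorem theorem6p1:
  fixes r :: nat and p :: real
  assumes "1 \<le> r" and "1 < p"
  shows "\<exists>K\<^sub>1 C\<^sub>1 :: real. 0 < K\<^sub>1 \<and> 0 < C\<^sub>1 \<and>
    (\<forall>f \<in> Lambda_space p. \<forall>W > 0.
       Lp_norm p (\<lambda>t. f t - sampling_series W f t)
         \<le> ennreal K\<^sub>1 * lp_norm p (uniform_grid W) (\<lambda>x. steklov (1 / W) r f x - f x)
           + ennreal C\<^sub>1 * modulus_of_smoothness r f (1 / W) p \<and>
       Lp_norm p (\<lambda>t. f t - sampling_series W f t)
         \<le> ennreal (max K\<^sub>1 C\<^sub>1) * semi_discrete_modulus r f (1 / W) (uniform_grid W) p)"
proof -
  have p: "0 < p" "0 < 1 / p" using assms(2) by auto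
  obtain C where C: "C < \<infinity>"
    "\<And>f X. f \<in> borel_measurable lebesgue \<Longrightarrow> bounded (range f) \<Longrightarrow> Lp_pow p lebesgue f < \<infinity> \<Longrightarrow>
      Lp_pow p Z (\<lambda>k. f (of_int k)) < \<infinity> \<Longrightarrow>
      (\<And>h. 0 < h \<Longrightarrow> h \<le> 1 \<Longrightarrow> Lp_pow p lebesgue (fwd_difference r h f) \<le> X) \<Longrightarrow>
      Lp_pow p lebesgue (\<lambda>t. f t - sinc_series (\<lambda>k. f (of_int k)) t)
        \<le> C * (Lp_pow p Z (\<lambda>k. steklov 1 r f (of_int k) - f (of_int k)) + X)"
    by (rule unit_scale_bound[OF assms]) blast
  define K where "K = enn2real (ennpow (1 / p) C * ennreal (2 powr (1 / p))) + 1"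
  have K_pos: "0 < K" by (simp add: K_def add_nonneg_pos)
  have K_le: "ennpow (1 / p) C * ennreal (2 powr (1 / p)) \<le> ennreal K"
  proof -
    obtain c where "0 \<le> c" "C = ennreal c" using C(1) by (cases C) auto
    then have "ennpow (1 / p) C * ennreal (2 powr (1 / p)) = ennreal (c powr (1 / p) * 2 powr (1 / p))"
      by (simp add: ennpow_ennreal ennreal_mult)
    then show ?thesis by (simp add: K_def)
  qed
  have main: "Lp_norm p (\<lambda>t. f t - sampling_series W f t)
      \<le> ennreal K * (lp_norm p (uniform_grid W) (\<lambda>x. steklov (1 / W) r f x - f x) + modulus_of_smoothness r f (1 / W) p)"
    if f: "f \<in> Lambda_space p" and W: "0 < W" for f W
  proof -
    let ?m = "modulus_of_smoothness r f (1 / W) p" and ?w = "ennreal (1 / W)"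
    let ?fW = "\<lambda>x. f (x / W)"
    have fm: "f \<in> borel_measurable lebesgue" and fb: "bounded (range f)"
      using f by (auto simp: Lambda_space_def bounded_measurable_def)
    have fWm: "?fW \<in> borel_measurable lebesgue" by (rule measurable_lebesgue_scale[OF fm W])
    have fWb: "bounded (range ?fW)" using fb by (rule bounded_subset) auto
    have ww: "ennreal W * ?w = 1" using W by (simp flip: ennreal_mult)
    have unscale: "Lp_pow p lebesgue (\<lambda>x. v (x / W)) = ennreal W * Lp_pow p lebesgue v"
      if "v \<in> borel_measurable lebesgue" for v :: "real \<Rightarrow> complex"
      using Lp_pow_lebesgue_scale[OF that W, of p] ww by (simp flip: mult.assoc)
    have fWp: "Lp_pow p lebesgue ?fW < \<infinity>"
      unfolding unscale[OF fm] using Lambda_space_Lp[OF p(1) f] by (simp add: ennreal_mult_less_top)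
    have fZ: "Lp_pow p Z (\<lambda>k. ?fW (of_int k)) < \<infinity>"
      by (rule Lambda_space_grid_finite[OF f W])
    have X: "Lp_pow p lebesgue (fwd_difference r h ?fW) \<le> ennreal W * ennpow p ?m" if h: "0 < h" "h \<le> 1" for h
    proof -
      have "fwd_difference r h ?fW = (\<lambda>x. fwd_difference r (h / W) f (x / W))"
        using W by (auto simp: fwd_difference_scale)
      then have "Lp_pow p lebesgue (fwd_difference r h ?fW) = ennreal W * Lp_pow p lebesgue (fwd_difference r (h / W) f)"
        using unscale[OF fwd_difference_measurable_lebesgue[OF fm]] by simp
      also have "Lp_pow p lebesgue (fwd_difference r (h / W) f) = ennpow p (Lp_norm p (fwd_difference r (h / W) f))"
        unfolding Lp_norm_eq ennpow_ennpow'[OF p(1)] ..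
      also have "\<dots> \<le> ennpow p ?m"
        unfolding modulus_of_smoothness_def using h W p
        by (intro ennpow_mono SUP_upper) (auto simp: divide_right_mono)
      finally show ?thesis by (simp add: mult_left_mono)
    qed
    let ?Z = "Lp_pow p Z (\<lambda>k. steklov 1 r ?fW (of_int k) - ?fW (of_int k))"
    have S_meas: "(\<lambda>t. f t - sampling_series W f t) \<in> borel_measurable lebesgue"
    proof (rule borel_measurable_diff[OF fm])
      have "sinc_series (\<lambda>k. f (of_int k / W)) \<in> borel_measurable lebesgue"
        using measurable_completion[of _ lborel] sinc_series_measurable[OF assms(2) fZ] by simp
      from measurable_lebesgue_affine[OF this, of W 0] W
      show "sampling_series W f \<in> borel_measurable lebesgue"
        by (simp add: sampling_series_def[abs_def] sinc_series_def)
    qed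
    have "Lp_pow p lebesgue (\<lambda>t. f t - sampling_series W f t)
        = ?w * Lp_pow p lebesgue (\<lambda>x. ?fW x - sinc_series (\<lambda>k. ?fW (of_int k)) x)"
      using Lp_pow_lebesgue_scale[OF S_meas W, of p] W by (simp add: sampling_series_scale)
    also have "\<dots> \<le> ?w * (C * (?Z + ennreal W * ennpow p ?m))"
      by (intro mult_left_mono C(2) fWm fWb fWp fZ X) auto
    also have "\<dots> = C * (?w * ?Z + (ennreal W * ?w) * ennpow p ?m)"
      by (simp only: distrib_left mult_ac)
    finally have "Lp_pow p lebesgue (\<lambda>t. f t - sampling_series W f t) \<le> C * (?w * ?Z + ennpow p ?m)"
      by (simp only: ww mult_1_left)
    then have "Lp_norm p (\<lambda>t. f t - sampling_series W f t) \<le> ennpow (1 / p) (C * (?w * ?Z + ennpow p ?m))"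
      unfolding Lp_norm_eq by (rule ennpow_mono[OF p(2)])
    also have "\<dots> = ennpow (1 / p) C * ennpow (1 / p) (?w * ?Z + ennpow p ?m)" by (rule ennpow_mult)
    also have "\<dots> \<le> ennpow (1 / p) C * (ennreal (2 powr (1 / p)) * (ennpow (1 / p) (?w * ?Z) + ennpow (1 / p) (ennpow p ?m)))"
      by (intro mult_left_mono ennpow_add_le p) simp
    also have "ennpow (1 / p) (ennpow p ?m) = ?m" by (rule ennpow_ennpow[OF p(1)])
    also have "ennpow (1 / p) (?w * ?Z) = lp_norm p (uniform_grid W) (\<lambda>x. steklov (1 / W) r f x - f x)"
      unfolding lp_norm_uniform_grid[OF W] steklov_scale[OF W] ..
    also have "ennpow (1 / p) C * (ennreal (2 powr (1 / p)) * (lp_norm p (uniform_grid W) (\<lambda>x. steklov (1 / W) r f x - f x) + ?m))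
       \<le> ennreal K * (lp_norm p (uniform_grid W) (\<lambda>x. steklov (1 / W) r f x - f x) + ?m)"
      unfolding mult.assoc[symmetric] by (intro mult_right_mono K_le) simp
    finally show ?thesis .
  qed
  show ?thesis
    using K_pos main by (intro exI[of _ K]) (auto simp: distrib_left semi_discrete_modulus_def)
qed

end
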